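(* Let $K$ be a field and $\mathcal P$ an infinite set of primes. Then there exists a minimal and effective ample groupoid $\mathcal G$ such that $K\mathcal G$ is simple if and only if the characteristic of $K$ does not belong to $\mathcal P$ and, moreover, every isotropy group of $\mathcal G$ is uncountable (and hence $\mathcal G$ is not topologically principal). Moreover, $\mathcal G$ is the (contracted) universal groupoid of an inverse semigroup with zero.
   Context: A groupoid $\mathcal G$ is identified with its set of arrows; $\mathcal G^0\subseteq\mathcal G$ is the set of identities (unit space), $d,r$ are the domain and range maps, and $\alpha\beta$ is defined when $d(\alpha)=r(\beta)$. A topological groupoid is étale if $d$ is a local homeomorphism; $\mathcal G^0$ is always assumed locally compact Hausdorff, but $\mathcal G$ need not be Hausdorff. It is ample if moreover $\mathcal G^0$ has a basis of compact open sets. A local bisection is an open $U\subseteq\mathcal G$ such that $d|_U$, $r|_U$ are homeomorphisms onto their images. $\mathcal G$ is minimal if every orbit $\{r(g):d(g)=x\}$, $x\in\mathcal G^0$, is dense in $\mathcal G^0$; effective if the interior of $\{g:d(g)=r(g)\}$ equals $\mathcal G^0$; topologically principal if the set of $x\in\mathcal G^0$ with trivial isotropy group $\{g:d(g)=r(g)=x\}$ is dense in $\mathcal G^0$. The Steinberg algebra $K\mathcal G$ is the $K$-span in $K^{\mathcal G}$ of characteristic functions of compact local bisections, with convolution $(f*g)(\gamma)=\sum_{\alpha\beta=\gamma}f(\alpha)g(\beta)$. An algebra is simple if it is non-zero and has no two-sided ideals other than $0$ and itself. Universal groupoid. An inverse semigroup is a semigroup $S$ in which every $s$ has a unique $s^*$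 with $ss^*s=s$, $s^*ss^*=s^*$; $E(S)$ is its semilattice of idempotents and $s\le t$ means $s=ts^*s$. For $S$ with zero, $\widehat{E(S)}$ is the space (topology of pointwise convergence) of non-zero, zero-preserving homomorphisms $\theta:E(S)\to\{0,1\}$, and $D(e)=\{\theta:\theta(e)=1\}$. $S$ acts by partial homeomorphisms $\beta_s:D(s^*s)\to D(ss^* )$, $\beta_s(\theta)(e)=\theta(s^*es)$. The (contracted) universal groupoid $\mathcal G(S)$ has arrows the classes $[s,\theta]$ of pairs with $\theta\in D(s^*s)$, where $(s,\theta)\sim(t,\theta')$ iff $\theta=\theta'$ and there is $u\le s,t$ with $\theta\in D(u^*u)$; $d[s,\theta]=\theta$, $r[s,\theta]=\beta_s(\theta)$, $[s,\beta_t(\theta)][t,\theta]=[st,\theta]$; a basis of open sets is $(s,U)=\{[s,\theta]:\theta\in U\}$ with $U\subseteq D(s^*s)$ open. *)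

theory Defs
  imports "HOL-Analysis.Analysis" "HOL-Computational_Algebra.Primes"
begin

section \<open>Topological groupoids\<close>

text \<open>A groupoid is identified with its set of arrows, which is the underlying set of the
  topology; units are arrows, and \<open>gdom\<close>, \<open>grng\<close> take values in arrows.
  \<open>gmult G a b\<close> is meaningful only if \<open>gdom G a = grng G b\<close>.\<close>

record 'a top_groupoid =
  gtop :: "'a topology"
  gdom :: "'a \<Rightarrow> 'a"
  grng :: "'a \<Rightarrow> 'a"
  gmult :: "'a \<Rightarrow> 'a \<Rightarrow> 'a"

definition arrows :: "('a, 'b) top_groupoid_scheme \<Rightarrow> 'a set" where
  "arrows G = topspace (gtop G)"

definition units :: "('a, 'b) top_groupoid_scheme \<Rightarrow> 'a set" where
  "units G = {x \<in> arrows G. gdom G x = x}"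

definition composable :: "('a, 'b) top_groupoid_scheme \<Rightarrow> ('a \<times> 'a) set" where
  "composable G = {(a, b). a \<in> arrows G \<and> b \<in> arrows G \<and> gdom G a = grng G b}"

definition is_ginverse :: "('a, 'b) top_groupoid_scheme \<Rightarrow> 'a \<Rightarrow> 'a \<Rightarrow> bool" where
  "is_ginverse G a b \<longleftrightarrow> b \<in> arrows G \<and> gdom G b = grng G a \<and> grng G b = gdom G a \<and>
     gmult G a b = grng G a \<and> gmult G b a = gdom G a"

definition ginv :: "('a, 'b) top_groupoid_scheme \<Rightarrow> 'a \<Rightarrow> 'a" where
  "ginv G a = (THE b. is_ginverse G a b)"

definition groupoid :: "('a, 'b) top_groupoid_scheme \<Rightarrow> bool" where
  "groupoid G \<longleftrightarrow>
     (\<forall>a\<in>arrows G. gdom G a \<in> arrows G \<and> grng G a \<in> arrows G \<and>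
        gdom G (gdom G a) = gdom G a \<and> grng G (gdom G a) = gdom G a \<and>
        gdom G (grng G a) = grng G a \<and> grng G (grng G a) = grng G a) \<and>
     (\<forall>(a, b)\<in>composable G. gmult G a b \<in> arrows G \<and>
        gdom G (gmult G a b) = gdom G b \<and> grng G (gmult G a b) = grng G a) \<and>
     (\<forall>a b c. (a, b) \<in> composable G \<and> (b, c) \<in> composable G \<longrightarrow>
        gmult G (gmult G a b) c = gmult G a (gmult G b c)) \<and>
     (\<forall>a\<in>arrows G. gmult G a (gdom G a) = a \<and> gmult G (grng G a) a = a) \<and>
     (\<forall>a\<in>arrows G. \<exists>b. is_ginverse G a b)"

definition topological_groupoid :: "('a, 'b) top_groupoid_scheme \<Rightarrow> bool" where
  "topological_groupoid G \<longleftrightarrow> groupoid G \<and>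
     continuous_map (subtopology (prod_topology (gtop G) (gtop G)) (composable G)) (gtop G)
       (\<lambda>(a, b). gmult G a b) \<and>
     continuous_map (gtop G) (gtop G) (ginv G)"

definition unit_space :: "('a, 'b) top_groupoid_scheme \<Rightarrow> 'a topology" where
  "unit_space G = subtopology (gtop G) (units G)"

definition local_homeomorphism :: "'a topology \<Rightarrow> 'b topology \<Rightarrow> ('a \<Rightarrow> 'b) \<Rightarrow> bool" where
  "local_homeomorphism X Y f \<longleftrightarrow> f ` topspace X \<subseteq> topspace Y \<and>
     (\<forall>x\<in>topspace X. \<exists>U. openin X U \<and> x \<in> U \<and> openin Y (f ` U) \<and>
        homeomorphic_map (subtopology X U) (subtopology Y (f ` U)) f)"

text \<open>Only the unit space is required to be Hausdorff, not the groupoid itself.\<close>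

definition etale_groupoid :: "('a, 'b) top_groupoid_scheme \<Rightarrow> bool" where
  "etale_groupoid G \<longleftrightarrow> topological_groupoid G \<and>
     locally_compact_space (unit_space G) \<and> Hausdorff_space (unit_space G) \<and>
     local_homeomorphism (gtop G) (unit_space G) (gdom G)"

definition ample_groupoid :: "('a, 'b) top_groupoid_scheme \<Rightarrow> bool" where
  "ample_groupoid G \<longleftrightarrow> etale_groupoid G \<and>
     openin (unit_space G) =
       arbitrary union_of (\<lambda>V. compactin (unit_space G) V \<and> openin (unit_space G) V)"

definition local_bisection :: "('a, 'b) top_groupoid_scheme \<Rightarrow> 'a set \<Rightarrow> bool" where
  "local_bisection G U \<longleftrightarrow> openin (gtop G) U \<and>
     homeomorphic_map (subtopology (gtop G) U) (subtopology (unit_space G) (gdom G ` U)) (gdom G) \<and>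
     homeomorphic_map (subtopology (gtop G) U) (subtopology (unit_space G) (grng G ` U)) (grng G)"

definition orbit :: "('a, 'b) top_groupoid_scheme \<Rightarrow> 'a \<Rightarrow> 'a set" where
  "orbit G x = grng G ` {g \<in> arrows G. gdom G g = x}"

definition minimal_groupoid :: "('a, 'b) top_groupoid_scheme \<Rightarrow> bool" where
  "minimal_groupoid G \<longleftrightarrow> (\<forall>x\<in>units G. unit_space G closure_of orbit G x = units G)"

definition effective_groupoid :: "('a, 'b) top_groupoid_scheme \<Rightarrow> bool" where
  "effective_groupoid G \<longleftrightarrow>
     gtop G interior_of {g \<in> arrows G. gdom G g = grng G g} = units G"

definition isotropy :: "('a, 'b) top_groupoid_scheme \<Rightarrow> 'a \<Rightarrow> 'a set" where
  "isotropy G x = {g \<in> arrows G. gdom G g = x \<and> grng G g = x}"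

definition topologically_principal :: "('a, 'b) top_groupoid_scheme \<Rightarrow> bool" where
  "topologically_principal G \<longleftrightarrow>
     unit_space G closure_of {x \<in> units G. isotropy G x = {x}} = units G"


section \<open>Steinberg algebras\<close>

text \<open>Elements of \<open>K\<^sup>G\<close> are represented by functions on the ambient type
  vanishing off the arrows. Steinberg algebras need not be unital, so the rings of HOL-Algebra do
  not apply.\<close>

definition steinberg_algebra :: "('a, 'b) top_groupoid_scheme \<Rightarrow> ('a \<Rightarrow> 'k::field) set" where
  "steinberg_algebra G =
     {f. \<exists>\<U> c. finite \<U> \<and> (\<forall>U\<in>\<U>. local_bisection G U \<and> compactin (gtop G) U) \<and>
           f = (\<lambda>g. \<Sum>U\<in>\<U>. c U * indicator U g)}"

text \<open>The index set is cut down to the non-zero terms because \<open>sum\<close> over an infinite set is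
  \<open>0\<close> by convention. On the Steinberg algebra of an ample groupoid only finitely many terms
  are non-zero.\<close>

definition convolution ::
    "('a, 'b) top_groupoid_scheme \<Rightarrow> ('a \<Rightarrow> 'k::field) \<Rightarrow> ('a \<Rightarrow> 'k) \<Rightarrow> 'a \<Rightarrow> 'k" where
  "convolution G f g \<gamma> =
     (\<Sum>(a, b) \<in> {(a, b) \<in> composable G. gmult G a b = \<gamma> \<and> f a * g b \<noteq> 0}. f a * g b)"

definition two_sided_ideal ::
    "('a \<Rightarrow> 'k::field) set \<Rightarrow> (('a \<Rightarrow> 'k) \<Rightarrow> ('a \<Rightarrow> 'k) \<Rightarrow> 'a \<Rightarrow> 'k) \<Rightarrow> ('a \<Rightarrow> 'k) set \<Rightarrow> bool" where
  "two_sided_ideal A m I \<longleftrightarrow> I \<subseteq> A \<and> (\<lambda>_. 0) \<in> I \<and>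
     (\<forall>f\<in>I. \<forall>g\<in>I. (\<lambda>x. f x + g x) \<in> I) \<and>
     (\<forall>c. \<forall>f\<in>I. (\<lambda>x. c * f x) \<in> I) \<and>
     (\<forall>a\<in>A. \<forall>f\<in>I. m a f \<in> I \<and> m f a \<in> I)"

definition simple_algebra ::
    "('a \<Rightarrow> 'k::field) set \<Rightarrow> (('a \<Rightarrow> 'k) \<Rightarrow> ('a \<Rightarrow> 'k) \<Rightarrow> 'a \<Rightarrow> 'k) \<Rightarrow> bool" where
  "simple_algebra A m \<longleftrightarrow> A \<noteq> {\<lambda>_. 0} \<and>
     (\<forall>I. two_sided_ideal A m I \<longrightarrow> I = {\<lambda>_. 0} \<or> I = A)"


section \<open>Inverse semigroups with zero and their contracted universal groupoids\<close>

record 's semigroup_zero =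
  elts :: "'s set"
  smult :: "'s \<Rightarrow> 's \<Rightarrow> 's"  (infixl \<open>\<cdot>\<index>\<close> 70)
  szero :: "'s"

definition inverse_semigroup_zero :: "('s, 'b) semigroup_zero_scheme \<Rightarrow> bool" where
  "inverse_semigroup_zero S \<longleftrightarrow>
     (\<forall>s\<in>elts S. \<forall>t\<in>elts S. s \<cdot>\<^bsub>S\<^esub> t \<in> elts S) \<and>
     (\<forall>s\<in>elts S. \<forall>t\<in>elts S. \<forall>u\<in>elts S. s \<cdot>\<^bsub>S\<^esub> t \<cdot>\<^bsub>S\<^esub> u = s \<cdot>\<^bsub>S\<^esub> (t \<cdot>\<^bsub>S\<^esub> u)) \<and>
     (\<forall>s\<in>elts S. \<exists>!t. t \<in> elts S \<and> s \<cdot>\<^bsub>S\<^esub> t \<cdot>\<^bsub>S\<^esub> s = s \<and> t \<cdot>\<^bsub>S\<^esub> s \<cdot>\<^bsub>S\<^esub> t = t) \<and>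
     szero S \<in> elts S \<and>
     (\<forall>s\<in>elts S. szero S \<cdot>\<^bsub>S\<^esub> s = szero S \<and> s \<cdot>\<^bsub>S\<^esub> szero S = szero S)"

definition star :: "('s, 'b) semigroup_zero_scheme \<Rightarrow> 's \<Rightarrow> 's" where
  "star S s = (THE t. t \<in> elts S \<and> s \<cdot>\<^bsub>S\<^esub> t \<cdot>\<^bsub>S\<^esub> s = s \<and> t \<cdot>\<^bsub>S\<^esub> s \<cdot>\<^bsub>S\<^esub> t = t)"

definition idems :: "('s, 'b) semigroup_zero_scheme \<Rightarrow> 's set" where
  "idems S = {e \<in> elts S. e \<cdot>\<^bsub>S\<^esub> e = e}"

definition nat_le :: "('s, 'b) semigroup_zero_scheme \<Rightarrow> 's \<Rightarrow> 's \<Rightarrow> bool" where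
  "nat_le S s t \<longleftrightarrow> s = t \<cdot>\<^bsub>S\<^esub> (star S s \<cdot>\<^bsub>S\<^esub> s)"

text \<open>The semilattice \<open>{0,1}\<close> is \<open>bool\<close> with conjunction. Characters are functions on
  \<open>idems S\<close>, i.e. extensional functions on the ambient type, so that equality of characters
  is equality of functions.\<close>

definition characters :: "('s, 'b) semigroup_zero_scheme \<Rightarrow> ('s \<Rightarrow> bool) set" where
  "characters S = {\<theta> \<in> extensional (idems S).
     (\<forall>e\<in>idems S. \<forall>f\<in>idems S. \<theta> (e \<cdot>\<^bsub>S\<^esub> f) \<longleftrightarrow> \<theta> e \<and> \<theta> f) \<and>
     \<not> \<theta> (szero S) \<and> (\<exists>e\<in>idems S. \<theta> e)}"

definition spectrum :: "('s, 'b) semigroup_zero_scheme \<Rightarrow> ('s \<Rightarrow> bool) topology" where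
  "spectrum S =
     subtopology (product_topology (\<lambda>_. discrete_topology UNIV) (idems S)) (characters S)"

definition charD :: "('s, 'b) semigroup_zero_scheme \<Rightarrow> 's \<Rightarrow> ('s \<Rightarrow> bool) set" where
  "charD S e = {\<theta> \<in> characters S. \<theta> e}"

definition dact :: "('s, 'b) semigroup_zero_scheme \<Rightarrow> 's \<Rightarrow> ('s \<Rightarrow> bool) \<Rightarrow> 's \<Rightarrow> bool" where
  "dact S s \<theta> = restrict (\<lambda>e. \<theta> (star S s \<cdot>\<^bsub>S\<^esub> e \<cdot>\<^bsub>S\<^esub> s)) (idems S)"

definition germ_pairs :: "('s, 'b) semigroup_zero_scheme \<Rightarrow> ('s \<times> ('s \<Rightarrow> bool)) set" where
  "germ_pairs S = {(s, \<theta>). s \<in> elts S \<and> \<theta> \<in> charD S (star S s \<cdot>\<^bsub>S\<^esub> s)}"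

definition germ_rel ::
    "('s, 'b) semigroup_zero_scheme \<Rightarrow> (('s \<times> ('s \<Rightarrow> bool)) \<times> ('s \<times> ('s \<Rightarrow> bool))) set" where
  "germ_rel S = {((s, \<theta>), (t, \<theta>')). (s, \<theta>) \<in> germ_pairs S \<and> (t, \<theta>') \<in> germ_pairs S \<and> \<theta> = \<theta>' \<and>
     (\<exists>u\<in>elts S. nat_le S u s \<and> nat_le S u t \<and> \<theta> \<in> charD S (star S u \<cdot>\<^bsub>S\<^esub> u))}"

definition germ ::
    "('s, 'b) semigroup_zero_scheme \<Rightarrow> 's \<Rightarrow> ('s \<Rightarrow> bool) \<Rightarrow> ('s \<times> ('s \<Rightarrow> bool)) set" where
  "germ S s \<theta> = germ_rel S `` {(s, \<theta>)}"

definition germ_basic ::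
    "('s, 'b) semigroup_zero_scheme \<Rightarrow> 's \<Rightarrow> ('s \<Rightarrow> bool) set \<Rightarrow> ('s \<times> ('s \<Rightarrow> bool)) set set" where
  "germ_basic S s U = germ S s ` U"

text \<open>A character \<open>\<theta>\<close> is identified with the unit \<open>[e, \<theta>]\<close> for any idempotent
  \<open>e\<close> with \<open>\<theta> e\<close>; below \<open>e\<close> is taken to be \<open>s\<^sup>*s\<close> for the domain and
  \<open>ss\<^sup>*\<close> for the range of \<open>[s, \<theta>]\<close>. The three operations are well defined on
  classes, so the descriptions denote on arrows and on composable pairs respectively. The sets
  \<open>(s, U)\<close> form a basis, so the topology they generate consists of their unions.\<close>

definition universal_groupoid ::
    "('s, 'b) semigroup_zero_scheme \<Rightarrow> ('s \<times> ('s \<Rightarrow> bool)) set top_groupoid" where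
  "universal_groupoid S =
    \<lparr>gtop = topology_generated_by
       {germ_basic S s U | s U. s \<in> elts S \<and> openin (spectrum S) U \<and>
          U \<subseteq> charD S (star S s \<cdot>\<^bsub>S\<^esub> s)},
     gdom = (\<lambda>a. THE x. \<exists>(s, \<theta>)\<in>germ_pairs S. a = germ S s \<theta> \<and>
       x = germ S (star S s \<cdot>\<^bsub>S\<^esub> s) \<theta>),
     grng = (\<lambda>a. THE x. \<exists>(s, \<theta>)\<in>germ_pairs S. a = germ S s \<theta> \<and>
       x = germ S (s \<cdot>\<^bsub>S\<^esub> star S s) (dact S s \<theta>)),
     gmult = (\<lambda>a b. THE c. \<exists>s t \<theta>. (t, \<theta>) \<in> germ_pairs S \<and> (s, dact S t \<theta>) \<in> germ_pairs S \<and>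
       a = germ S s (dact S t \<theta>) \<and> b = germ S t \<theta> \<and> c = germ S (s \<cdot>\<^bsub>S\<^esub> t) \<theta>)\<rparr>"

end

theory Submission
  imports Defs "HOL-Library.Function_Algebras" "HOL-Library.Poly_Mapping" "HOL-Library.Sublist"
    "HOL-Number_Theory.Cong"
begin

text \<open>Let an abelian group \<open>G\<close> act self-similarly on the words over an infinite alphabet. The
  elements \<open>u g v\<^sup>*\<close>, together with a zero, form an inverse semigroup whose universal groupoid is
  minimal, and effective if the action is faithful enough. The isotropy group of the empty word is \<open>G\<close>.

  Take \<open>G = H \<times> B\<close>, where \<open>H = \<Prod>\<^sub>n (\<int>/n)\<^sup>2\<close> and \<open>B\<close> consists of the finitely supported
  functions from an uncountable index set to \<open>H\<close>. A letter \<open>x\<close> tests one coordinate of \<open>B\<close>, in the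
  sense that it is moved unless this coordinate is \<open>0\<close>, and the restriction \<open>g \<mapsto> g|\<^sub>x\<close> is the
  identity on \<open>B\<close> and maps \<open>H\<close> into the tested coordinate by a homomorphism killing a line of
  \<open>(\<int>/p)\<^sup>2\<close> for every \<open>p \<in> P\<close>. An infinite word tests only countably many coordinates of \<open>B\<close>, so
  all isotropy groups are uncountable.

  If the characteristic \<open>p\<close> of \<open>K\<close> is in \<open>P\<close>, then \<open>\<Sum>h\<close>, over \<open>h \<in> (\<int>/p)\<^sup>2 \<subseteq> H\<close>, vanishes outside
  the orbit of the empty word, since on each letter it becomes a sum over fibres with \<open>p\<close> elements;
  the functions vanishing outside this orbit form a proper ideal. If the characteristic is not in
  \<open>P\<close>, then an element \<open>f\<close> of \<open>K H\<close> is determined by its restrictions to letters: summing \<open>f\<close>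
  over the \<open>p + 1\<close> lines through \<open>a\<close> in \<open>(\<int>/p)\<^sup>2\<close> yields \<open>p f(a)\<close> plus the total sum of \<open>f\<close>.
  Hence every non-zero element of the algebra can be compressed, first by a fresh letter and then by
  a word of tests, to a non-zero multiple of the identity.\<close>

section \<open>Inverse semigroups\<close>

text \<open>For Hausdorff ample groupoids, minimality and effectiveness already force a simple
  algebra, so a dependence on the characteristic must come from germs that cannot be separated. They
  sit over finite words: every neighbourhood of a finite word contains the cylinders of all but
  finitely many of its one-letter extensions, and at the empty word such a cylinder no longer
  distinguishes elements of \<open>H\<close> with the same image under the letter. One letter
  suffices, because it sets the \<open>H\<close>-part to \<open>0\<close> and elements of
  \<open>B\<close> restrict to themselves; hence tests can be concatenated without altering what
  they test, and \<open>B\<close> still provides isotropy far along a word.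

  The algebra is handled through \<open>S\<close>: it is spanned by the functions
  \<open>ind s\<close>, and convolution of these is multiplication in \<open>S\<close>. Both halves
  of the simplicity question become computations with triples, governed by sums over the fibres of
  the maps \<open>psi P l\<close>.

  The carrier type is prescribed as \<open>nat \<Rightarrow> nat\<close>. An uncountable index set
  still fits, since words, finitely supported functions and families of residues can all be coded by
  sequences of naturals.\<close>

locale inverse_semigroup =
  fixes S :: "('s, 'b) semigroup_zero_scheme" (structure)
  assumes inverse_semigroup_zero: "inverse_semigroup_zero S"
begin

abbreviation inverse_elt (\<open>_\<^sup>\<star>\<close> [1000] 1000) where "s\<^sup>\<star> \<equiv> star S s"
abbreviation E where "E \<equiv> idems S"
abbreviation zero (\<open>\<zero>\<close>) where "\<zero> \<equiv> szero S"

lemma mult_closed [simp]: "s \<in> elts S \<Longrightarrow> t \<in> elts S \<Longrightarrow> s \<cdot> t \<in> elts S"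
  and mult_assoc [simp]: "s \<in> elts S \<Longrightarrow> t \<in> elts S \<Longrightarrow> u \<in> elts S \<Longrightarrow> s \<cdot> t \<cdot> u = s \<cdot> (t \<cdot> u)"
  and zero_closed [simp]: "\<zero> \<in> elts S"
  and mult_zero [simp]: "s \<in> elts S \<Longrightarrow> \<zero> \<cdot> s = \<zero>" "s \<in> elts S \<Longrightarrow> s \<cdot> \<zero> = \<zero>"
  using inverse_semigroup_zero unfolding inverse_semigroup_zero_def by blast+

lemma ex1_star:
  "s \<in> elts S \<Longrightarrow> \<exists>!t. t \<in> elts S \<and> s \<cdot> t \<cdot> s = s \<and> t \<cdot> s \<cdot> t = t"
  using inverse_semigroup_zero unfolding inverse_semigroup_zero_def by (elim conjE) (rule bspec)

lemma star_props:
  assumes "s \<in> elts S"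
  shows "s\<^sup>\<star> \<in> elts S \<and> s \<cdot> s\<^sup>\<star> \<cdot> s = s \<and> s\<^sup>\<star> \<cdot> s \<cdot> s\<^sup>\<star> = s\<^sup>\<star>"
  unfolding star_def by (rule theI') (rule ex1_star[OF assms])

lemma star_closed [simp]: "s \<in> elts S \<Longrightarrow> s\<^sup>\<star> \<in> elts S"
  using star_props by blast

lemma star_cancel [simp]:
  assumes "s \<in> elts S"
  shows "s \<cdot> (s\<^sup>\<star> \<cdot> s) = s" "s\<^sup>\<star> \<cdot> (s \<cdot> s\<^sup>\<star>) = s\<^sup>\<star>"
  using star_props[OF assms] assms by simp_all

lemma star_cancel_left [simp]:
  assumes "s \<in> elts S" "x \<in> elts S"
  shows "s \<cdot> (s\<^sup>\<star> \<cdot> (s \<cdot> x)) = s \<cdot> x" "s\<^sup>\<star> \<cdot> (s \<cdot> (s\<^sup>\<star> \<cdot> x)) = s\<^sup>\<star> \<cdot> x"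
proof -
  have "s \<cdot> (s\<^sup>\<star> \<cdot> s) \<cdot> x = s \<cdot> x" "s\<^sup>\<star> \<cdot> (s \<cdot> s\<^sup>\<star>) \<cdot> x = s\<^sup>\<star> \<cdot> x"
    using assms by (simp_all only: star_cancel)
  then show "s \<cdot> (s\<^sup>\<star> \<cdot> (s \<cdot> x)) = s \<cdot> x" "s\<^sup>\<star> \<cdot> (s \<cdot> (s\<^sup>\<star> \<cdot> x)) = s\<^sup>\<star> \<cdot> x"
    using assms by (simp_all only: mult_assoc star_closed mult_closed)
qed

lemma star_unique:
  assumes "s \<in> elts S" "t \<in> elts S" "s \<cdot> (t \<cdot> s) = s" "t \<cdot> (s \<cdot> t) = t"
  shows "s\<^sup>\<star> = t"
  using ex1_star[OF assms(1)] star_props[OF assms(1)] assms(2-4) mult_assoc assms(1) by metis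

lemma star_star [simp]: "s \<in> elts S \<Longrightarrow> s\<^sup>\<star>\<^sup>\<star> = s"
  by (rule star_unique) simp_all

lemma idems_elts [simp]: "e \<in> E \<Longrightarrow> e \<in> elts S"
  and idem_mult [simp]: "e \<in> E \<Longrightarrow> e \<cdot> e = e"
  by (auto simp: idems_def)

lemma idem_mult_left [simp]: "e \<in> E \<Longrightarrow> x \<in> elts S \<Longrightarrow> e \<cdot> (e \<cdot> x) = e \<cdot> x"
  using mult_assoc[of e e x] by simp

lemma idemsI: "e \<in> elts S \<Longrightarrow> e \<cdot> e = e \<Longrightarrow> e \<in> E"
  unfolding idems_def by blast

lemma zero_idem [simp]: "\<zero> \<in> E"
  by (rule idemsI) simp_all

lemma star_idem [simp]: "e \<in> E \<Longrightarrow> e\<^sup>\<star> = e"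
  by (rule star_unique) simp_all

lemma star_mult_idem [simp]: "s \<in> elts S \<Longrightarrow> s\<^sup>\<star> \<cdot> s \<in> E" "s \<in> elts S \<Longrightarrow> s \<cdot> s\<^sup>\<star> \<in> E"
  by (rule idemsI; simp)+

text \<open>The inverse \<open>x\<close> of \<open>e \<cdot> f\<close> equals
  \<open>f \<cdot> x \<cdot> e\<close>, because the latter is an inverse as well. This form makes
  \<open>x\<close> idempotent, hence its own inverse, so that
  \<open>e \<cdot> f = x\<close>.\<close>

lemma idem_prod_idem:
  assumes e: "e \<in> E" and f: "f \<in> E"
  shows "e \<cdot> f \<in> E"
proof -
  define x where "x = (e \<cdot> f)\<^sup>\<star>"
  have x: "x \<in> elts S" and efxef: "e \<cdot> (f \<cdot> (x \<cdot> (e \<cdot> f))) = e \<cdot> f"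
    and xefx: "x \<cdot> (e \<cdot> (f \<cdot> x)) = x"
    using star_cancel[of "e \<cdot> f"] e f unfolding x_def
    by (simp_all only: mult_assoc star_closed mult_closed idems_elts)
  have xefx': "x \<cdot> (e \<cdot> (f \<cdot> (x \<cdot> y))) = x \<cdot> y" if "y \<in> elts S" for y
  proof -
    have "x \<cdot> (e \<cdot> (f \<cdot> x)) \<cdot> y = x \<cdot> y" by (simp only: xefx)
    then show ?thesis using that x e f by simp
  qed
  have "(e \<cdot> f)\<^sup>\<star> = f \<cdot> (x \<cdot> e)"
    using e f x efxef xefx' by (intro star_unique) simp_all
  then have fxe: "x = f \<cdot> (x \<cdot> e)" by (simp add: x_def)
  have "x \<cdot> x = f \<cdot> (x \<cdot> e) \<cdot> (f \<cdot> (x \<cdot> e))" by (simp only: fxe[symmetric])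
  also have "\<dots> = f \<cdot> (x \<cdot> e)" using e f x xefx' by simp
  also have "\<dots> = x" by (rule fxe[symmetric])
  finally have "x \<in> E" using x by (intro idemsI)
  moreover from this have "e \<cdot> f = x"
    using star_star[of "e \<cdot> f"] e f unfolding x_def[symmetric] by simp
  ultimately show ?thesis by simp
qed

text \<open>Both products are idempotent, which makes \<open>f \<cdot> e\<close> an inverse of
  \<open>e \<cdot> f\<close>; but an idempotent is its own inverse.\<close>

lemma idem_commute:
  assumes e: "e \<in> E" and f: "f \<in> E"
  shows "e \<cdot> f = f \<cdot> e"
proof -
  have 1: "e \<cdot> (f \<cdot> (e \<cdot> f)) = e \<cdot> f" "f \<cdot> (e \<cdot> (f \<cdot> e)) = f \<cdot> e"
    using idem_mult[OF idem_prod_idem[OF e f]] idem_mult[OF idem_prod_idem[OF f e]] e f by simp_all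
  have "(e \<cdot> f)\<^sup>\<star> = f \<cdot> e"
    using e f 1 by (intro star_unique) simp_all
  then show ?thesis using idem_prod_idem[OF e f] by simp
qed

lemma idem_left_commute:
  assumes "e \<in> E" "f \<in> E" "x \<in> elts S"
  shows "e \<cdot> (f \<cdot> x) = f \<cdot> (e \<cdot> x)"
  using idem_commute[OF assms(1,2)] assms mult_assoc[of e f x] mult_assoc[of f e x] by simp

text \<open>The idempotents \<open>star S s \<cdot> s\<close> and \<open>t \<cdot> star S t\<close>
  meet in the middle of the products and commute.\<close>

lemma star_mult [simp]:
  assumes s: "s \<in> elts S" and t: "t \<in> elts S"
  shows "(s \<cdot> t)\<^sup>\<star> = t\<^sup>\<star> \<cdot> s\<^sup>\<star>"
proof (rule star_unique)
  have *: "s\<^sup>\<star> \<cdot> (s \<cdot> (t \<cdot> (t\<^sup>\<star> \<cdot> x))) = t \<cdot> (t\<^sup>\<star> \<cdot> (s\<^sup>\<star> \<cdot> (s \<cdot> x)))" if "x \<in> elts S" for x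
    using idem_left_commute[of "s\<^sup>\<star> \<cdot> s" "t \<cdot> t\<^sup>\<star>" x] s t that by simp
  have **: "t \<cdot> (t\<^sup>\<star> \<cdot> (s\<^sup>\<star> \<cdot> (s \<cdot> x))) = s\<^sup>\<star> \<cdot> (s \<cdot> (t \<cdot> (t\<^sup>\<star> \<cdot> x)))" if "x \<in> elts S" for x
    using *[OF that] by simp
  have "s \<cdot> (t \<cdot> (t\<^sup>\<star> \<cdot> (s\<^sup>\<star> \<cdot> (s \<cdot> t)))) = s \<cdot> (s\<^sup>\<star> \<cdot> (s \<cdot> (t \<cdot> (t\<^sup>\<star> \<cdot> t))))"
    by (simp only: **[OF t])
  then show "s \<cdot> t \<cdot> (t\<^sup>\<star> \<cdot> s\<^sup>\<star> \<cdot> (s \<cdot> t)) = s \<cdot> t" using s t by simp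
  have "t\<^sup>\<star> \<cdot> (s\<^sup>\<star> \<cdot> (s \<cdot> (t \<cdot> (t\<^sup>\<star> \<cdot> s\<^sup>\<star>)))) = t\<^sup>\<star> \<cdot> (t \<cdot> (t\<^sup>\<star> \<cdot> (s\<^sup>\<star> \<cdot> (s \<cdot> s\<^sup>\<star>))))"
    by (simp only: *[OF star_closed[OF s]])
  then show "t\<^sup>\<star> \<cdot> s\<^sup>\<star> \<cdot> (s \<cdot> t \<cdot> (t\<^sup>\<star> \<cdot> s\<^sup>\<star>)) = t\<^sup>\<star> \<cdot> s\<^sup>\<star>" using s t by simp
qed (use s t in simp_all)

lemma conj_idem [simp]:
  assumes "s \<in> elts S" "e \<in> E"
  shows "s\<^sup>\<star> \<cdot> (e \<cdot> s) \<in> E" "s \<cdot> (e \<cdot> s\<^sup>\<star>) \<in> E"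
proof -
  have "s\<^sup>\<star> \<cdot> (e \<cdot> s) \<in> E" if "s \<in> elts S" for s
    using star_mult_idem(1)[of "e \<cdot> s"] that assms by simp
  from this[of s] this[of "s\<^sup>\<star>"] show "s\<^sup>\<star> \<cdot> (e \<cdot> s) \<in> E" "s \<cdot> (e \<cdot> s\<^sup>\<star>) \<in> E"
    using assms by simp_all
qed

text \<open>This is how a restriction in the range is turned into one in the domain, where germs are
  compared.\<close>

lemma idem_mult_eq:
  assumes s: "s \<in> elts S" and e: "e \<in> E"
  shows "e \<cdot> s = s \<cdot> (s\<^sup>\<star> \<cdot> (e \<cdot> s))"
proof -
  have "s \<cdot> (s\<^sup>\<star> \<cdot> (e \<cdot> s)) = e \<cdot> (s \<cdot> (s\<^sup>\<star> \<cdot> s))"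
    using idem_left_commute[of "s \<cdot> s\<^sup>\<star>" e s] s e by simp
  then show ?thesis using s by simp
qed

section \<open>Characters and the spectrum\<close>

abbreviation dom where "dom s \<equiv> charD S (s\<^sup>\<star> \<cdot> s)"

lemma character_mult:
  "\<theta> \<in> characters S \<Longrightarrow> e \<in> E \<Longrightarrow> f \<in> E \<Longrightarrow> \<theta> (e \<cdot> f) \<longleftrightarrow> \<theta> e \<and> \<theta> f"
  by (auto simp: characters_def)

lemma character_zero: "\<theta> \<in> characters S \<Longrightarrow> \<not> \<theta> \<zero>"
  by (auto simp: characters_def)

lemma character_nonzero: "\<theta> \<in> characters S \<Longrightarrow> \<exists>e\<in>E. \<theta> e"
  by (auto simp: characters_def)

lemma character_ext:
  assumes "\<theta> \<in> characters S" "\<theta>' \<in> characters S" "\<And>e. e \<in> E \<Longrightarrow> \<theta> e = \<theta>' e"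
  shows "\<theta> = \<theta>'"
  using assms unfolding characters_def by (auto intro: extensionalityI[where A = E])

lemma charD_iff: "\<theta> \<in> charD S e \<longleftrightarrow> \<theta> \<in> characters S \<and> \<theta> e"
  by (auto simp: charD_def)

abbreviation charDs where "charDs e F \<equiv> charD S e - (\<Union>f\<in>F. charD S f)"

lemma charD_subset: "charD S e \<subseteq> characters S"
  by (auto simp: charD_def)

lemma charD_mult: "e \<in> E \<Longrightarrow> f \<in> E \<Longrightarrow> charD S (e \<cdot> f) = charD S e \<inter> charD S f"
  by (auto simp: charD_iff character_mult)

lemma dact_apply: "s \<in> elts S \<Longrightarrow> e \<in> E \<Longrightarrow> dact S s \<theta> e = \<theta> (s\<^sup>\<star> \<cdot> (e \<cdot> s))"
  by (simp add: dact_def)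

lemma dact_charD:
  assumes s: "s \<in> elts S" and \<theta>: "\<theta> \<in> dom s"
  shows "dact S s \<theta> \<in> charD S (s \<cdot> s\<^sup>\<star>)"
proof -
  have \<theta>': "\<theta> \<in> characters S" "\<theta> (s\<^sup>\<star> \<cdot> s)" using \<theta> by (auto simp: charD_iff)
  have "\<theta> (s\<^sup>\<star> \<cdot> (e \<cdot> f \<cdot> s)) \<longleftrightarrow> \<theta> (s\<^sup>\<star> \<cdot> (e \<cdot> s)) \<and> \<theta> (s\<^sup>\<star> \<cdot> (f \<cdot> s))"
    if e: "e \<in> E" and f: "f \<in> E" for e f
  proof -
    have "s\<^sup>\<star> \<cdot> (e \<cdot> s) \<cdot> (s\<^sup>\<star> \<cdot> (f \<cdot> s)) = s\<^sup>\<star> \<cdot> (e \<cdot> (s \<cdot> (s\<^sup>\<star> \<cdot> (f \<cdot> s))))"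
      using s e f by simp
    also have "\<dots> = s\<^sup>\<star> \<cdot> (e \<cdot> f \<cdot> s)"
      using s e f by (simp flip: idem_mult_eq)
    finally show ?thesis using character_mult[OF \<theta>'(1), of "s\<^sup>\<star> \<cdot> (e \<cdot> s)" "s\<^sup>\<star> \<cdot> (f \<cdot> s)"] s e f by simp
  qed
  then have "\<forall>e\<in>E. \<forall>f\<in>E. dact S s \<theta> (e \<cdot> f) \<longleftrightarrow> dact S s \<theta> e \<and> dact S s \<theta> f"
    using s by (simp add: dact_apply idem_prod_idem)
  moreover have "\<not> dact S s \<theta> \<zero>"
    using s character_zero[OF \<theta>'(1)] by (simp add: dact_apply)
  moreover have "dact S s \<theta> (s \<cdot> s\<^sup>\<star>)"
    using s \<theta>' by (simp add: dact_apply)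
  moreover have "dact S s \<theta> \<in> extensional E"
    unfolding dact_def by simp
  ultimately show ?thesis
    unfolding charD_iff characters_def using star_mult_idem(2)[OF s] by blast
qed

lemma dact_character: "s \<in> elts S \<Longrightarrow> \<theta> \<in> dom s \<Longrightarrow> dact S s \<theta> \<in> characters S"
  using dact_charD charD_subset by blast

lemma dact_mult:
  assumes "s \<in> elts S" "t \<in> elts S"
  shows "dact S s (dact S t \<theta>) = dact S (s \<cdot> t) \<theta>"
  unfolding dact_def using assms by (intro ext) (simp add: restrict_def)

lemma dact_idem:
  assumes e: "e \<in> E" and \<theta>: "\<theta> \<in> charD S e"
  shows "dact S e \<theta> = \<theta>"
proof (rule character_ext)
  show "dact S e \<theta> \<in> characters S" using dact_character[of e \<theta>] e \<theta> by simp
  show "dact S e \<theta> f = \<theta> f" if "f \<in> E" for f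
    using that e \<theta> by (auto simp: dact_apply charD_iff character_mult idem_prod_idem)
qed (use \<theta> in \<open>simp add: charD_iff\<close>)

lemma dact_star:
  assumes "s \<in> elts S" "\<theta> \<in> dom s"
  shows "dact S s\<^sup>\<star> (dact S s \<theta>) = \<theta>"
  using assms by (simp add: dact_mult dact_idem)

lemma dact_dom_iff:
  assumes s: "s \<in> elts S" and t: "t \<in> elts S" and \<theta>: "\<theta> \<in> dom t"
  shows "dact S t \<theta> \<in> dom s \<longleftrightarrow> \<theta> \<in> dom (s \<cdot> t)"
  using dact_character[OF t \<theta>] assms by (auto simp: charD_iff dact_apply)

lemma dom_mult_subset:
  assumes s: "s \<in> elts S" and t: "t \<in> elts S"
  shows "dom (s \<cdot> t) \<subseteq> dom t"
proof
  fix \<theta> assume \<theta>: "\<theta> \<in> dom (s \<cdot> t)"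
  have "(s \<cdot> t)\<^sup>\<star> \<cdot> (s \<cdot> t) \<cdot> (t\<^sup>\<star> \<cdot> t) = (s \<cdot> t)\<^sup>\<star> \<cdot> (s \<cdot> t)" using s t by simp
  then show "\<theta> \<in> dom t"
    using \<theta> s t character_mult[of \<theta> "(s \<cdot> t)\<^sup>\<star> \<cdot> (s \<cdot> t)" "t\<^sup>\<star> \<cdot> t"]
    by (simp add: charD_iff del: star_mult mult_assoc)
qed

lemma dom_mult_idem:
  assumes s: "s \<in> elts S" and e: "e \<in> E"
  shows "dom (s \<cdot> e) = dom s \<inter> charD S e"
proof -
  have "(s \<cdot> e)\<^sup>\<star> \<cdot> (s \<cdot> e) = s\<^sup>\<star> \<cdot> s \<cdot> e"
    using s e idem_left_commute[of e "s\<^sup>\<star> \<cdot> s" e] by simp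
  then show ?thesis using s e charD_mult[of "s\<^sup>\<star> \<cdot> s" e] by simp
qed

lemma characters_extensional: "characters S \<subseteq> extensional E"
  unfolding characters_def by blast

lemma topspace_spectrum [simp]: "topspace (spectrum S) = characters S"
  using characters_extensional unfolding spectrum_def by (auto simp: PiE_UNIV_domain PiE_def)

lemma openin_spectrum_eval:
  assumes "e \<in> E"
  shows "openin (spectrum S) {\<theta> \<in> characters S. \<theta> e \<in> B}"
proof -
  have "continuous_map (spectrum S) (discrete_topology UNIV) (\<lambda>\<theta>. \<theta> e)"
    unfolding spectrum_def using assms
    by (intro continuous_map_from_subtopology continuous_map_product_projection)
  from openin_continuous_map_preimage[OF this, of B] show ?thesis by simp
qed

lemma openin_charD: "e \<in> E \<Longrightarrow> openin (spectrum S) (charD S e)"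
  using openin_spectrum_eval[of e "{True}"] by (simp add: charD_def)

lemma openin_charD_diff:
  assumes "e \<in> E" "finite F" "F \<subseteq> E"
  shows "openin (spectrum S) (charDs e F)"
proof -
  have "openin (spectrum S) (charD S e \<inter> (\<Inter>f\<in>F. {\<theta> \<in> characters S. \<theta> f \<in> {False}}) )" if "F \<noteq> {}"
    using assms that by (intro openin_Int openin_charD openin_INT2 openin_spectrum_eval) auto
  moreover have "charDs e F
      = charD S e \<inter> (\<Inter>f\<in>F. {\<theta> \<in> characters S. \<theta> f \<in> {False}})" if "F \<noteq> {}"
    using that by (auto simp: charD_iff)
  ultimately show ?thesis using assms openin_charD by (cases "F = {}") simp_all
qed

text \<open>By Tychonoff's theorem it suffices that the set is closed in the product of two-point
  spaces. Each multiplicativity condition involves three coordinates only, and fixing the value at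
  \<open>e\<close> keeps the zero homomorphism out of the closure.\<close>

lemma compactin_charD:
  assumes e: "e \<in> E"
  shows "compactin (spectrum S) (charD S e)"
proof -
  define X where "X = product_topology (\<lambda>_::'s. discrete_topology (UNIV :: bool set)) E"
  have closed: "closedin X {\<theta> \<in> topspace X. \<theta> a \<in> B}" if "a \<in> E" for a B
  proof -
    have "continuous_map X (discrete_topology UNIV) (\<lambda>\<theta>. \<theta> a)"
      unfolding X_def using that by (rule continuous_map_product_projection)
    from closedin_continuous_map_preimage[OF this, of B] show ?thesis by simp
  qed
  define A where "A a = {\<theta> \<in> topspace X. \<theta> a \<in> {True}}" for a
  define B where "B a = {\<theta> \<in> topspace X. \<theta> a \<in> {False}}" for a
  have top: "topspace X = extensional E"
    unfolding X_def by (auto simp: PiE_def)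
  have "closedin X ((\<Inter>p\<in>E \<times> E. A (fst p \<cdot> snd p) \<inter> (A (fst p) \<inter> A (snd p)) \<union>
      B (fst p \<cdot> snd p) \<inter> (B (fst p) \<union> B (snd p))) \<inter> B \<zero> \<inter> A e)"
    using e unfolding A_def B_def
    by (intro closedin_Int closedin_INT closedin_Un closed) (auto simp: idem_prod_idem)
  also have "(\<Inter>p\<in>E \<times> E. A (fst p \<cdot> snd p) \<inter> (A (fst p) \<inter> A (snd p)) \<union>
      B (fst p \<cdot> snd p) \<inter> (B (fst p) \<union> B (snd p))) \<inter> B \<zero> \<inter> A e = charD S e"
  proof (intro set_eqI iffI)
    fix \<theta>
    assume *: "\<theta> \<in> (\<Inter>p\<in>E \<times> E. A (fst p \<cdot> snd p) \<inter> (A (fst p) \<inter> A (snd p)) \<union>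
      B (fst p \<cdot> snd p) \<inter> (B (fst p) \<union> B (snd p))) \<inter> B \<zero> \<inter> A e"
    have "\<theta> (a \<cdot> b) \<longleftrightarrow> \<theta> a \<and> \<theta> b" if "a \<in> E" "b \<in> E" for a b
      using INT_D[OF IntD1[OF IntD1[OF *]], of "(a, b)"] that unfolding A_def B_def by auto
    moreover have "\<theta> \<in> extensional E" "\<theta> e" "\<not> \<theta> \<zero>"
      using * unfolding A_def B_def top by auto
    ultimately show "\<theta> \<in> charD S e"
      using e unfolding charD_def characters_def by blast
  next
    fix \<theta> assume \<theta>: "\<theta> \<in> charD S e"
    then have "\<theta> \<in> extensional E" "\<theta> e" "\<theta> \<in> characters S"
      using characters_extensional by (auto simp: charD_iff)
    then show "\<theta> \<in> (\<Inter>p\<in>E \<times> E. A (fst p \<cdot> snd p) \<inter> (A (fst p) \<inter> A (snd p)) \<union>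
      B (fst p \<cdot> snd p) \<inter> (B (fst p) \<union> B (snd p))) \<inter> B \<zero> \<inter> A e"
      unfolding A_def B_def top by (auto simp: character_mult character_zero)
  qed
  finally have "closedin X (charD S e)" .
  moreover have "compact_space X"
    unfolding X_def by (simp add: compact_space_product_topology compact_space_discrete_topology)
  ultimately have "compactin X (charD S e)"
    by (rule closedin_compact_space[rotated])
  then show ?thesis
    using charD_subset unfolding spectrum_def X_def[symmetric] by (simp add: compactin_subtopology)
qed

lemma compactin_charD_diff:
  assumes "e \<in> E" "finite F" "F \<subseteq> E"
  shows "compactin (spectrum S) (charDs e F)"
proof -
  have "closedin (spectrum S) (characters S - (\<Union>f\<in>F. charD S f))"
    using assms by (intro closedin_diff closedin_topspace[of "spectrum S", simplified] openin_Union)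
      (auto intro!: openin_charD)
  then have "compactin (spectrum S) (charD S e \<inter> (characters S - (\<Union>f\<in>F. charD S f)))"
    using compactin_charD[OF assms(1)] by (rule compact_Int_closedin[rotated])
  moreover have "charD S e \<inter> (characters S - (\<Union>f\<in>F. charD S f)) = charDs e F"
    using charD_subset by blast
  ultimately show ?thesis by simp
qed

lemma character_finite_meet:
  assumes "finite A" "A \<subseteq> E" "\<theta> \<in> characters S" "\<And>a. a \<in> A \<Longrightarrow> \<theta> a"
  obtains e where "e \<in> E" "\<theta> e" "\<And>a. a \<in> A \<Longrightarrow> charD S e \<subseteq> charD S a"
proof -
  have "\<exists>e\<in>E. \<theta> e \<and> (\<forall>a\<in>A. charD S e \<subseteq> charD S a)"
    using assms(1,2,4)
  proof (induction A rule: finite_induct)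
    case empty
    then show ?case using character_nonzero[OF assms(3)] by simp
  next
    case (insert a A)
    then obtain e where "e \<in> E" "\<theta> e" "\<forall>a\<in>A. charD S e \<subseteq> charD S a" by auto
    then show ?case using insert.prems assms(3)
      by (intro bexI[of _ "a \<cdot> e"]) (auto simp: charD_mult character_mult idem_prod_idem)
  qed
  then show ?thesis using that by blast
qed

text \<open>A basic open set of the product prescribes finitely many values. The idempotents with
  value \<open>True\<close> are replaced by one idempotent below all of them, those with value
  \<open>False\<close> form \<open>F\<close>.\<close>

lemma spectrum_basis:
  assumes U: "openin (spectrum S) U" and \<theta>: "\<theta> \<in> U"
  obtains e F where "e \<in> E" "finite F" "F \<subseteq> E" "\<theta> \<in> charDs e F"
    "charDs e F \<subseteq> U"
proof -
  obtain W where W: "openin (product_topology (\<lambda>_. discrete_topology UNIV) E) W"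
    and UW: "U = W \<inter> characters S"
    using U unfolding spectrum_def openin_subtopology by blast
  have \<theta>c: "\<theta> \<in> characters S" using UW \<theta> by blast
  have "\<theta> \<in> W" using UW \<theta> by blast
  then obtain V where "finite {i \<in> E. V i \<noteq> topspace (discrete_topology UNIV)}"
    and V: "\<theta> \<in> PiE E V" "PiE E V \<subseteq> W"
    using W unfolding openin_product_topology_alt by meson
  then have fin: "finite {i \<in> E. V i \<noteq> UNIV}" by simp
  let ?A = "{i \<in> E. V i \<noteq> UNIV}"
  obtain e where e: "e \<in> E" "\<theta> e" "\<And>a. a \<in> ?A \<Longrightarrow> \<theta> a \<Longrightarrow> charD S e \<subseteq> charD S a"
  proof (rule character_finite_meet[of "{a \<in> ?A. \<theta> a}" \<theta>])
    show "finite {a \<in> ?A. \<theta> a}" using fin by (rule rev_finite_subset) blast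
  qed (use \<theta>c in auto)
  let ?F = "{a \<in> ?A. \<not> \<theta> a}"
  have finF: "finite ?F" using fin by (rule rev_finite_subset) blast
  have "\<theta>' \<in> U" if \<theta>': "\<theta>' \<in> charD S e - (\<Union>f\<in>?F. charD S f)" for \<theta>'
  proof -
    have c: "\<theta>' \<in> characters S" using \<theta>' charD_subset by blast
    have "\<theta>' a = \<theta> a" if "a \<in> ?A" for a
      using e(3)[OF that] \<theta>' that c by (cases "\<theta> a") (auto simp: charD_iff)
    then have "\<theta>' a \<in> V a" if "a \<in> E" for a
      using that V(1) PiE_mem[of \<theta> E V a] by (cases "a \<in> ?A") auto
    then show ?thesis
      using V(2) c characters_extensional UW by (auto simp: PiE_def)
  qed
  then show ?thesis
    using e finF \<theta>c by (intro that[of e ?F]) (auto simp: charD_iff)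
qed

lemma Hausdorff_spectrum: "Hausdorff_space (spectrum S)"
  unfolding spectrum_def
  by (intro Hausdorff_space_subtopology) (simp add: Hausdorff_space_product_topology)

lemma locally_compact_spectrum: "locally_compact_space (spectrum S)"
  unfolding locally_compact_space_def
proof
  fix \<theta> assume "\<theta> \<in> topspace (spectrum S)"
  then obtain e where "e \<in> E" "\<theta> \<in> charD S e"
    using character_nonzero[of \<theta>] by (auto simp: charD_iff)
  then show "\<exists>U K. openin (spectrum S) U \<and> compactin (spectrum S) K \<and> \<theta> \<in> U \<and> U \<subseteq> K"
    using openin_charD compactin_charD by blast
qed

lemma openin_dact_preimage:
  assumes s: "s \<in> elts S" and U: "openin (spectrum S) U"
  shows "openin (spectrum S) {\<theta> \<in> dom s. dact S s \<theta> \<in> U}"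
proof (subst openin_subopen, intro ballI)
  fix \<theta> assume \<theta>: "\<theta> \<in> {\<theta> \<in> dom s. dact S s \<theta> \<in> U}"
  then obtain e F where eF: "e \<in> E" "finite F" "F \<subseteq> E" "dact S s \<theta> \<in> charDs e F"
    "charDs e F \<subseteq> U"
    using spectrum_basis[OF U, of "dact S s \<theta>"] by blast
  let ?c = "\<lambda>e. s\<^sup>\<star> \<cdot> (e \<cdot> s)"
  let ?T = "dom s \<inter> (charD S (?c e) - (\<Union>f\<in>?c ` F. charD S f))"
  have iff: "dact S s \<theta> \<in> charD S a \<longleftrightarrow> \<theta> \<in> charD S (?c a)" if "\<theta> \<in> dom s" "a \<in> E" for \<theta> a
    using that s dact_character[OF s that(1)] charD_subset by (auto simp: charD_iff dact_apply)
  note iffF = iff[OF _ subsetD[OF eF(3)]]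
  have "openin (spectrum S) ?T"
    using s eF by (intro openin_Int openin_charD openin_charD_diff) auto
  moreover have "\<theta> \<in> ?T" using \<theta> eF iff iffF by auto
  moreover have "?T \<subseteq> {\<theta> \<in> dom s. dact S s \<theta> \<in> U}"
    using eF(1,5) iff iffF by auto
  ultimately show "\<exists>T. openin (spectrum S) T \<and> \<theta> \<in> T \<and> T \<subseteq> {\<theta> \<in> dom s. dact S s \<theta> \<in> U}"
    by blast
qed

section \<open>Germs\<close>

abbreviation G where "G \<equiv> universal_groupoid S"

lemma germ_pairs_iff: "(s, \<theta>) \<in> germ_pairs S \<longleftrightarrow> s \<in> elts S \<and> \<theta> \<in> dom s"
  by (simp add: germ_pairs_def)

text \<open>A common lower bound \<open>u\<close> of \<open>s\<close> and \<open>t\<close> enters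
  only through the idempotent \<open>e = star S u \<cdot> u\<close>, on which \<open>s\<close> and
  \<open>t\<close> agree. Germs are compared in this form from here on.\<close>

lemma germ_rel_iff:
  "((s, \<theta>), (t, \<theta>')) \<in> germ_rel S \<longleftrightarrow>
     (s, \<theta>) \<in> germ_pairs S \<and> (t, \<theta>') \<in> germ_pairs S \<and> \<theta> = \<theta>' \<and> (\<exists>e\<in>E. \<theta> e \<and> s \<cdot> e = t \<cdot> e)"
  (is "?L \<longleftrightarrow> ?R")
proof
  assume ?L
  then obtain u where u: "u \<in> elts S" "nat_le S u s" "nat_le S u t" "\<theta> \<in> dom u"
    and st: "(s, \<theta>) \<in> germ_pairs S" "(t, \<theta>') \<in> germ_pairs S" "\<theta> = \<theta>'"
    unfolding germ_rel_def by auto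
  then have "s \<cdot> (u\<^sup>\<star> \<cdot> u) = t \<cdot> (u\<^sup>\<star> \<cdot> u)" "\<theta> (u\<^sup>\<star> \<cdot> u)"
    by (simp_all add: nat_le_def charD_iff)
  then show ?R using st u by (auto intro!: bexI[of _ "u\<^sup>\<star> \<cdot> u"])
next
  assume R: ?R
  then obtain e where e: "e \<in> E" "\<theta> e" "s \<cdot> e = t \<cdot> e" by blast
  have le: "nat_le S (s \<cdot> e) s" if "s \<in> elts S" for s
    using that e(1) idem_left_commute[of e "s\<^sup>\<star> \<cdot> s" e] unfolding nat_le_def by simp
  have "nat_le S (s \<cdot> e) s" "nat_le S (s \<cdot> e) t" "\<theta> \<in> dom (s \<cdot> e)"
    using R e le[of s] le[of t] dom_mult_idem[of s e] by (auto simp: germ_pairs_iff charD_iff)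
  then show ?L
    using R e unfolding germ_rel_def by (auto simp: germ_pairs_iff)
qed

lemma equiv_germ_rel: "equiv (germ_pairs S) (germ_rel S)"
proof (rule equivI)
  show "germ_rel S \<subseteq> germ_pairs S \<times> germ_pairs S"
    unfolding germ_rel_def by auto
  show "refl_on (germ_pairs S) (germ_rel S)"
    by (rule refl_onI) (auto simp: germ_rel_iff germ_pairs_iff charD_iff character_nonzero)
  show "sym (germ_rel S)"
    unfolding sym_def germ_rel_def by blast
  show "trans (germ_rel S)"
  proof (rule transI, clarify)
    fix s \<theta> t \<theta>' u \<theta>''
    assume 1: "((s, \<theta>), (t, \<theta>')) \<in> germ_rel S" and 2: "((t, \<theta>'), (u, \<theta>'')) \<in> germ_rel S"
    obtain e f where ef: "e \<in> E" "\<theta> e" "s \<cdot> e = t \<cdot> e" "f \<in> E" "\<theta> f" "t \<cdot> f = u \<cdot> f"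
      using 1 2 by (auto simp: germ_rel_iff)
    have el: "s \<in> elts S" "t \<in> elts S" "u \<in> elts S" "\<theta> \<in> characters S"
      using 1 2 by (auto simp: germ_rel_iff germ_pairs_iff charD_iff)
    have "s \<cdot> (e \<cdot> f) = t \<cdot> (e \<cdot> f)"
      using ef el mult_assoc[of s e f] by simp
    also have "\<dots> = u \<cdot> (e \<cdot> f)"
      using ef el mult_assoc[of t f e] idem_commute[of e f] by simp
    finally show "((s, \<theta>), (u, \<theta>'')) \<in> germ_rel S"
      using 1 2 ef el by (auto simp: germ_rel_iff character_mult idem_prod_idem intro!: bexI[of _ "e \<cdot> f"])
  qed
qed

lemma germ_eq_iff:
  assumes "s \<in> elts S" "\<theta> \<in> dom s" "t \<in> elts S" "\<theta>' \<in> dom t"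
  shows "germ S s \<theta> = germ S t \<theta>' \<longleftrightarrow> \<theta> = \<theta>' \<and> (\<exists>e\<in>E. \<theta> e \<and> s \<cdot> e = t \<cdot> e)"
  unfolding germ_def using assms
  by (subst eq_equiv_class_iff[OF equiv_germ_rel]) (auto simp: germ_pairs_iff germ_rel_iff)

lemma germ_eqI:
  assumes "s \<in> elts S" "\<theta> \<in> dom s" "t \<in> elts S" "e \<in> E" "\<theta> e" "s \<cdot> e = t \<cdot> e"
  shows "\<theta> \<in> dom t" "germ S s \<theta> = germ S t \<theta>"
proof -
  have "\<theta> \<in> charD S e" using assms charD_subset by (auto simp: charD_iff)
  then show "\<theta> \<in> dom t"
    using dom_mult_idem[of s e] dom_mult_idem[of t e] assms by auto
  then show "germ S s \<theta> = germ S t \<theta>"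
    using assms by (subst germ_eq_iff) auto
qed

lemma dact_germ_eq:
  assumes "s \<in> elts S" "\<theta> \<in> dom s" "t \<in> elts S" "\<theta> \<in> dom t" "germ S s \<theta> = germ S t \<theta>"
  shows "dact S s \<theta> = dact S t \<theta>"
proof -
  obtain e where e: "e \<in> E" "\<theta> e" "s \<cdot> e = t \<cdot> e" using assms by (auto simp: germ_eq_iff)
  then have "dact S e \<theta> = \<theta>" using assms by (intro dact_idem) (auto simp: charD_iff)
  then show ?thesis
    using dact_mult[of s e \<theta>] dact_mult[of t e \<theta>] e assms by simp
qed

text \<open>The arrow that stands for the character itself; by \<open>unit_eq\<close> the choice of
  \<open>e\<close> does not matter.\<close>

definition unit :: "('s \<Rightarrow> bool) \<Rightarrow> ('s \<times> ('s \<Rightarrow> bool)) set" where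
  "unit \<theta> = germ S (SOME e. e \<in> E \<and> \<theta> e) \<theta>"

lemma unit_eq:
  assumes e: "e \<in> E" and \<theta>: "\<theta> \<in> charD S e"
  shows "unit \<theta> = germ S e \<theta>"
proof -
  define f where "f = (SOME e. e \<in> E \<and> \<theta> e)"
  have f: "f \<in> E \<and> \<theta> f"
    unfolding f_def using assms by (intro someI[of "\<lambda>e. e \<in> E \<and> \<theta> e" e]) (auto simp: charD_iff)
  then have "germ S f \<theta> = germ S e \<theta>"
    using assms idem_left_commute[of f e f] idem_commute[of f e]
    by (intro germ_eqI(2)[where e = "e \<cdot> f"]) (auto simp: charD_iff character_mult idem_prod_idem)
  then show ?thesis unfolding unit_def f_def .
qed

lemma character_obtain:
  assumes "\<theta> \<in> characters S"
  obtains e where "e \<in> E" "\<theta> \<in> charD S e"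
  using character_nonzero[OF assms] assms by (auto simp: charD_iff)

lemma unit_inject:
  assumes "\<theta> \<in> characters S" "\<theta>' \<in> characters S"
  shows "unit \<theta> = unit \<theta>' \<longleftrightarrow> \<theta> = \<theta>'"
proof -
  obtain e f where ef: "e \<in> E" "\<theta> \<in> charD S e" "f \<in> E" "\<theta>' \<in> charD S f"
    using assms character_obtain by metis
  then have "germ S e \<theta> = germ S f \<theta>' \<longrightarrow> \<theta> = \<theta>'" by (simp add: germ_eq_iff)
  then show ?thesis using unit_eq[OF ef(1,2)] unit_eq[OF ef(3,4)] by metis
qed

lemma gdom_germ [simp]:
  assumes "s \<in> elts S" "\<theta> \<in> dom s"
  shows "gdom G (germ S s \<theta>) = unit \<theta>"
proof -
  have eq: "germ S (s\<^sup>\<star> \<cdot> s) \<theta> = unit \<theta>" if "s \<in> elts S" "\<theta> \<in> dom s" for s \<theta>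
    using that by (intro unit_eq[symmetric]) auto
  show ?thesis
    unfolding universal_groupoid_def top_groupoid.simps
  proof (rule the_equality)
    show "\<exists>(t, \<theta>')\<in>germ_pairs S. germ S s \<theta> = germ S t \<theta>' \<and> unit \<theta> = germ S (t\<^sup>\<star> \<cdot> t) \<theta>'"
      using assms eq by (auto simp: germ_pairs_iff intro!: bexI[of _ "(s, \<theta>)"])
  next
    fix x assume "\<exists>(t, \<theta>')\<in>germ_pairs S. germ S s \<theta> = germ S t \<theta>' \<and> x = germ S (t\<^sup>\<star> \<cdot> t) \<theta>'"
    then show "x = unit \<theta>" using assms eq by (auto simp: germ_pairs_iff germ_eq_iff)
  qed
qed

lemma grng_germ [simp]:
  assumes "s \<in> elts S" "\<theta> \<in> dom s"
  shows "grng G (germ S s \<theta>) = unit (dact S s \<theta>)"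
proof -
  have eq: "germ S (s \<cdot> s\<^sup>\<star>) (dact S s \<theta>) = unit (dact S s \<theta>)" if "s \<in> elts S" "\<theta> \<in> dom s" for s \<theta>
    using that dact_charD by (intro unit_eq[symmetric]) auto
  show ?thesis
    unfolding universal_groupoid_def top_groupoid.simps
  proof (rule the_equality)
    show "\<exists>(t, \<theta>')\<in>germ_pairs S. germ S s \<theta> = germ S t \<theta>' \<and>
        unit (dact S s \<theta>) = germ S (t \<cdot> t\<^sup>\<star>) (dact S t \<theta>')"
      using assms eq by (auto simp: germ_pairs_iff intro!: bexI[of _ "(s, \<theta>)"])
  next
    fix x assume "\<exists>(t, \<theta>')\<in>germ_pairs S. germ S s \<theta> = germ S t \<theta>' \<and>
        x = germ S (t \<cdot> t\<^sup>\<star>) (dact S t \<theta>')"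
    then obtain t \<theta>' where t: "t \<in> elts S" "\<theta>' \<in> dom t" "germ S s \<theta> = germ S t \<theta>'"
      "x = germ S (t \<cdot> t\<^sup>\<star>) (dact S t \<theta>')"
      by (auto simp: germ_pairs_iff)
    moreover from this have "\<theta>' = \<theta>" using assms by (simp add: germ_eq_iff)
    ultimately show "x = unit (dact S s \<theta>)" using assms eq dact_germ_eq[of s \<theta> t] by simp
  qed
qed

lemma germ_mult_cong:
  assumes el: "s \<in> elts S" "t \<in> elts S" "s' \<in> elts S" "t' \<in> elts S"
    and \<theta>: "\<theta> \<in> dom t" "\<theta> \<in> dom t'" "dact S t \<theta> \<in> dom s" "dact S t' \<theta> \<in> dom s'"
    and eq: "germ S t \<theta> = germ S t' \<theta>" "germ S s (dact S t \<theta>) = germ S s' (dact S t' \<theta>)"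
  shows "germ S (s \<cdot> t) \<theta> = germ S (s' \<cdot> t') \<theta>"
proof -
  obtain e f where e: "e \<in> E" "\<theta> e" "t \<cdot> e = t' \<cdot> e"
    and f: "f \<in> E" "dact S t \<theta> f" "s \<cdot> f = s' \<cdot> f"
    using eq el \<theta> by (auto simp: germ_eq_iff)
  have \<theta>c: "\<theta> \<in> characters S" using \<theta> charD_subset by blast
  define w where "w = t \<cdot> e"
  have w: "w \<in> elts S" using el e by (simp add: w_def)
  \<comment> \<open>\<open>e\<close> makes \<open>t\<close> and \<open>t'\<close> agree, and
    \<open>f\<close> makes \<open>s\<close> and \<open>s'\<close> agree after them; \<open>k\<close>
    is the part of \<open>e\<close> that the common restriction \<open>w\<close> carries into
    \<open>f\<close>.\<close>
  define k where "k = w\<^sup>\<star> \<cdot> (f \<cdot> w)"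
  have k: "k \<in> E" using w f by (simp add: k_def)
  have ek: "e \<cdot> k = k" unfolding k_def w_def using el e(1) f(1) by simp
  have "k = e \<cdot> ((t\<^sup>\<star> \<cdot> (f \<cdot> t)) \<cdot> e)" unfolding k_def w_def using el e(1) f(1) by simp
  then have "\<theta> k"
    using e f el \<theta>c by (simp add: character_mult idem_prod_idem dact_apply del: mult_assoc)
  have *: "s \<cdot> (r \<cdot> k) = s \<cdot> f \<cdot> w" if "s \<in> elts S" "r \<in> elts S" "r \<cdot> e = w" for s r
  proof -
    have "r \<cdot> k = w \<cdot> k" using ek that e k mult_assoc[of r e k] by simp
    then show ?thesis using idem_mult_eq[OF w f(1)] that f w by (simp add: k_def)
  qed
  have "s \<cdot> (t \<cdot> k) = s' \<cdot> (t' \<cdot> k)"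
    using *[of s t] *[of s' t'] el e f by (simp add: w_def)
  then show ?thesis
    using el k \<open>\<theta> k\<close> \<theta> by (intro germ_eqI(2)[where e = k]) (simp_all flip: dact_dom_iff del: star_mult)
qed

lemma gmult_germ:
  assumes "s \<in> elts S" "t \<in> elts S" "\<theta> \<in> dom t" "dact S t \<theta> \<in> dom s"
  shows "gmult G (germ S s (dact S t \<theta>)) (germ S t \<theta>) = germ S (s \<cdot> t) \<theta>"
  unfolding universal_groupoid_def top_groupoid.simps
proof (rule the_equality)
  show "\<exists>s' t' \<theta>'. (t', \<theta>') \<in> germ_pairs S \<and> (s', dact S t' \<theta>') \<in> germ_pairs S \<and>
    germ S s (dact S t \<theta>) = germ S s' (dact S t' \<theta>') \<and> germ S t \<theta> = germ S t' \<theta>' \<and>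
    germ S (s \<cdot> t) \<theta> = germ S (s' \<cdot> t') \<theta>'"
    using assms by (auto simp: germ_pairs_iff)
next
  fix c
  assume "\<exists>s' t' \<theta>'. (t', \<theta>') \<in> germ_pairs S \<and> (s', dact S t' \<theta>') \<in> germ_pairs S \<and>
    germ S s (dact S t \<theta>) = germ S s' (dact S t' \<theta>') \<and> germ S t \<theta> = germ S t' \<theta>' \<and>
    c = germ S (s' \<cdot> t') \<theta>'"
  then obtain s' t' \<theta>' where h: "t' \<in> elts S" "\<theta>' \<in> dom t'" "s' \<in> elts S" "dact S t' \<theta>' \<in> dom s'"
    "germ S s (dact S t \<theta>) = germ S s' (dact S t' \<theta>')" "germ S t \<theta> = germ S t' \<theta>'"
    "c = germ S (s' \<cdot> t') \<theta>'"
    by (auto simp: germ_pairs_iff)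
  moreover from this have "\<theta>' = \<theta>" using assms by (simp add: germ_eq_iff)
  ultimately show "c = germ S (s \<cdot> t) \<theta>"
    using germ_mult_cong[of s t s' t' \<theta>] assms by simp
qed

end

section \<open>The universal groupoid\<close>

lemma homeomorphic_map_open_injective:
  assumes f: "continuous_map X Y f" "open_map X Y f" and U: "openin X U" "inj_on f U"
  shows "homeomorphic_map (subtopology X U) (subtopology Y (f ` U)) f"
proof (rule bijective_open_imp_homeomorphic_map)
  have Us: "U \<subseteq> topspace X" and fU: "f ` U \<subseteq> topspace Y"
    using U f openin_subset by (auto simp: continuous_map_def)
  show "continuous_map (subtopology X U) (subtopology Y (f ` U)) f"
    by (intro continuous_map_into_subtopology continuous_map_from_subtopology f) auto
  show "open_map (subtopology X U) (subtopology Y (f ` U)) f"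
    unfolding open_map_def
  proof (intro allI impI)
    fix W assume "openin (subtopology X U) W"
    then have "openin X W" "W \<subseteq> U" using U openin_open_subtopology by blast+
    then have "openin Y (f ` W)" "f ` W \<subseteq> f ` U" using f by (auto simp: open_map_def)
    then show "openin (subtopology Y (f ` U)) (f ` W)" 
      unfolding openin_subtopology by (intro exI[of _ "f ` W"]) blast
  qed
  show "f ` topspace (subtopology X U) = topspace (subtopology Y (f ` U))"
    using Us fU by auto
  show "inj_on f (topspace (subtopology X U))" using U Us by (simp add: inf_absorb2)
qed

lemma homeomorphic_map_imp_inj_on:
  "homeomorphic_map (subtopology X U) Y f \<Longrightarrow> U \<subseteq> topspace X \<Longrightarrow> inj_on f U"
  using homeomorphic_imp_injective_map[of "subtopology X U" Y f] by (simp add: inf_absorb2)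

context inverse_semigroup
begin

text \<open>Openness is read off in the charts \<open>\<theta> \<mapsto> germ S s \<theta>\<close>.
  For a generator \<open>(t, V)\<close> the trace in the chart of \<open>s\<close> is the union of
  the sets \<open>V \<inter> dom s \<inter> charD S e\<close> over the idempotents \<open>e\<close>
  with \<open>s \<cdot> e = t \<cdot> e\<close>, hence open. The continuity proofs use this in place
  of the generated topology.\<close>

lemma openin_universal_groupoid:
  "openin (gtop G) W \<longleftrightarrow> W \<subseteq> {germ S s \<theta> | s \<theta>. s \<in> elts S \<and> \<theta> \<in> dom s} \<and>
     (\<forall>s\<in>elts S. openin (spectrum S) {\<theta> \<in> dom s. germ S s \<theta> \<in> W})"
  (is "_ \<longleftrightarrow> W \<subseteq> ?A \<and> ?P W")
proof -
  let ?B = "{germ_basic S s U | s U. s \<in> elts S \<and> openin (spectrum S) U \<and> U \<subseteq> dom s}"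
  have gtop: "gtop G = topology_generated_by ?B"
    by (simp add: universal_groupoid_def)
  have P: "?P W" if "generate_topology_on ?B W" for W
    using that
  proof (induction rule: generate_topology_on.induct)
    case Empty
    then show ?case by simp
  next
    case (Int a b)
    have "{\<theta> \<in> dom s. germ S s \<theta> \<in> a \<inter> b} = {\<theta> \<in> dom s. germ S s \<theta> \<in> a} \<inter> {\<theta> \<in> dom s. germ S s \<theta> \<in> b}"
      for s by blast
    then show ?case using Int by (simp add: openin_Int)
  next
    case (UN K)
    have "{\<theta> \<in> dom s. germ S s \<theta> \<in> \<Union>K} = (\<Union>k\<in>K. {\<theta> \<in> dom s. germ S s \<theta> \<in> k})" for s
      by blast
    then show ?case using UN by (auto intro: openin_Union)
  next
    case (Basis W)
    then obtain t V where t: "W = germ_basic S t V" "t \<in> elts S" "openin (spectrum S) V" "V \<subseteq> dom t"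
      by blast
    show ?case
    proof
      fix s assume s: "s \<in> elts S"
      have "{\<theta> \<in> dom s. germ S s \<theta> \<in> W} =
          (\<Union>e\<in>{e \<in> E. s \<cdot> e = t \<cdot> e}. V \<inter> dom s \<inter> charD S e)"
      proof (intro set_eqI iffI)
        fix \<theta> assume "\<theta> \<in> {\<theta> \<in> dom s. germ S s \<theta> \<in> W}"
        then obtain \<theta>' where \<theta>: "\<theta> \<in> dom s" "\<theta>' \<in> V" "\<theta>' \<in> dom t" "germ S s \<theta> = germ S t \<theta>'"
          using t(1,4) by (auto simp: germ_basic_def)
        then obtain e where "\<theta> = \<theta>'" "e \<in> E" "\<theta> e" "s \<cdot> e = t \<cdot> e"
          using germ_eq_iff s t(2) by blast
        then show "\<theta> \<in> (\<Union>e\<in>{e \<in> E. s \<cdot> e = t \<cdot> e}. V \<inter> dom s \<inter> charD S e)"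
          using \<theta> by (auto simp: charD_iff)
      next
        fix \<theta> assume "\<theta> \<in> (\<Union>e\<in>{e \<in> E. s \<cdot> e = t \<cdot> e}. V \<inter> dom s \<inter> charD S e)"
        then obtain e where e: "\<theta> \<in> V" "\<theta> \<in> dom s" "e \<in> E" "\<theta> e" "s \<cdot> e = t \<cdot> e"
          by (auto simp: charD_iff)
        then have "germ S s \<theta> = germ S t \<theta>" using germ_eqI s t(2) by blast
        then show "\<theta> \<in> {\<theta> \<in> dom s. germ S s \<theta> \<in> W}"
          using e by (auto simp: t(1) germ_basic_def)
      qed
      moreover have "openin (spectrum S) \<dots>"
        using s t(3) by (intro openin_Union) (auto intro!: openin_Int openin_charD)
      ultimately show "openin (spectrum S) {\<theta> \<in> dom s. germ S s \<theta> \<in> W}" by simp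
    qed
  qed
  have "W \<subseteq> ?A" if "openin (gtop G) W"
    using openin_subset[OF that] unfolding gtop topology_generated_by_topspace
    by (fastforce simp: germ_basic_def)
  moreover have "?P W" if "openin (gtop G) W"
    using that P unfolding gtop openin_topology_generated_by_iff by blast
  moreover have "openin (gtop G) W" if W: "W \<subseteq> ?A" "?P W"
  proof -
    have "W = (\<Union>s\<in>elts S. germ_basic S s {\<theta> \<in> dom s. germ S s \<theta> \<in> W})"
      using W unfolding germ_basic_def by blast
    moreover have "openin (gtop G) (\<Union>s\<in>elts S. germ_basic S s {\<theta> \<in> dom s. germ S s \<theta> \<in> W})"
      unfolding gtop using W(2)
      by (intro openin_Union) (auto intro!: topology_generated_by_Basis)
    ultimately show ?thesis by simp
  qed
  ultimately show ?thesis by blast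
qed

lemma openin_germ_preimage:
  "openin (gtop G) W \<Longrightarrow> s \<in> elts S \<Longrightarrow> openin (spectrum S) {\<theta> \<in> dom s. germ S s \<theta> \<in> W}"
  by (simp add: openin_universal_groupoid)

lemma openin_germ_basic:
  assumes "s \<in> elts S" "openin (spectrum S) U" "U \<subseteq> dom s"
  shows "openin (gtop G) (germ_basic S s U)"
  unfolding universal_groupoid_def top_groupoid.simps using assms
  by (intro topology_generated_by_Basis) blast

lemma arrows_eq: "arrows G = {germ S s \<theta> | s \<theta>. s \<in> elts S \<and> \<theta> \<in> dom s}"
proof
  show "arrows G \<subseteq> {germ S s \<theta> | s \<theta>. s \<in> elts S \<and> \<theta> \<in> dom s}"
    using openin_topspace[of "gtop G"] unfolding openin_universal_groupoid arrows_def by blast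
  show "{germ S s \<theta> | s \<theta>. s \<in> elts S \<and> \<theta> \<in> dom s} \<subseteq> arrows G"
  proof clarify
    fix s \<theta> assume "s \<in> elts S" "\<theta> \<in> dom s"
    then show "germ S s \<theta> \<in> arrows G"
      using openin_subset[OF openin_germ_basic[of s "dom s"]] openin_charD[of "s\<^sup>\<star> \<cdot> s"]
      by (auto simp: germ_basic_def arrows_def)
  qed
qed

lemma arrowE:
  assumes "a \<in> arrows G"
  obtains s \<theta> where "s \<in> elts S" "\<theta> \<in> dom s" "a = germ S s \<theta>"
  using assms arrows_eq by auto

lemma germ_arrow [simp]: "s \<in> elts S \<Longrightarrow> \<theta> \<in> dom s \<Longrightarrow> germ S s \<theta> \<in> arrows G"
  using arrows_eq by auto

lemma unit_obtain:
  assumes "\<theta> \<in> characters S"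
  obtains e where "e \<in> E" "\<theta> \<in> dom e" "unit \<theta> = germ S e \<theta>" "dact S e \<theta> = \<theta>"
  using character_obtain[OF assms] unit_eq dact_idem by (metis idem_mult star_idem)

lemma unit_arrow [simp]:
  assumes "\<theta> \<in> characters S"
  shows "unit \<theta> \<in> arrows G" "gdom G (unit \<theta>) = unit \<theta>" "grng G (unit \<theta>) = unit \<theta>"
  using unit_obtain[OF assms] by (metis germ_arrow gdom_germ grng_germ idems_elts)+

lemma dom_character [simp]: "\<theta> \<in> dom s \<Longrightarrow> \<theta> \<in> characters S"
  using charD_subset by blast

lemma units_eq: "units G = unit ` characters S"
proof
  show "units G \<subseteq> unit ` characters S"
    unfolding units_def by (auto elim!: arrowE simp: eq_commute)
  show "unit ` characters S \<subseteq> units G"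
    unfolding units_def by auto
qed

lemma composable_germ:
  assumes "s \<in> elts S" "t \<in> elts S" "\<theta> \<in> dom t" "dact S t \<theta> \<in> dom s"
  shows "(germ S s (dact S t \<theta>), germ S t \<theta>) \<in> composable G"
  using assms by (simp add: composable_def)

lemma composableE:
  assumes "(a, b) \<in> composable G"
  obtains s t \<theta> where "s \<in> elts S" "t \<in> elts S" "\<theta> \<in> dom t" "dact S t \<theta> \<in> dom s"
    "a = germ S s (dact S t \<theta>)" "b = germ S t \<theta>" "\<theta> \<in> dom (s \<cdot> t)"
proof -
  obtain s \<phi> t \<theta> where st: "s \<in> elts S" "\<phi> \<in> dom s" "a = germ S s \<phi>"
    "t \<in> elts S" "\<theta> \<in> dom t" "b = germ S t \<theta>" "gdom G a = grng G b"
    using assms by (auto simp: composable_def elim!: arrowE)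
  then have "\<phi> = dact S t \<theta>"
    using dact_character by (simp add: unit_inject)
  then show ?thesis using st that dact_dom_iff by blast
qed

lemma is_ginverse_germ:
  assumes "s \<in> elts S" "\<theta> \<in> dom s"
  shows "is_ginverse G (germ S s \<theta>) (germ S s\<^sup>\<star> (dact S s \<theta>))"
proof -
  have d: "dact S s \<theta> \<in> dom s\<^sup>\<star>" using assms dact_charD by simp
  have "gmult G (germ S s \<theta>) (germ S s\<^sup>\<star> (dact S s \<theta>)) = germ S (s \<cdot> s\<^sup>\<star>) (dact S s \<theta>)"
    using gmult_germ[of s "s\<^sup>\<star>" "dact S s \<theta>"] assms d by (simp add: dact_star)
  moreover have "gmult G (germ S s\<^sup>\<star> (dact S s \<theta>)) (germ S s \<theta>) = germ S (s\<^sup>\<star> \<cdot> s) \<theta>"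
    using gmult_germ[of "s\<^sup>\<star>" s \<theta>] assms d by simp
  ultimately show ?thesis
    unfolding is_ginverse_def using assms d dact_charD
    by (simp add: dact_star unit_eq[of "s \<cdot> s\<^sup>\<star>"] unit_eq[of "s\<^sup>\<star> \<cdot> s"])
qed

lemma groupoid: "groupoid G"
  unfolding groupoid_def
proof (intro conjI ballI allI impI)
  show "gdom G a \<in> arrows G" "grng G a \<in> arrows G" "gdom G (gdom G a) = gdom G a"
    "grng G (gdom G a) = gdom G a" "gdom G (grng G a) = grng G a" "grng G (grng G a) = grng G a"
    if "a \<in> arrows G" for a
    using that by (auto elim!: arrowE simp: dact_character)
next
  fix p assume "p \<in> composable G"
  then obtain s t \<theta> where st: "s \<in> elts S" "t \<in> elts S" "\<theta> \<in> dom t" "dact S t \<theta> \<in> dom s"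
    "p = (germ S s (dact S t \<theta>), germ S t \<theta>)" "\<theta> \<in> dom (s \<cdot> t)"
    by (cases p) (auto elim: composableE)
  then show "case p of (a, b) \<Rightarrow> gmult G a b \<in> arrows G \<and>
        gdom G (gmult G a b) = gdom G b \<and> grng G (gmult G a b) = grng G a"
    by (simp add: gmult_germ dact_mult del: star_mult)
next
  fix a b c assume "(a, b) \<in> composable G \<and> (b, c) \<in> composable G"
  then have "a \<in> arrows G" "gdom G a = grng G b" "(b, c) \<in> composable G"
    by (auto simp: composable_def)
  then obtain t u \<theta> where "a \<in> arrows G" "gdom G a = grng G b" and
    tu: "t \<in> elts S" "u \<in> elts S" "\<theta> \<in> dom u" "dact S u \<theta> \<in> dom t"
    "b = germ S t (dact S u \<theta>)" "c = germ S u \<theta>" "\<theta> \<in> dom (t \<cdot> u)"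
    by (elim composableE) auto
  then obtain s \<phi> where s: "s \<in> elts S" "\<phi> \<in> dom s" "a = germ S s \<phi>" "gdom G a = grng G b"
    by (auto elim!: arrowE)
  then have \<phi>: "\<phi> = dact S t (dact S u \<theta>)"
    using tu dact_character by (simp add: unit_inject)
  then have "dact S (t \<cdot> u) \<theta> \<in> dom s" "dact S u \<theta> \<in> dom (s \<cdot> t)"
    using s tu dact_dom_iff[of s t "dact S u \<theta>"] by (simp_all add: dact_mult del: star_mult)
  then show "gmult G (gmult G a b) c = gmult G a (gmult G b c)"
    using s tu \<phi> gmult_germ[of s t "dact S u \<theta>"] gmult_germ[of "s \<cdot> t" u \<theta>]
      gmult_germ[of t u \<theta>] gmult_germ[of s "t \<cdot> u" \<theta>]
    by (simp add: dact_mult del: star_mult)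
next
  fix a assume "a \<in> arrows G"
  then obtain s \<theta> where s: "s \<in> elts S" "\<theta> \<in> dom s" "a = germ S s \<theta>" by (rule arrowE)
  show "gmult G a (gdom G a) = a"
    using gmult_germ[of s "s\<^sup>\<star> \<cdot> s" \<theta>] s by (simp add: unit_eq[of "s\<^sup>\<star> \<cdot> s"] dact_idem)
  show "gmult G (grng G a) a = a"
    using gmult_germ[of "s \<cdot> s\<^sup>\<star>" s \<theta>] s dact_charD by (simp add: unit_eq[of "s \<cdot> s\<^sup>\<star>"])
next
  show "\<exists>b. is_ginverse G a b" if "a \<in> arrows G" for a
    using that is_ginverse_germ by (auto elim!: arrowE)
qed

lemma gmult_assoc:
  assumes "(a, b) \<in> composable G" "(b, c) \<in> composable G"
  shows "gmult G (gmult G a b) c = gmult G a (gmult G b c)"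
proof -
  have "\<forall>a b c. (a, b) \<in> composable G \<and> (b, c) \<in> composable G \<longrightarrow>
      gmult G (gmult G a b) c = gmult G a (gmult G b c)"
    using groupoid unfolding groupoid_def by (elim conjE)
  then show ?thesis using assms by blast
qed

lemma gmult_units:
  assumes "a \<in> arrows G"
  shows "gmult G a (gdom G a) = a" "gmult G (grng G a) a = a"
proof -
  have "\<forall>a\<in>arrows G. gmult G a (gdom G a) = a \<and> gmult G (grng G a) a = a"
    using groupoid unfolding groupoid_def by (elim conjE)
  then show "gmult G a (gdom G a) = a" "gmult G (grng G a) a = a" using assms by auto
qed

lemma ginv_germ [simp]:
  assumes s: "s \<in> elts S" "\<theta> \<in> dom s"
  shows "ginv G (germ S s \<theta>) = germ S s\<^sup>\<star> (dact S s \<theta>)"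
proof -
  have "b = c" if "is_ginverse G a b" "is_ginverse G a c" "a \<in> arrows G" for a b c
  proof -
    have g: "(b, a) \<in> composable G" "(a, c) \<in> composable G"
      using that by (auto simp: composable_def is_ginverse_def)
    have "b = gmult G b (gdom G b)" using gmult_units(1)[of b] that by (simp add: is_ginverse_def)
    also have "\<dots> = gmult G b (gmult G a c)" using that by (simp add: is_ginverse_def)
    also have "\<dots> = gmult G (gmult G b a) c" by (rule gmult_assoc[OF g, symmetric])
    also have "\<dots> = gmult G (grng G c) c" using that by (simp add: is_ginverse_def)
    also have "\<dots> = c" using gmult_units(2)[of c] that by (simp add: is_ginverse_def)
    finally show ?thesis .
  qed
  then show ?thesis
    unfolding ginv_def using is_ginverse_germ[OF s] s by (intro the_equality) auto
qed

lemma topspace_gtop: "topspace (gtop G) = arrows G"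
  by (simp add: arrows_def)

lemma continuous_ginv: "continuous_map (gtop G) (gtop G) (ginv G)"
  unfolding continuous_map_def
proof (intro conjI allI impI)
  show "ginv G \<in> topspace (gtop G) \<rightarrow> topspace (gtop G)"
    using dact_charD by (auto simp: topspace_gtop elim!: arrowE)
  fix W assume W: "openin (gtop G) W"
  have "openin (spectrum S) {\<theta> \<in> dom s. germ S s \<theta> \<in> {a \<in> arrows G. ginv G a \<in> W}}"
    if s: "s \<in> elts S" for s
  proof -
    have "{\<theta> \<in> dom s. germ S s \<theta> \<in> {a \<in> arrows G. ginv G a \<in> W}} =
        {\<theta> \<in> dom s. dact S s \<theta> \<in> {\<theta> \<in> dom s\<^sup>\<star>. germ S s\<^sup>\<star> \<theta> \<in> W}}"
      using s dact_charD by auto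
    then show ?thesis
      using openin_dact_preimage[OF s openin_germ_preimage[OF W, of "s\<^sup>\<star>"]] s by simp
  qed
  then show "openin (gtop G) {x \<in> topspace (gtop G). ginv G x \<in> W}"
    unfolding topspace_gtop openin_universal_groupoid arrows_eq[symmetric] by auto
qed

lemma continuous_gmult:
  "continuous_map (subtopology (prod_topology (gtop G) (gtop G)) (composable G)) (gtop G)
     (\<lambda>(a, b). gmult G a b)"
  unfolding continuous_map_def
proof (intro conjI allI impI)
  let ?X = "subtopology (prod_topology (gtop G) (gtop G)) (composable G)"
  have top: "topspace ?X = composable G"
    by (auto simp: topspace_gtop composable_def)
  show "(\<lambda>(a, b). gmult G a b) \<in> topspace ?X \<rightarrow> topspace (gtop G)"
    using groupoid unfolding top topspace_gtop groupoid_def by auto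
  fix W assume W: "openin (gtop G) W"
  show "openin ?X {x \<in> topspace ?X. (case x of (a, b) \<Rightarrow> gmult G a b) \<in> W}"
    unfolding top
  proof (subst openin_subopen, clarify)
    fix a b assume ab: "(a, b) \<in> composable G" "gmult G a b \<in> W"
    obtain s t \<theta> where st: "s \<in> elts S" "t \<in> elts S" "\<theta> \<in> dom t" "dact S t \<theta> \<in> dom s"
      "a = germ S s (dact S t \<theta>)" "b = germ S t \<theta>" "\<theta> \<in> dom (s \<cdot> t)"
      using ab(1) by (rule composableE)
    define V where "V = {\<theta> \<in> dom (s \<cdot> t). germ S (s \<cdot> t) \<theta> \<in> W}"
    have V: "openin (spectrum S) V" "V \<subseteq> dom t" "\<theta> \<in> V"
      using st ab(2) openin_germ_preimage[OF W, of "s \<cdot> t"] dom_mult_subset[of s t]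
      unfolding V_def by (auto simp: gmult_germ simp del: star_mult)
    let ?T = "(germ_basic S s (dom s) \<times> germ_basic S t V) \<inter> composable G"
    have "openin (prod_topology (gtop G) (gtop G)) (germ_basic S s (dom s) \<times> germ_basic S t V)"
      using st V by (simp add: openin_prod_Times_iff openin_germ_basic openin_charD)
    then have "openin ?X ?T"
      unfolding openin_subtopology by blast
    moreover have "(a, b) \<in> ?T"
      using ab st V by (auto simp: germ_basic_def)
    moreover have "gmult G a' b' \<in> W" if ab': "(a', b') \<in> ?T" for a' b'
    proof -
      obtain \<phi> \<psi> where *: "a' = germ S s \<phi>" "\<phi> \<in> dom s" "b' = germ S t \<psi>" "\<psi> \<in> V"
        using ab' by (auto simp: germ_basic_def)
      \<comment> \<open>Composability determines the character of the left germ, so the product is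
        again a germ of \<open>s \<cdot> t\<close>.\<close>
      then have "\<phi> = dact S t \<psi>"
        using ab' V st dact_character[of t \<psi>] by (auto simp: composable_def unit_inject)
      then show ?thesis
        using * st V gmult_germ[of s t \<psi>] by (auto simp: V_def)
    qed
    ultimately show "\<exists>T. openin ?X T \<and> (a, b) \<in> T \<and>
        T \<subseteq> {x \<in> composable G. (case x of (a, b) \<Rightarrow> gmult G a b) \<in> W}"
      by (intro exI[of _ ?T]) auto
  qed
qed

lemma topological_groupoid: "topological_groupoid G"
  unfolding topological_groupoid_def using groupoid continuous_gmult continuous_ginv by blast

lemma topspace_unit_space: "topspace (unit_space G) = units G"
  unfolding unit_space_def by (auto simp: topspace_gtop units_def)

text \<open>A germ of \<open>s\<close> over \<open>\<theta>\<close> is a unit exactly if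
  \<open>s \<cdot> e = e\<close> for some idempotent \<open>e\<close> with
  \<open>\<theta> e\<close>. This condition is open in \<open>\<theta>\<close>.\<close>

lemma openin_unit_image:
  assumes V: "openin (spectrum S) V"
  shows "openin (gtop G) (unit ` V)"
  unfolding openin_universal_groupoid
proof (intro conjI ballI)
  have Vc: "V \<subseteq> characters S" using openin_subset[OF V] by simp
  then show "unit ` V \<subseteq> {germ S s \<theta> | s \<theta>. s \<in> elts S \<and> \<theta> \<in> dom s}"
    using unit_arrow(1) by (auto simp: arrows_eq[symmetric])
  fix s assume s: "s \<in> elts S"
  have "{\<theta> \<in> dom s. germ S s \<theta> \<in> unit ` V} = (\<Union>e\<in>{e \<in> E. s \<cdot> e = e}. V \<inter> dom s \<inter> charD S e)"
  proof (intro set_eqI iffI)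
    fix \<theta> assume "\<theta> \<in> {\<theta> \<in> dom s. germ S s \<theta> \<in> unit ` V}"
    then obtain \<theta>' where \<theta>: "\<theta> \<in> dom s" "\<theta>' \<in> V" "germ S s \<theta> = unit \<theta>'" by blast
    obtain e where e: "e \<in> E" "\<theta>' \<in> dom e" "unit \<theta>' = germ S e \<theta>'"
      using unit_obtain Vc \<theta>(2) by blast
    then obtain f where f: "\<theta> = \<theta>'" "f \<in> E" "\<theta> f" "s \<cdot> f = e \<cdot> f"
      using s \<theta> by (auto simp: germ_eq_iff)
    then have "s \<cdot> (e \<cdot> f) = e \<cdot> f"
      using s e mult_assoc[of s f e] idem_commute[of e f] idem_left_commute[of e f e] by simp
    moreover have "\<theta> \<in> charD S (e \<cdot> f)"
      using e f by (auto simp: charD_mult charD_iff)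
    ultimately show "\<theta> \<in> (\<Union>e\<in>{e \<in> E. s \<cdot> e = e}. V \<inter> dom s \<inter> charD S e)"
      using e f \<theta> idem_prod_idem by blast
  next
    fix \<theta> assume "\<theta> \<in> (\<Union>e\<in>{e \<in> E. s \<cdot> e = e}. V \<inter> dom s \<inter> charD S e)"
    then obtain e where e: "e \<in> E" "s \<cdot> e = e" "\<theta> \<in> V" "\<theta> \<in> dom s" "\<theta> \<in> charD S e" by blast
    then have "germ S s \<theta> = germ S e \<theta>"
      using s by (intro germ_eqI(2)[where e = e]) (auto simp: charD_iff)
    then show "\<theta> \<in> {\<theta> \<in> dom s. germ S s \<theta> \<in> unit ` V}"
      using e unit_eq[of e \<theta>] by (auto intro!: image_eqI[of _ _ \<theta>])
  qed
  also have "openin (spectrum S) \<dots>"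
    using s V by (intro openin_Union) (auto intro!: openin_Int openin_charD)
  finally show "openin (spectrum S) {\<theta> \<in> dom s. germ S s \<theta> \<in> unit ` V}" .
qed

lemma openin_units: "openin (gtop G) (units G)"
  using openin_unit_image[OF openin_topspace] by (simp add: units_eq)

lemma openin_unit_space_iff: "openin (unit_space G) V \<longleftrightarrow> openin (gtop G) V \<and> V \<subseteq> units G"
  unfolding unit_space_def using openin_open_subtopology[OF openin_units] .

lemma homeomorphic_unit: "homeomorphic_map (spectrum S) (unit_space G) unit"
proof (rule bijective_open_imp_homeomorphic_map)
  show "continuous_map (spectrum S) (unit_space G) unit"
    unfolding continuous_map_def
  proof (intro conjI allI impI)
    show "unit \<in> topspace (spectrum S) \<rightarrow> topspace (unit_space G)"
      by (auto simp: topspace_unit_space units_eq)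
    fix V assume V: "openin (unit_space G) V"
    have "{\<theta> \<in> topspace (spectrum S). unit \<theta> \<in> V} = (\<Union>e\<in>E. {\<theta> \<in> dom e. germ S e \<theta> \<in> V})"
    proof (intro set_eqI iffI)
      fix \<theta> assume "\<theta> \<in> {\<theta> \<in> topspace (spectrum S). unit \<theta> \<in> V}"
      then have "\<theta> \<in> characters S" "unit \<theta> \<in> V" by auto
      then show "\<theta> \<in> (\<Union>e\<in>E. {\<theta> \<in> dom e. germ S e \<theta> \<in> V})"
        by (elim unit_obtain) auto
    next
      fix \<theta> assume "\<theta> \<in> (\<Union>e\<in>E. {\<theta> \<in> dom e. germ S e \<theta> \<in> V})"
      then obtain e where e: "e \<in> E" "\<theta> \<in> charD S e" "germ S e \<theta> \<in> V" by auto
      then show "\<theta> \<in> {\<theta> \<in> topspace (spectrum S). unit \<theta> \<in> V}"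
        using unit_eq[OF e(1,2)] by (simp add: charD_iff)
    qed
    then show "openin (spectrum S) {\<theta> \<in> topspace (spectrum S). unit \<theta> \<in> V}"
      using V openin_germ_preimage[of V] unfolding openin_unit_space_iff
      by (simp only:) (intro openin_Union; blast intro: idems_elts)
  qed
  show "open_map (spectrum S) (unit_space G) unit"
    unfolding open_map_def openin_unit_space_iff units_eq
    using openin_unit_image openin_subset by fastforce
qed (auto simp: topspace_unit_space units_eq inj_on_def unit_inject)

lemma gdom_continuous_open:
  "continuous_map (gtop G) (unit_space G) (gdom G)" "open_map (gtop G) (unit_space G) (gdom G)"
proof -
  show "continuous_map (gtop G) (unit_space G) (gdom G)"
    unfolding continuous_map_def
  proof (intro conjI allI impI)
    show "gdom G \<in> topspace (gtop G) \<rightarrow> topspace (unit_space G)"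
      by (auto simp: topspace_unit_space topspace_gtop units_eq elim!: arrowE)
    fix V assume V: "openin (unit_space G) V"
    then have "openin (spectrum S) {\<theta> \<in> characters S. unit \<theta> \<in> V}"
      using homeomorphic_imp_continuous_map[OF homeomorphic_unit] by (auto simp: continuous_map_def)
    then have "openin (spectrum S) (dom s \<inter> {\<theta> \<in> characters S. unit \<theta> \<in> V})" if "s \<in> elts S" for s
      using that by (intro openin_Int openin_charD) auto
    moreover have "{\<theta> \<in> dom s. germ S s \<theta> \<in> {a \<in> arrows G. gdom G a \<in> V}} =
        dom s \<inter> {\<theta> \<in> characters S. unit \<theta> \<in> V}" if "s \<in> elts S" for s
      using that by auto
    ultimately show "openin (gtop G) {a \<in> topspace (gtop G). gdom G a \<in> V}"
      unfolding topspace_gtop openin_universal_groupoid arrows_eq[symmetric] by auto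
  qed
  show "open_map (gtop G) (unit_space G) (gdom G)"
    unfolding open_map_def
  proof (intro allI impI)
    fix W assume W: "openin (gtop G) W"
    have "gdom G ` W = unit ` (\<Union>s\<in>elts S. {\<theta> \<in> dom s. germ S s \<theta> \<in> W})" (is "?L = ?R")
    proof
      show "?L \<subseteq> ?R"
      proof clarify
        fix a assume a: "a \<in> W"
        then have "a \<in> arrows G" using openin_subset[OF W] topspace_gtop by blast
        then show "gdom G a \<in> ?R" using a by (auto elim!: arrowE)
      qed
      show "?R \<subseteq> ?L" by (force simp: image_iff)
    qed
    moreover have "openin (spectrum S) (\<Union>s\<in>elts S. {\<theta> \<in> dom s. germ S s \<theta> \<in> W})"
      using openin_germ_preimage[OF W] by (intro openin_Union) auto
    ultimately show "openin (unit_space G) (gdom G ` W)"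
      using homeomorphic_imp_open_map[OF homeomorphic_unit] by (auto simp: open_map_def)
  qed
qed

lemma gdom_ginv: "a \<in> arrows G \<Longrightarrow> gdom G (ginv G a) = grng G a"
  and ginv_ginv: "a \<in> arrows G \<Longrightarrow> ginv G (ginv G a) = a"
  and ginv_arrow: "a \<in> arrows G \<Longrightarrow> ginv G a \<in> arrows G"
  using dact_charD by (auto elim!: arrowE simp: dact_star)

lemma grng_continuous_open:
  "continuous_map (gtop G) (unit_space G) (grng G)" "open_map (gtop G) (unit_space G) (grng G)"
proof -
  have "continuous_map (gtop G) (unit_space G) (gdom G \<circ> ginv G)"
    using continuous_ginv gdom_continuous_open(1) by (rule continuous_map_compose)
  then show "continuous_map (gtop G) (unit_space G) (grng G)"
    by (rule continuous_map_eq) (simp add: topspace_gtop gdom_ginv)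
  show "open_map (gtop G) (unit_space G) (grng G)"
    unfolding open_map_def
  proof (intro allI impI)
    fix W assume W: "openin (gtop G) W"
    then have sub: "W \<subseteq> arrows G" using openin_subset topspace_gtop by blast
    have "grng G ` W = gdom G ` {a \<in> arrows G. ginv G a \<in> W}"
    proof (intro set_eqI iffI)
      fix x assume "x \<in> grng G ` W"
      then obtain a where "a \<in> W" "x = grng G a" by blast
      then show "x \<in> gdom G ` {a \<in> arrows G. ginv G a \<in> W}"
        using sub by (intro image_eqI[of _ _ "ginv G a"]) (auto simp: gdom_ginv ginv_ginv ginv_arrow)
    next
      fix x assume "x \<in> gdom G ` {a \<in> arrows G. ginv G a \<in> W}"
      then obtain a where "a \<in> arrows G" "ginv G a \<in> W" "x = gdom G a" by blast
      then show "x \<in> grng G ` W"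
        using gdom_ginv[of "ginv G a"] by (intro image_eqI[of _ _ "ginv G a"]) (auto simp: ginv_ginv ginv_arrow)
    qed
    moreover have "openin (gtop G) {a \<in> arrows G. ginv G a \<in> W}"
      using continuous_ginv W by (auto simp: continuous_map_def topspace_gtop)
    ultimately show "openin (unit_space G) (grng G ` W)"
      using gdom_continuous_open(2) by (auto simp: open_map_def)
  qed
qed

text \<open>The maps \<open>gdom G\<close> and \<open>grng G\<close> are continuous and open, so
  injectivity alone makes them homeomorphisms from an open set onto its image.\<close>

lemma local_bisection_iff:
  "local_bisection G U \<longleftrightarrow> openin (gtop G) U \<and> inj_on (gdom G) U \<and> inj_on (grng G) U"
proof
  assume *: "local_bisection G U"
  then have "U \<subseteq> topspace (gtop G)" using openin_subset by (auto simp: local_bisection_def)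
  with * show "openin (gtop G) U \<and> inj_on (gdom G) U \<and> inj_on (grng G) U"
    unfolding local_bisection_def by (auto intro: homeomorphic_map_imp_inj_on)
next
  assume "openin (gtop G) U \<and> inj_on (gdom G) U \<and> inj_on (grng G) U"
  then show "local_bisection G U"
    unfolding local_bisection_def
    by (auto intro!: homeomorphic_map_open_injective gdom_continuous_open grng_continuous_open)
qed

lemma local_bisection_germ_basic:
  assumes s: "s \<in> elts S" and V: "openin (spectrum S) V" "V \<subseteq> dom s"
  shows "local_bisection G (germ_basic S s V)"
proof -
  have "\<theta> = \<theta>'" if "\<theta> \<in> V" "\<theta>' \<in> V" "dact S s \<theta> = dact S s \<theta>'" for \<theta> \<theta>'
    using that s V(2) dact_star by (metis subsetD)
  then have "inj_on (\<lambda>\<theta>. dact S s \<theta>) V" by (rule inj_onI)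
  moreover have "\<theta> \<in> characters S \<and> dact S s \<theta> \<in> characters S \<and> \<theta> \<in> dom s" if "\<theta> \<in> V" for \<theta>
    using that s V(2) dact_character charD_subset by blast
  ultimately have "inj_on (gdom G \<circ> germ S s) V" "inj_on (grng G \<circ> germ S s) V"
    using s by (auto simp: inj_on_def unit_inject)
  then show ?thesis
    unfolding local_bisection_iff germ_basic_def
    using openin_germ_basic[OF s V] by (auto simp: germ_basic_def intro: inj_on_imageI)
qed

lemma compactin_germ_basic:
  assumes s: "s \<in> elts S" and V: "compactin (spectrum S) V" "V \<subseteq> dom s"
  shows "compactin (gtop G) (germ_basic S s V)"
  unfolding germ_basic_def
proof (rule image_compactin)
  show "compactin (subtopology (spectrum S) (dom s)) V"
    using V by (simp add: compactin_subtopology)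
  have "openin (spectrum S) (dom s)" using s by (simp add: openin_charD)
  then show "continuous_map (subtopology (spectrum S) (dom s)) (gtop G) (germ S s)"
    unfolding continuous_map_def topspace_gtop using s charD_subset
    by (auto simp: openin_open_subtopology Int_absorb1 openin_germ_preimage)
qed

lemma etale_groupoid: "etale_groupoid G"
  unfolding etale_groupoid_def
proof (intro conjI topological_groupoid)
  have "spectrum S homeomorphic_space unit_space G"
    using homeomorphic_unit homeomorphic_map_imp_homeomorphic_space by blast
  then show "locally_compact_space (unit_space G)" "Hausdorff_space (unit_space G)"
    using Hausdorff_spectrum locally_compact_spectrum
      homeomorphic_locally_compact_space homeomorphic_Hausdorff_space by blast+
  show "local_homeomorphism (gtop G) (unit_space G) (gdom G)"
    unfolding local_homeomorphism_def
  proof (intro conjI ballI)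
    show "gdom G ` topspace (gtop G) \<subseteq> topspace (unit_space G)"
      using gdom_continuous_open(1) by (auto simp: continuous_map_def)
    fix a assume "a \<in> topspace (gtop G)"
    then obtain s \<theta> where s: "s \<in> elts S" "\<theta> \<in> dom s" "a = germ S s \<theta>"
      unfolding topspace_gtop by (rule arrowE)
    let ?U = "germ_basic S s (dom s)"
    have "local_bisection G ?U"
      using s by (intro local_bisection_germ_basic) (auto simp: openin_charD)
    then have "openin (gtop G) ?U" "openin (unit_space G) (gdom G ` ?U)"
      "homeomorphic_map (subtopology (gtop G) ?U) (subtopology (unit_space G) (gdom G ` ?U)) (gdom G)"
      using gdom_continuous_open(2) unfolding local_bisection_def open_map_def by blast+
    moreover have "a \<in> ?U" using s by (auto simp: germ_basic_def)
    ultimately show "\<exists>U. openin (gtop G) U \<and> a \<in> U \<and> openin (unit_space G) (gdom G ` U) \<and>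
        homeomorphic_map (subtopology (gtop G) U) (subtopology (unit_space G) (gdom G ` U)) (gdom G)"
      by blast
  qed
qed

text \<open>The sets \<open>charDs e F\<close> are compact and open and form a basis of the
  spectrum; \<open>unit\<close> carries them over to the unit space.\<close>

theorem ample_universal_groupoid: "ample_groupoid G"
  unfolding ample_groupoid_def
proof (intro conjI etale_groupoid ext)
  fix V
  have "openin (unit_space G) V" if "(arbitrary union_of (\<lambda>V. compactin (unit_space G) V \<and> openin (unit_space G) V)) V"
    using that openin_subopen[of "unit_space G" V] unfolding arbitrary_union_of_alt by blast
  moreover have "(arbitrary union_of (\<lambda>V. compactin (unit_space G) V \<and> openin (unit_space G) V)) V"
    if V: "openin (unit_space G) V"
    unfolding arbitrary_union_of_alt
  proof
    fix x assume x: "x \<in> V"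
    then obtain \<theta> where \<theta>: "x = unit \<theta>" "\<theta> \<in> characters S"
      using openin_subset[OF V] by (auto simp: topspace_unit_space units_eq)
    have cont: "continuous_map (spectrum S) (unit_space G) unit"
      and op: "open_map (spectrum S) (unit_space G) unit"
      using homeomorphic_unit homeomorphic_imp_continuous_map homeomorphic_imp_open_map by blast+
    have "openin (spectrum S) {\<theta> \<in> characters S. unit \<theta> \<in> V}"
      using cont V by (auto simp: continuous_map_def)
    then obtain e F where eF: "e \<in> E" "finite F" "F \<subseteq> E" "\<theta> \<in> charDs e F"
      "charDs e F \<subseteq> {\<theta> \<in> characters S. unit \<theta> \<in> V}"
      using \<theta> x by (elim spectrum_basis[of _ \<theta>]) auto
    let ?U = "unit ` (charDs e F)"
    have "compactin (unit_space G) ?U"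
      using image_compactin[OF compactin_charD_diff[OF eF(1-3)] cont] .
    moreover have "openin (unit_space G) ?U"
      using op openin_charD_diff[OF eF(1-3)] by (auto simp: open_map_def)
    ultimately show "\<exists>U. (compactin (unit_space G) U \<and> openin (unit_space G) U) \<and> x \<in> U \<and> U \<subseteq> V"
      using eF \<theta> by (intro exI[of _ ?U]) auto
  qed
  ultimately show "openin (unit_space G) V =
      (arbitrary union_of (\<lambda>V. compactin (unit_space G) V \<and> openin (unit_space G) V)) V"
    by blast
qed

end

section \<open>Steinberg algebras\<close>

interpretation pointwise: vector_space "(\<lambda>c f x. c * f x) :: 'k::field \<Rightarrow> ('x \<Rightarrow> 'k) \<Rightarrow> 'x \<Rightarrow> 'k"
  by unfold_locales (auto simp: algebra_simps)

lemma sum_fun_eq: "(\<Sum>i\<in>A. f i) = (\<lambda>x. \<Sum>i\<in>A. f i x :: 'k::field)"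
  by (induction A rule: infinite_finite_induct) (auto simp: zero_fun_def)

text \<open>By bilinearity the claim passes from \<open>B\<close> to its span in one factor at a
  time.\<close>

lemma span_mult_closed:
  fixes B :: "('x \<Rightarrow> 'k::field) set"
  assumes B: "\<And>f g. f \<in> B \<Longrightarrow> g \<in> B \<Longrightarrow> (\<lambda>x. f x * g x) \<in> pointwise.span B"
    and f: "f \<in> pointwise.span B" and g: "g \<in> pointwise.span B"
  shows "(\<lambda>x. f x * g x) \<in> pointwise.span B"
proof -
  have sub: "pointwise.subspace {f. (\<lambda>x. f x * h x) \<in> pointwise.span B}" for h
  proof (rule pointwise.subspaceI, unfold mem_Collect_eq)
    show "(\<lambda>x. 0 x * h x) \<in> pointwise.span B"
      using pointwise.span_zero[of B] by (simp add: zero_fun_def)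
    show "(\<lambda>x. (f + f') x * h x) \<in> pointwise.span B"
      if "(\<lambda>x. f x * h x) \<in> pointwise.span B" "(\<lambda>x. f' x * h x) \<in> pointwise.span B" for f f'
      using pointwise.span_add[OF that] by (simp add: plus_fun_def distrib_right)
    show "(\<lambda>x. c * f x * h x) \<in> pointwise.span B"
      if "(\<lambda>x. f x * h x) \<in> pointwise.span B" for c f
      using pointwise.span_scale[OF that, of c] by (simp add: mult.assoc)
  qed
  have "(\<lambda>x. h x * g x) \<in> pointwise.span B" if h: "h \<in> B" for h
  proof -
    have "(\<lambda>x. g x * h x) \<in> pointwise.span B"
      using pointwise.span_minimal[OF _ sub[of h], of B] B h g by blast
    moreover have "(\<lambda>x. g x * h x) = (\<lambda>x. h x * g x)"
      by (rule ext) (rule mult.commute)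
    ultimately show ?thesis by (simp only:)
  qed
  then show ?thesis
    using pointwise.span_minimal[OF _ sub[of g], of B] f by blast
qed

lemma indicator_empty_eq_zero: "(indicator {} :: 'x \<Rightarrow> 'k::field) = 0"
  by (auto simp: indicator_def)

lemma steinberg_algebra_eq_span:
  "(steinberg_algebra G :: ('a \<Rightarrow> 'k::field) set) =
     pointwise.span (indicator ` {U. local_bisection G U \<and> compactin (gtop G) U})"
    (is "_ = pointwise.span (indicator ` ?B)")
proof
  show "(steinberg_algebra G :: ('a \<Rightarrow> 'k) set) \<subseteq> pointwise.span (indicator ` ?B)"
  proof
    fix f :: "'a \<Rightarrow> 'k" assume "f \<in> steinberg_algebra G"
    then obtain \<U> c where "finite \<U>" "\<U> \<subseteq> ?B" "f = (\<Sum>U\<in>\<U>. (\<lambda>g. c U * indicator U g))"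
      unfolding steinberg_algebra_def sum_fun_eq by blast
    moreover have "(\<lambda>g. c U * indicator U g) \<in> pointwise.span (indicator ` ?B)" if "U \<in> ?B" for U
      by (rule pointwise.span_scale[OF pointwise.span_base[OF imageI[OF that]]])
    ultimately show "f \<in> pointwise.span (indicator ` ?B)"
      using pointwise.span_sum[of \<U> "\<lambda>U g. c U * indicator U g"] by blast
  qed
  show "pointwise.span (indicator ` ?B) \<subseteq> (steinberg_algebra G :: ('a \<Rightarrow> 'k) set)"
  proof
    fix f :: "'a \<Rightarrow> 'k" assume "f \<in> pointwise.span (indicator ` ?B)"
    then obtain t r where t: "finite t" "t \<subseteq> indicator ` ?B" "f = (\<Sum>a\<in>t. (\<lambda>x. r a * a x))"
      unfolding pointwise.span_explicit by blast
    \<comment> \<open>The span is indexed by functions, the definition by sets; injectivity of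
      \<open>indicator\<close> lets the coefficients be transferred.\<close>
    have inj: "inj (indicator :: 'a set \<Rightarrow> 'a \<Rightarrow> 'k)"
    proof (rule injI)
      fix U V :: "'a set" assume *: "(indicator U :: 'a \<Rightarrow> 'k) = indicator V"
      have "x \<in> U \<longleftrightarrow> x \<in> V" for x
        using fun_cong[OF *, of x] by (auto simp: indicator_def split: if_splits)
      then show "U = V" by blast
    qed
    obtain \<U> where U: "\<U> \<subseteq> ?B" "finite \<U>" "t = indicator ` \<U>"
      using finite_subset_image[OF t(1,2)] by blast
    have "f = (\<lambda>g. \<Sum>U\<in>\<U>. r (indicator U) * indicator U g)"
      unfolding t(3) U(3) sum_fun_eq using inj
      by (simp add: sum.reindex inj_on_subset[OF inj] o_def)
    then show "f \<in> steinberg_algebra G"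
      unfolding steinberg_algebra_def using U
      by (intro CollectI exI[of _ \<U>] exI[of _ "\<lambda>U. r (indicator U)"]) auto
  qed
qed

section \<open>Generators of the Steinberg algebra\<close>

context inverse_semigroup
begin

definition ind :: "'s \<Rightarrow> ('s \<times> ('s \<Rightarrow> bool)) set \<Rightarrow> 'k::field" where
  "ind s = indicator (germ_basic S s (dom s))"

lemma ind_germ:
  assumes "s \<in> elts S" "t \<in> elts S" "\<theta> \<in> dom t"
  shows "ind s (germ S t \<theta>) = (of_bool (\<exists>e\<in>E. \<theta> e \<and> s \<cdot> e = t \<cdot> e) :: 'k::field)"
proof -
  have "germ S t \<theta> \<in> germ_basic S s (dom s) \<longleftrightarrow> (\<exists>e\<in>E. \<theta> e \<and> s \<cdot> e = t \<cdot> e)"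
  proof
    assume "germ S t \<theta> \<in> germ_basic S s (dom s)"
    then obtain \<theta>' where "\<theta>' \<in> dom s" "germ S t \<theta> = germ S s \<theta>'"
      unfolding germ_basic_def by blast
    then show "\<exists>e\<in>E. \<theta> e \<and> s \<cdot> e = t \<cdot> e"
      using assms germ_eq_iff[of t \<theta> s \<theta>'] by metis
  next
    assume "\<exists>e\<in>E. \<theta> e \<and> s \<cdot> e = t \<cdot> e"
    then obtain e where "e \<in> E" "\<theta> e" "t \<cdot> e = s \<cdot> e" by metis
    then show "germ S t \<theta> \<in> germ_basic S s (dom s)"
      using germ_eqI[of t \<theta> s e] assms unfolding germ_basic_def by auto
  qed
  then show ?thesis by (simp add: ind_def indicator_def)
qed

lemma germ_basic_dom_arrows: "s \<in> elts S \<Longrightarrow> germ_basic S s (dom s) \<subseteq> arrows G"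
  by (auto simp: germ_basic_def)

lemma ind_off: "s \<in> elts S \<Longrightarrow> a \<notin> arrows G \<Longrightarrow> ind s a = 0"
  using germ_basic_dom_arrows by (auto simp: ind_def indicator_def)

abbreviation A :: "(('s \<times> ('s \<Rightarrow> bool)) set \<Rightarrow> 'k::field) set" where
  "A \<equiv> steinberg_algebra G"

lemma ind_in_algebra: "s \<in> elts S \<Longrightarrow> ind s \<in> A"
  unfolding steinberg_algebra_eq_span ind_def
  by (intro pointwise.span_base imageI)
     (auto intro!: local_bisection_germ_basic compactin_germ_basic openin_charD compactin_charD)

text \<open>The Boolean algebra of compact open sets generated by the sets \<open>D(e)\<close>, described through
  their characteristic functions over \<open>'k\<close>.\<close>

definition constructible :: "'k::field itself \<Rightarrow> ('s \<Rightarrow> bool) set \<Rightarrow> bool" where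
  "constructible _ V \<longleftrightarrow>
     (indicator V :: _ \<Rightarrow> 'k) \<in> pointwise.span ((\<lambda>e. indicator (charD S e)) ` E)"

lemma constructible_charD: "e \<in> E \<Longrightarrow> constructible TYPE('k::field) (charD S e)"
  unfolding constructible_def by (intro pointwise.span_base imageI)

lemma constructible_Int:
  assumes "constructible TYPE('k::field) V" "constructible TYPE('k) W"
  shows "constructible TYPE('k) (V \<inter> W)"
proof -
  let ?B = "(\<lambda>e. indicator (charD S e) :: _ \<Rightarrow> 'k) ` E"
  have "(\<lambda>x. indicator V x * indicator W x :: 'k) \<in> pointwise.span ?B"
  proof (rule span_mult_closed)
    fix f g assume "f \<in> ?B" "g \<in> ?B"
    then obtain e e' where e: "e \<in> E" "e' \<in> E" "f = indicator (charD S e)" "g = indicator (charD S e')"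
      by blast
    then have "(\<lambda>x. f x * g x) = indicator (charD S (e \<cdot> e'))"
      by (auto simp: charD_mult indicator_inter_arith)
    then show "(\<lambda>x. f x * g x) \<in> pointwise.span ?B"
      using e idem_prod_idem by (auto intro!: pointwise.span_base)
  qed (use assms in \<open>simp_all add: constructible_def\<close>)
  moreover have "(indicator (V \<inter> W) :: _ \<Rightarrow> 'k) = (\<lambda>x. indicator V x * indicator W x)"
    by (rule ext) (rule indicator_inter_arith)
  ultimately show ?thesis unfolding constructible_def by (simp only:)
qed

lemma constructible_Diff:
  assumes "constructible TYPE('k::field) V" "constructible TYPE('k) W"
  shows "constructible TYPE('k) (V - W)"
proof -
  have "(indicator (V - W) :: _ \<Rightarrow> 'k) = indicator V - indicator (V \<inter> W)"
    by (auto simp: indicator_def)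
  with assms(1) constructible_Int[OF assms] show ?thesis
    unfolding constructible_def by (simp only: pointwise.span_diff)
qed

lemma constructible_Un:
  assumes "constructible TYPE('k::field) V" "constructible TYPE('k) W"
  shows "constructible TYPE('k) (V \<union> W)"
proof -
  have "(indicator (V \<union> W) :: _ \<Rightarrow> 'k) = indicator V + indicator (W - V)"
    by (auto simp: indicator_def)
  with assms(1) constructible_Diff[OF assms(2,1)] show ?thesis
    unfolding constructible_def by (simp only: pointwise.span_add)
qed

lemma constructible_charD_diff:
  assumes "finite F" "F \<subseteq> E" "e \<in> E"
  shows "constructible TYPE('k::field) (charDs e F)"
  using assms
proof (induction F rule: finite_induct)
  case empty
  then show ?case by (simp add: constructible_charD)
next
  case (insert f F)
  have "charD S e - (\<Union>f\<in>insert f F. charD S f) = (charDs e F) - charD S f"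
    by blast
  moreover have "constructible TYPE('k) (charDs e F)" "f \<in> E"
    using insert by auto
  ultimately show ?case by (simp add: constructible_Diff constructible_charD)
qed

text \<open>The predicate \<open>?P\<close> transports a function of characters to the germs of
  \<open>s\<close>, extended by \<open>0\<close>. It is linear, so only the functions
  \<open>indicator (charD S e)\<close> have to be treated, and their transport is
  \<open>ind (s \<cdot> e)\<close>.\<close>

lemma indicator_germ_basic_in_span:
  assumes s: "s \<in> elts S" and V: "constructible TYPE('k::field) V" "V \<subseteq> dom s"
  shows "(indicator (germ_basic S s V) :: _ \<Rightarrow> 'k) \<in> pointwise.span (ind ` elts S)"
proof -
  let ?P = "\<lambda>\<phi> :: ('s \<Rightarrow> bool) \<Rightarrow> 'k. \<exists>f\<in>pointwise.span (ind ` elts S).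
    (\<forall>\<theta>\<in>dom s. f (germ S s \<theta>) = \<phi> \<theta>) \<and> (\<forall>a. a \<notin> germ_basic S s (dom s) \<longrightarrow> f a = 0)"
  have "?P (indicator V)"
    using V(1) unfolding constructible_def
  proof (rule pointwise.span_induct)
    show "pointwise.subspace {\<phi>. ?P \<phi>}"
    proof (rule pointwise.subspaceI; clarsimp)
      show "\<exists>f\<in>pointwise.span (ind ` elts S). (\<forall>\<theta>\<in>dom s. f (germ S s \<theta>) = 0) \<and>
          (\<forall>a. a \<notin> germ_basic S s (dom s) \<longrightarrow> f a = 0)"
        by (rule bexI[of _ 0]) (auto simp: pointwise.span_zero)
      fix \<phi> \<psi> :: "('s \<Rightarrow> bool) \<Rightarrow> 'k" and f g
      assume "f \<in> pointwise.span (ind ` elts S)" "g \<in> pointwise.span (ind ` elts S)"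
        "\<forall>\<theta>\<in>dom s. f (germ S s \<theta>) = \<phi> \<theta>" "\<forall>\<theta>\<in>dom s. g (germ S s \<theta>) = \<psi> \<theta>"
        "\<forall>a. a \<notin> germ_basic S s (dom s) \<longrightarrow> f a = 0" "\<forall>a. a \<notin> germ_basic S s (dom s) \<longrightarrow> g a = 0"
      then show "\<exists>f\<in>pointwise.span (ind ` elts S). (\<forall>\<theta>\<in>dom s. f (germ S s \<theta>) = \<phi> \<theta> + \<psi> \<theta>) \<and>
          (\<forall>a. a \<notin> germ_basic S s (dom s) \<longrightarrow> f a = 0)"
        by (intro bexI[of _ "f + g"]) (auto simp: pointwise.span_add)
    next
      fix c :: 'k and \<phi> :: "('s \<Rightarrow> bool) \<Rightarrow> 'k" and f
      assume "f \<in> pointwise.span (ind ` elts S)" "\<forall>\<theta>\<in>dom s. f (germ S s \<theta>) = \<phi> \<theta>"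
        "\<forall>a. a \<notin> germ_basic S s (dom s) \<longrightarrow> f a = 0"
      then show "\<exists>f\<in>pointwise.span (ind ` elts S). (\<forall>\<theta>\<in>dom s. f (germ S s \<theta>) = c * \<phi> \<theta>) \<and>
          (\<forall>a. a \<notin> germ_basic S s (dom s) \<longrightarrow> f a = 0)"
        by (intro bexI[of _ "\<lambda>a. c * f a"]) (auto simp: pointwise.span_scale)
    qed
    fix \<phi> :: "('s \<Rightarrow> bool) \<Rightarrow> 'k" assume "\<phi> \<in> (\<lambda>e. indicator (charD S e)) ` E"
    then obtain e where e: "e \<in> E" "\<phi> = indicator (charD S e)" by blast
    have d: "dom (s \<cdot> e) = dom s \<inter> charD S e" using dom_mult_idem s e by blast
    have "germ S (s \<cdot> e) \<theta> = germ S s \<theta>" if "\<theta> \<in> dom (s \<cdot> e)" for \<theta>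
      using that s e d by (intro germ_eqI(2)[where e = e]) (auto simp: charD_iff)
    then have sub: "germ_basic S (s \<cdot> e) (dom (s \<cdot> e)) = germ_basic S s (dom s \<inter> charD S e)"
      unfolding germ_basic_def d[symmetric] by (rule image_cong[OF refl])
    have "ind (s \<cdot> e) (germ S s \<theta>) = \<phi> \<theta>" if "\<theta> \<in> dom s" for \<theta>
      using that s germ_eq_iff[of s \<theta> s] unfolding ind_def sub e(2)
      by (auto simp: germ_basic_def indicator_def)
    moreover have "ind (s \<cdot> e) a = (0::'k)" if "a \<notin> germ_basic S s (dom s)" for a
      using that unfolding ind_def sub by (auto simp: germ_basic_def indicator_def)
    ultimately show "?P \<phi>"
      using s e by (intro bexI[of _ "ind (s \<cdot> e)"]) (auto intro: pointwise.span_base)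
  qed
  then obtain f :: "_ \<Rightarrow> 'k" where f: "f \<in> pointwise.span (ind ` elts S)"
    "\<And>\<theta>. \<theta> \<in> dom s \<Longrightarrow> f (germ S s \<theta>) = indicator V \<theta>"
    "\<And>a. a \<notin> germ_basic S s (dom s) \<Longrightarrow> f a = 0" by blast
  have "f a = indicator (germ_basic S s V) a" for a
  proof (cases "a \<in> germ_basic S s (dom s)")
    case True
    then obtain \<theta> where "\<theta> \<in> dom s" "a = germ S s \<theta>" by (auto simp: germ_basic_def)
    moreover from this have "a \<in> germ_basic S s V \<longleftrightarrow> \<theta> \<in> V"
      using s V(2) germ_eq_iff[of s \<theta> s] by (auto simp: germ_basic_def)
    ultimately show ?thesis using f(2) by (simp add: indicator_def)
  next
    case False
    then have "a \<notin> germ_basic S s V" using V(2) by (auto simp: germ_basic_def)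
    then show ?thesis using f(3) False by simp
  qed
  then have "f = indicator (germ_basic S s V)" by blast
  then show ?thesis using f(1) by simp
qed

text \<open>A compact bisection \<open>U\<close> is covered by finitely many pieces
  \<open>(s, N)\<close> with \<open>N\<close> constructible. They are added one by one:
  \<open>gdom G\<close> is injective on \<open>U\<close>, so the overlap of a new piece with the
  earlier ones is determined by its characters, and the remainder \<open>N - M\<close> is again
  constructible.\<close>

lemma steinberg_algebra_eq_span_ind: "(A :: (_ \<Rightarrow> 'k::field) set) = pointwise.span (ind ` elts S)"
proof
  show "pointwise.span (ind ` elts S) \<subseteq> A"
    using ind_in_algebra unfolding steinberg_algebra_eq_span
    by (intro pointwise.span_minimal) auto
  have "(indicator U :: _ \<Rightarrow> 'k) \<in> pointwise.span (ind ` elts S)"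
    if U: "local_bisection G U" "compactin (gtop G) U" for U
  proof -
    define \<N> where "\<N> = {(s, N). s \<in> elts S \<and> N \<subseteq> dom s \<and> openin (spectrum S) N \<and>
      constructible TYPE('k) N \<and> germ_basic S s N \<subseteq> U}"
    have Uop: "openin (gtop G) U" and inj: "inj_on (gdom G) U"
      using U(1) by (auto simp: local_bisection_iff)
    have "\<exists>\<B>. finite \<B> \<and> \<B> \<subseteq> (\<lambda>(s, N). germ_basic S s N) ` \<N> \<and> U \<subseteq> \<Union>\<B>"
    proof (rule compactinD[OF U(2)])
      show "openin (gtop G) B" if "B \<in> (\<lambda>(s, N). germ_basic S s N) ` \<N>" for B
        using that openin_germ_basic by (auto simp: \<N>_def)
      show "U \<subseteq> \<Union> ((\<lambda>(s, N). germ_basic S s N) ` \<N>)"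
      proof
        fix a assume a: "a \<in> U"
        then have "a \<in> arrows G" using openin_subset[OF Uop] topspace_gtop by blast
        then obtain s \<theta> where s: "s \<in> elts S" "\<theta> \<in> dom s" "a = germ S s \<theta>" by (rule arrowE)
        obtain e F where eF: "e \<in> E" "finite F" "F \<subseteq> E" "\<theta> \<in> charDs e F"
          "charDs e F \<subseteq> {\<theta> \<in> dom s. germ S s \<theta> \<in> U}"
          using spectrum_basis[OF openin_germ_preimage[OF Uop s(1)], of \<theta>] s a by blast
        then have "(s, charDs e F) \<in> \<N>"
          unfolding \<N>_def using s openin_charD_diff[OF eF(1-3)] constructible_charD_diff[OF eF(2,3,1)]
          by (auto simp: germ_basic_def)
        moreover have "a \<in> germ_basic S s (charDs e F)"
          unfolding germ_basic_def s(3) using eF(4) by (rule imageI)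
        ultimately show "a \<in> \<Union> ((\<lambda>(s, N). germ_basic S s N) ` \<N>)" by blast
      qed
    qed
    then obtain \<B> where B: "finite \<B>" "\<B> \<subseteq> (\<lambda>(s, N). germ_basic S s N) ` \<N>" "U \<subseteq> \<Union>\<B>"
      by blast
    obtain \<M> where M: "finite \<M>" "\<M> \<subseteq> \<N>" "\<B> = (\<lambda>(s, N). germ_basic S s N) ` \<M>"
      using finite_subset_image[OF B(1,2)] by blast
    have "(indicator (\<Union>(s, N)\<in>\<M>. germ_basic S s N) :: _ \<Rightarrow> 'k) \<in> pointwise.span (ind ` elts S) \<and>
        constructible TYPE('k) (\<Union>(s, N)\<in>\<M>. N)"
      using M(1,2)
    proof (induction \<M> rule: finite_induct)
      case empty
      show ?case
        by (simp only: image_empty Union_empty constructible_def pointwise.span_zero simp_thms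
            indicator_empty_eq_zero)
    next
      case (insert p \<M>)
      obtain s N where p: "p = (s, N)" by (cases p)
      have sN: "s \<in> elts S" "N \<subseteq> dom s" "constructible TYPE('k) N" "germ_basic S s N \<subseteq> U"
        using insert.prems unfolding p \<N>_def by auto
      define C where "C = (\<Union>(s, N)\<in>\<M>. germ_basic S s N)"
      define M where "M = (\<Union>(s, N)\<in>\<M>. N)"
      have IH: "(indicator C :: _ \<Rightarrow> 'k) \<in> pointwise.span (ind ` elts S)" "constructible TYPE('k) M"
        using insert unfolding C_def M_def by auto
      have "germ S s \<theta> \<in> C \<longleftrightarrow> \<theta> \<in> M" if \<theta>: "\<theta> \<in> N" for \<theta>
      proof
        assume "germ S s \<theta> \<in> C"
        then obtain t K \<phi> where t: "(t, K) \<in> \<M>" "\<phi> \<in> K" "germ S s \<theta> = germ S t \<phi>"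
          unfolding C_def germ_basic_def by blast
        then have "t \<in> elts S" "\<phi> \<in> dom t" using insert.prems unfolding \<N>_def by auto
        then have "\<theta> = \<phi>" using t sN \<theta> germ_eq_iff by blast
        then show "\<theta> \<in> M" using t unfolding M_def by blast
      next
        assume "\<theta> \<in> M"
        then obtain t K where t: "(t, K) \<in> \<M>" "\<theta> \<in> K" unfolding M_def by blast
        then have tK: "t \<in> elts S" "\<theta> \<in> dom t" "germ S t \<theta> \<in> U"
          using insert.prems unfolding \<N>_def germ_basic_def by auto
        moreover have "germ S s \<theta> \<in> U" "\<theta> \<in> dom s" using sN \<theta> unfolding germ_basic_def by auto
        ultimately have "germ S s \<theta> = germ S t \<theta>"
          using inj sN(1) by (auto simp: inj_on_def)
        then show "germ S s \<theta> \<in> C" using t unfolding C_def germ_basic_def by auto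
      qed
      then have "germ_basic S s (N - M) = germ_basic S s N - C"
        unfolding germ_basic_def by auto
      then have "(indicator (germ_basic S s N \<union> C) :: _ \<Rightarrow> 'k) =
          indicator C + indicator (germ_basic S s (N - M))"
        by (auto simp: indicator_def)
      moreover have "(indicator (germ_basic S s (N - M)) :: _ \<Rightarrow> 'k) \<in> pointwise.span (ind ` elts S)"
        using sN IH by (intro indicator_germ_basic_in_span constructible_Diff) auto
      ultimately have "(indicator (germ_basic S s N \<union> C) :: _ \<Rightarrow> 'k) \<in> pointwise.span (ind ` elts S)"
        using IH pointwise.span_add by metis
      moreover have "constructible TYPE('k) (N \<union> M)" using sN IH constructible_Un by blast
      ultimately show ?case unfolding p C_def M_def by simp
    qed
    moreover have "(\<Union>(s, N)\<in>\<M>. germ_basic S s N) = U"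
      using B M unfolding \<N>_def by auto
    ultimately show ?thesis by simp
  qed
  then show "(A :: (_ \<Rightarrow> 'k) set) \<subseteq> pointwise.span (ind ` elts S)"
    unfolding steinberg_algebra_eq_span by (intro pointwise.span_minimal) auto
qed

section \<open>Convolution with the generators\<close>

lemma composable_iff: "(a, b) \<in> composable G \<longleftrightarrow> a \<in> arrows G \<and> b \<in> arrows G \<and> gdom G a = grng G b"
  by (simp add: composable_def)

lemma gmult_arrow:
  assumes "(a, b) \<in> composable G"
  shows "gmult G a b \<in> arrows G" "gdom G (gmult G a b) = gdom G b" "grng G (gmult G a b) = grng G a"
proof -
  have "\<forall>(a, b)\<in>composable G. gmult G a b \<in> arrows G \<and>
        gdom G (gmult G a b) = gdom G b \<and> grng G (gmult G a b) = grng G a"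
    using groupoid unfolding groupoid_def by (elim conjE)
  then show "gmult G a b \<in> arrows G" "gdom G (gmult G a b) = gdom G b" "grng G (gmult G a b) = grng G a"
    using assms by auto
qed

lemma is_ginverse_ginv:
  assumes "a \<in> arrows G"
  shows "is_ginverse G a (ginv G a)"
  using assms is_ginverse_germ by (elim arrowE) simp

lemma gmult_cancel_left:
  assumes "(a, b) \<in> composable G"
  shows "gmult G (ginv G a) (gmult G a b) = b"
proof -
  have a: "a \<in> arrows G" "b \<in> arrows G" "gdom G a = grng G b"
    using assms by (simp_all add: composable_iff)
  then have "(ginv G a, a) \<in> composable G" "gmult G (ginv G a) a = gdom G a"
    using is_ginverse_ginv[OF a(1)] by (simp_all add: composable_iff is_ginverse_def)
  then show ?thesis
    using gmult_assoc[of "ginv G a" a b] assms gmult_units(2)[OF a(2)] a(3) by simp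
qed

lemma gmult_cancel_right:
  assumes "(a, b) \<in> composable G"
  shows "gmult G (gmult G a b) (ginv G b) = a"
proof -
  have a: "a \<in> arrows G" "b \<in> arrows G" "gdom G a = grng G b"
    using assms by (simp_all add: composable_iff)
  then have "(b, ginv G b) \<in> composable G" "gmult G b (ginv G b) = grng G b"
    using is_ginverse_ginv[OF a(2)] by (simp_all add: composable_iff is_ginverse_def)
  then show ?thesis
    using gmult_assoc[of a b "ginv G b"] assms gmult_units(1)[OF a(1)] a(3) by simp
qed

lemma convolution_off: "\<gamma> \<notin> arrows G \<Longrightarrow> convolution G f g \<gamma> = 0"
  unfolding convolution_def using gmult_arrow by (intro sum.neutral) auto

lemma convolution_eq_sum:
  assumes "finite D" "D \<subseteq> {(a, b) \<in> composable G. gmult G a b = \<gamma>}"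
    and "\<And>a b. (a, b) \<in> composable G \<Longrightarrow> gmult G a b = \<gamma> \<Longrightarrow> f a * g b \<noteq> 0 \<Longrightarrow> (a, b) \<in> D"
  shows "convolution G f g \<gamma> = (\<Sum>(a, b)\<in>D. f a * g b :: 'k::field)"
  unfolding convolution_def
proof (rule sum.mono_neutral_left)
  show "\<forall>i\<in>D - {(a, b). (a, b) \<in> composable G \<and> gmult G a b = \<gamma> \<and> f a * g b \<noteq> 0}.
      (case i of (a, b) \<Rightarrow> f a * g b) = 0"
    using assms(2) by fastforce
  show "{(a, b). (a, b) \<in> composable G \<and> gmult G a b = \<gamma> \<and> f a * g b \<noteq> 0} \<subseteq> D"
    using assms(3) by blast
qed (rule assms(1))

lemma convolution_singleton:
  assumes "(a, b) \<in> composable G" "gmult G a b = \<gamma>"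
    and "\<And>a' b'. (a', b') \<in> composable G \<Longrightarrow> gmult G a' b' = \<gamma> \<Longrightarrow> f a' * g b' \<noteq> 0 \<Longrightarrow> a' = a \<and> b' = b"
  shows "convolution G f g \<gamma> = (f a * g b :: 'k::field)"
proof -
  have "convolution G f g \<gamma> = (\<Sum>(a, b)\<in>{(a, b)}. f a * g b)"
  proof (rule convolution_eq_sum)
    show "{(a, b)} \<subseteq> {(a, b) \<in> composable G. gmult G a b = \<gamma>}" using assms(1,2) by blast
    show "(a', b') \<in> {(a, b)}" if "(a', b') \<in> composable G" "gmult G a' b' = \<gamma>" "f a' * g b' \<noteq> 0" for a' b'
      using assms(3)[OF that] by blast
  qed simp
  then show ?thesis by simp
qed

lemma convolution_zero:
  assumes "\<And>a b. (a, b) \<in> composable G \<Longrightarrow> gmult G a b = \<gamma> \<Longrightarrow> f a * g b = 0"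
  shows "convolution G f g \<gamma> = 0"
  unfolding convolution_def using assms by (intro sum.neutral) auto

lemma ind_nonzeroE:
  assumes "ind s a \<noteq> (0 :: 'k::field)"
  obtains \<theta> where "\<theta> \<in> dom s" "a = germ S s \<theta>"
proof -
  have "a \<in> germ_basic S s (dom s)" using assms unfolding ind_def by (metis indicator_simps(2))
  then show ?thesis using that unfolding germ_basic_def by blast
qed

lemma ind_germ_self [simp]: "\<theta> \<in> dom s \<Longrightarrow> ind s (germ S s \<theta>) = 1"
  by (auto simp: ind_def germ_basic_def)

text \<open>A germ of \<open>s\<close> is determined by its range, so at most one factorization of
  \<open>germ S t \<theta>\<close> has a germ of \<open>s\<close> on the left; it exists exactly if
  \<open>\<theta>\<close> lies in the domain of \<open>star S s \<cdot> t\<close>.\<close>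

lemma convolution_ind_left:
  assumes s: "s \<in> elts S" and t: "t \<in> elts S" "\<theta> \<in> dom t"
  shows "convolution G (ind s) f (germ S t \<theta>) =
    (if \<theta> \<in> dom (s\<^sup>\<star> \<cdot> t) then f (germ S (s\<^sup>\<star> \<cdot> t) \<theta>) else (0 :: 'k::field))"
proof -
  have *: "\<theta> \<in> dom (s\<^sup>\<star> \<cdot> t) \<and> a = germ S s (dact S (s\<^sup>\<star> \<cdot> t) \<theta>) \<and> b = germ S (s\<^sup>\<star> \<cdot> t) \<theta>"
    if ab: "(a, b) \<in> composable G" "gmult G a b = germ S t \<theta>" "ind s a * f b \<noteq> 0" for a b
  proof -
    obtain \<psi> where \<psi>: "\<psi> \<in> dom s" "a = germ S s \<psi>"
      using ab(3) by (metis ind_nonzeroE mult_eq_0_iff)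
    have "unit (dact S s \<psi>) = unit (dact S t \<theta>)"
      using gmult_arrow(3)[OF ab(1)] ab(2) \<psi> s t by simp
    then have eq: "dact S s \<psi> = dact S t \<theta>"
      using \<psi> s t dact_character by (simp add: unit_inject)
    then have "dact S t \<theta> \<in> dom s\<^sup>\<star>" using dact_charD[OF s \<psi>(1)] s by simp
    moreover have "b = gmult G (germ S s\<^sup>\<star> (dact S t \<theta>)) (germ S t \<theta>)"
      using gmult_cancel_left[OF ab(1)] ab(2) \<psi> s eq by simp
    moreover have "\<psi> = dact S (s\<^sup>\<star> \<cdot> t) \<theta>"
      using dact_star[OF s \<psi>(1)] s t by (simp add: eq dact_mult)
    ultimately show ?thesis
      using gmult_germ[of "s\<^sup>\<star>" t \<theta>] dact_dom_iff[of "s\<^sup>\<star>" t \<theta>] s t \<psi> by simp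
  qed
  show ?thesis
  proof (cases "\<theta> \<in> dom (s\<^sup>\<star> \<cdot> t)")
    case True
    define \<phi> where "\<phi> = dact S (s\<^sup>\<star> \<cdot> t) \<theta>"
    have "dact S t \<theta> \<in> dom s\<^sup>\<star>" using True dact_dom_iff[of "s\<^sup>\<star>" t \<theta>] s t by simp
    then have \<phi>: "\<phi> \<in> dom s"
      using dact_charD[of "s\<^sup>\<star>" "dact S t \<theta>"] s t by (simp add: \<phi>_def dact_mult)
    \<comment> \<open>An idempotent on which \<open>t\<close> agrees with
      \<open>s \<cdot> star S s \<cdot> t\<close>; it has the value \<open>True\<close> because
      \<open>\<theta>\<close> lies in the domain of \<open>star S s \<cdot> t\<close>.\<close>
    let ?k = "t\<^sup>\<star> \<cdot> (s \<cdot> (s\<^sup>\<star> \<cdot> t))"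
    have "?k \<in> E" "\<theta> ?k" using conj_idem(1)[of t "s \<cdot> s\<^sup>\<star>"] s t True by (simp_all add: charD_iff)
    moreover have "t \<cdot> ?k = s \<cdot> (s\<^sup>\<star> \<cdot> t)"
      using idem_mult_eq[of t "s \<cdot> s\<^sup>\<star>"] s t by simp
    then have "s \<cdot> (s\<^sup>\<star> \<cdot> t) \<cdot> ?k = t \<cdot> ?k"
      using s t idem_mult_left[of "s \<cdot> s\<^sup>\<star>" t] by simp
    ultimately have "germ S t \<theta> = germ S (s \<cdot> (s\<^sup>\<star> \<cdot> t)) \<theta>"
      using s t by (intro germ_eqI(2)[where e = ?k]) simp_all
    then have m: "gmult G (germ S s \<phi>) (germ S (s\<^sup>\<star> \<cdot> t) \<theta>) = germ S t \<theta>"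
      using gmult_germ[of s "s\<^sup>\<star> \<cdot> t" \<theta>] True \<phi> s t unfolding \<phi>_def by simp
    have c: "(germ S s \<phi>, germ S (s\<^sup>\<star> \<cdot> t) \<theta>) \<in> composable G"
      using True \<phi> s t unfolding \<phi>_def by (intro composable_germ) auto
    show ?thesis
      using convolution_singleton[OF c m, of "ind s" f] * True \<phi> unfolding \<phi>_def by simp
  next
    case False
    have "convolution G (ind s) f (germ S t \<theta>) = 0"
      by (rule convolution_zero, rule ccontr) (use * False in blast)
    then show ?thesis using False by simp
  qed
qed

lemma convolution_ind_right:
  assumes s: "s \<in> elts S" and t: "t \<in> elts S" "\<theta> \<in> dom t"
  shows "convolution G f (ind s) (germ S t \<theta>) =
    (if \<theta> \<in> dom s then f (germ S (t \<cdot> s\<^sup>\<star>) (dact S s \<theta>)) else (0 :: 'k::field))"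
proof -
  have d: "dact S s \<theta> \<in> dom s\<^sup>\<star>" "dact S s\<^sup>\<star> (dact S s \<theta>) = \<theta>" if "\<theta> \<in> dom s"
    using that s dact_charD dact_star by simp_all
  have *: "\<theta> \<in> dom s \<and> a = germ S (t \<cdot> s\<^sup>\<star>) (dact S s \<theta>) \<and> b = germ S s \<theta>"
    if ab: "(a, b) \<in> composable G" "gmult G a b = germ S t \<theta>" "f a * ind s b \<noteq> 0" for a b
  proof -
    obtain \<psi> where \<psi>: "\<psi> \<in> dom s" "b = germ S s \<psi>"
      using ab(3) by (metis ind_nonzeroE mult_eq_0_iff)
    have "unit \<psi> = unit \<theta>"
      using gmult_arrow(2)[OF ab(1)] ab(2) \<psi> s t by simp
    then have "\<psi> = \<theta>" using \<psi> t by (simp add: unit_inject)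
    moreover have "a = gmult G (germ S t \<theta>) (germ S s\<^sup>\<star> (dact S s \<psi>))"
      using gmult_cancel_right[OF ab(1)] ab(2) \<psi> s by simp
    ultimately show ?thesis
      using gmult_germ[of t "s\<^sup>\<star>" "dact S s \<theta>"] d s t \<psi> by simp
  qed
  show ?thesis
  proof (cases "\<theta> \<in> dom s")
    case True
    have dom: "dact S s \<theta> \<in> dom (t \<cdot> s\<^sup>\<star>)"
      using dact_dom_iff[of t "s\<^sup>\<star>" "dact S s \<theta>"] d[OF True] s t by simp
    have c: "(germ S (t \<cdot> s\<^sup>\<star>) (dact S s \<theta>), germ S s \<theta>) \<in> composable G"
      using True dom s t by (intro composable_germ) auto
    have "\<theta> (s\<^sup>\<star> \<cdot> s)" using True by (simp add: charD_iff)
    then have "germ S t \<theta> = germ S (t \<cdot> s\<^sup>\<star> \<cdot> s) \<theta>"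
      by (intro germ_eqI(2)[where e = "s\<^sup>\<star> \<cdot> s"]) (use s t in simp_all)
    then have m: "gmult G (germ S (t \<cdot> s\<^sup>\<star>) (dact S s \<theta>)) (germ S s \<theta>) = germ S t \<theta>"
      using gmult_germ[of "t \<cdot> s\<^sup>\<star>" s \<theta>] True dom s t by simp
    show ?thesis
      using convolution_singleton[OF c m, of f "ind s"] * True by simp
  next
    case False
    have "convolution G f (ind s) (germ S t \<theta>) = 0"
      by (rule convolution_zero, rule ccontr) (use * False in blast)
    then show ?thesis using False by simp
  qed
qed

text \<open>After \<open>convolution_ind_left\<close> it remains to see that
  \<open>star S s \<cdot> r\<close> has the germ of \<open>t\<close> exactly if \<open>r\<close> has
  the germ of \<open>s \<cdot> t\<close>. In either direction the agreement idempotent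
  \<open>e\<close> is shrunk by a \<open>k\<close> on which multiplying by
  \<open>s \<cdot> star S s\<close> or \<open>star S s \<cdot> s\<close> changes nothing.\<close>

lemma convolution_ind:
  assumes s: "s \<in> elts S" and t: "t \<in> elts S"
  shows "convolution G (ind s) (ind t) = (ind (s \<cdot> t) :: _ \<Rightarrow> 'k::field)"
proof
  fix \<gamma>
  show "convolution G (ind s) (ind t) \<gamma> = (ind (s \<cdot> t) \<gamma> :: 'k)"
  proof (cases "\<gamma> \<in> arrows G")
    case True
    then obtain r \<theta> where r: "r \<in> elts S" "\<theta> \<in> dom r" "\<gamma> = germ S r \<theta>" by (rule arrowE)
    have \<theta>: "\<theta> \<in> characters S" using r by simp
    have "(\<theta> \<in> dom (s\<^sup>\<star> \<cdot> r) \<and> (\<exists>e\<in>E. \<theta> e \<and> t \<cdot> e = s\<^sup>\<star> \<cdot> r \<cdot> e)) \<longleftrightarrow>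
        (\<exists>e\<in>E. \<theta> e \<and> s \<cdot> t \<cdot> e = r \<cdot> e)"
    proof
      assume "\<theta> \<in> dom (s\<^sup>\<star> \<cdot> r) \<and> (\<exists>e\<in>E. \<theta> e \<and> t \<cdot> e = s\<^sup>\<star> \<cdot> r \<cdot> e)"
      then obtain e where e: "e \<in> E" "\<theta> e" "t \<cdot> e = s\<^sup>\<star> \<cdot> r \<cdot> e" and d: "\<theta> \<in> dom (s\<^sup>\<star> \<cdot> r)"
        by blast
      define k where "k = r\<^sup>\<star> \<cdot> (s \<cdot> (s\<^sup>\<star> \<cdot> r))"
      have k: "k \<in> E" "\<theta> k"
        using conj_idem(1)[of r "s \<cdot> s\<^sup>\<star>"] s r d by (simp_all add: charD_iff k_def)
      have rk: "s \<cdot> (s\<^sup>\<star> \<cdot> (r \<cdot> k)) = r \<cdot> k"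
        using idem_mult_eq[of r "s \<cdot> s\<^sup>\<star>"] s r by (simp add: k_def)
      have "s \<cdot> t \<cdot> (e \<cdot> k) = s \<cdot> (t \<cdot> e) \<cdot> k" using s t e(1) k(1) by simp
      also have "\<dots> = s \<cdot> (s\<^sup>\<star> \<cdot> (r \<cdot> (e \<cdot> k)))" unfolding e(3) using s r e(1) k(1) by simp
      also have "\<dots> = s \<cdot> (s\<^sup>\<star> \<cdot> (r \<cdot> k)) \<cdot> e"
        unfolding idem_commute[OF e(1) k(1)] using s r e(1) k(1) by simp
      also have "\<dots> = r \<cdot> (e \<cdot> k)"
        unfolding rk idem_commute[OF e(1) k(1)] using r e(1) k(1) by simp
      finally show "\<exists>e\<in>E. \<theta> e \<and> s \<cdot> t \<cdot> e = r \<cdot> e"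
        using e(1,2) k \<theta> by (intro bexI[of _ "e \<cdot> k"]) (auto simp: character_mult idem_prod_idem)
    next
      assume "\<exists>e\<in>E. \<theta> e \<and> s \<cdot> t \<cdot> e = r \<cdot> e"
      then obtain e where e: "e \<in> E" "\<theta> e" "r \<cdot> e = s \<cdot> t \<cdot> e" by metis
      have d: "\<theta> \<in> dom (s \<cdot> t)"
        by (rule germ_eqI(1)[of r \<theta> "s \<cdot> t" e]) (use e r s t in simp_all)
      define k where "k = t\<^sup>\<star> \<cdot> (s\<^sup>\<star> \<cdot> (s \<cdot> t))"
      have k: "k \<in> E" "\<theta> k"
        using conj_idem(1)[of t "s\<^sup>\<star> \<cdot> s"] s t d by (simp_all add: charD_iff k_def)
      have tk: "s\<^sup>\<star> \<cdot> (s \<cdot> (t \<cdot> k)) = t \<cdot> k"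
        using idem_mult_eq[of t "s\<^sup>\<star> \<cdot> s"] s t by (simp add: k_def)
      have "s\<^sup>\<star> \<cdot> r \<cdot> (e \<cdot> k) = s\<^sup>\<star> \<cdot> (r \<cdot> e) \<cdot> k" using s r e(1) k(1) by simp
      also have "\<dots> = s\<^sup>\<star> \<cdot> (s \<cdot> (t \<cdot> (e \<cdot> k)))" unfolding e(3) using s t e(1) k(1) by simp
      also have "\<dots> = s\<^sup>\<star> \<cdot> (s \<cdot> (t \<cdot> k)) \<cdot> e"
        unfolding idem_commute[OF e(1) k(1)] using s t e(1) k(1) by simp
      also have "\<dots> = t \<cdot> (e \<cdot> k)"
        unfolding tk idem_commute[OF e(1) k(1)] using t e(1) k(1) by simp
      finally have eq: "t \<cdot> (e \<cdot> k) = s\<^sup>\<star> \<cdot> r \<cdot> (e \<cdot> k)" by (rule sym)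
      have ek: "e \<cdot> k \<in> E" "\<theta> (e \<cdot> k)"
        using e(1,2) k \<theta> by (auto simp: character_mult idem_prod_idem)
      have \<theta>t: "\<theta> \<in> dom t" using d dom_mult_subset[OF s t] by blast
      have "\<theta> \<in> dom (s\<^sup>\<star> \<cdot> r)"
        by (rule germ_eqI(1)[where s = t and e = "e \<cdot> k"]) (use s t r ek eq \<theta>t in simp_all)
      then show "\<theta> \<in> dom (s\<^sup>\<star> \<cdot> r) \<and> (\<exists>e\<in>E. \<theta> e \<and> t \<cdot> e = s\<^sup>\<star> \<cdot> r \<cdot> e)"
        using ek eq by blast
    qed
    note key = this
    have "convolution G (ind s) (ind t) \<gamma> =
        (if \<theta> \<in> dom (s\<^sup>\<star> \<cdot> r) then ind t (germ S (s\<^sup>\<star> \<cdot> r) \<theta>) else (0 :: 'k))"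
      unfolding r(3) by (rule convolution_ind_left[OF s r(1,2)])
    also have "\<dots> = of_bool (\<theta> \<in> dom (s\<^sup>\<star> \<cdot> r) \<and> (\<exists>e\<in>E. \<theta> e \<and> t \<cdot> e = s\<^sup>\<star> \<cdot> r \<cdot> e))"
      using s r(1) t by (simp add: ind_germ del: mult_assoc star_mult)
    also have "\<dots> = ind (s \<cdot> t) \<gamma>"
      unfolding key r(3) by (rule ind_germ[symmetric]) (use r s t in simp_all)
    finally show ?thesis .
  qed (use s t in \<open>simp add: convolution_off ind_off\<close>)
qed

text \<open>The definition of convolution adds up only nonzero terms and an infinite sum counts as
  \<open>0\<close>, so linearity is not automatic. For a generator it follows from the explicit
  formula, whatever the functions \<open>f i\<close> are.\<close>

lemma convolution_ind_linear_left:
  assumes s: "s \<in> elts S"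
  shows "convolution G (ind s) (\<lambda>x. \<Sum>i\<in>I. c i * f i x) =
    (\<lambda>x. \<Sum>i\<in>I. c i * convolution G (ind s) (f i) x :: 'k::field)"
proof
  fix \<gamma> show "convolution G (ind s) (\<lambda>x. \<Sum>i\<in>I. c i * f i x) \<gamma> =
    (\<Sum>i\<in>I. c i * convolution G (ind s) (f i) \<gamma>)"
    by (cases "\<gamma> \<in> arrows G") (auto elim!: arrowE simp: convolution_off convolution_ind_left[OF s])
qed

lemma convolution_ind_linear_right:
  assumes s: "s \<in> elts S"
  shows "convolution G (\<lambda>x. \<Sum>i\<in>I. c i * f i x) (ind s) =
    (\<lambda>x. \<Sum>i\<in>I. c i * convolution G (f i) (ind s) x :: 'k::field)"
proof
  fix \<gamma> show "convolution G (\<lambda>x. \<Sum>i\<in>I. c i * f i x) (ind s) \<gamma> =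
    (\<Sum>i\<in>I. c i * convolution G (f i) (ind s) \<gamma>)"
    by (cases "\<gamma> \<in> arrows G") (auto elim!: arrowE simp: convolution_off convolution_ind_right[OF s])
qed

lemma convolution_ind_sum:
  assumes "s \<in> elts S" "t \<in> elts S" "T \<subseteq> elts S"
  shows "convolution G (ind s) (convolution G (\<lambda>x. \<Sum>r\<in>T. c r * ind r x) (ind t)) =
    (\<lambda>x. \<Sum>r\<in>T. c r * ind (s \<cdot> (r \<cdot> t)) x :: 'k::field)"
proof -
  have "convolution G (ind s) (\<lambda>x. \<Sum>r\<in>T. c r * convolution G (ind r) (ind t) x) =
      (\<lambda>x. \<Sum>r\<in>T. c r * convolution G (ind s) (convolution G (ind r) (ind t)) x)"
    by (rule convolution_ind_linear_left[OF assms(1)])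
  moreover have "convolution G (ind s) (convolution G (ind r) (ind t)) = (ind (s \<cdot> (r \<cdot> t)) :: _ \<Rightarrow> 'k)"
    if "r \<in> T" for r
    using assms that by (simp add: convolution_ind subset_iff)
  ultimately show ?thesis
    using convolution_ind_linear_right[OF assms(2), of c ind T] by simp
qed

text \<open>For a generator there is at most one pair, since the left factor is a germ of
  \<open>s\<close> with prescribed range and it determines the right factor. Finiteness in terms of
  \<open>f\<close> alone gives one index set for all right factors, which makes convolution linear
  in \<open>f\<close>.\<close>

lemma finite_gmult_support:
  assumes "f \<in> A"
  shows "finite {(a, b) \<in> composable G. gmult G a b = \<gamma> \<and> f a \<noteq> (0 :: 'k::field)}" (is "finite (?D f)")
  using assms unfolding steinberg_algebra_eq_span_ind
proof (induction f rule: pointwise.span_induct)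
  show "pointwise.subspace {f :: _ \<Rightarrow> 'k. finite (?D f)}"
  proof (rule pointwise.subspaceI; clarsimp)
    show "finite (?D f) \<Longrightarrow> finite (?D g) \<Longrightarrow>
        finite {(a, b). (a, b) \<in> composable G \<and> gmult G a b = \<gamma> \<and> f a + g a \<noteq> 0}" for f g
      by (rule finite_subset[of _ "?D f \<union> ?D g"]) auto
    show "finite (?D f) \<Longrightarrow> finite {(a, b). (a, b) \<in> composable G \<and> gmult G a b = \<gamma> \<and> c \<noteq> 0 \<and> f a \<noteq> 0}"
      for c :: 'k and f
      by (rule finite_subset[of _ "?D f"]) auto
  qed
  fix f :: "_ \<Rightarrow> 'k" assume "f \<in> ind ` elts S"
  then obtain s where s: "s \<in> elts S" "f = ind s" by blast
  have uniq: "a = a' \<and> b = b'" if *: "(a, b) \<in> ?D f" "(a', b') \<in> ?D f" for a b a' b'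
  proof -
    have ab: "(a, b) \<in> composable G" "gmult G a b = \<gamma>" "f a \<noteq> 0"
      "(a', b') \<in> composable G" "gmult G a' b' = \<gamma>" "f a' \<noteq> 0"
      using * by auto
    then have g: "grng G a = grng G \<gamma>" "grng G a' = grng G \<gamma>" using gmult_arrow(3) by metis+
    obtain \<theta> \<theta>' where \<theta>: "\<theta> \<in> dom s" "\<theta>' \<in> dom s" "a = germ S s \<theta>" "a' = germ S s \<theta>'"
      using ab(3,6) s(2) by (metis ind_nonzeroE)
    then have "unit (dact S s \<theta>) = unit (dact S s \<theta>')"
      using g s by simp
    then have "dact S s \<theta> = dact S s \<theta>'"
      using \<theta> s dact_character unit_inject by blast
    then have "\<theta> = \<theta>'" using dact_star s \<theta> by metis
    then have aa: "a = a'" using \<theta> by simp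
    have "b = gmult G (ginv G a) \<gamma>" "b' = gmult G (ginv G a') \<gamma>"
      using ab gmult_cancel_left by metis+
    then show ?thesis using aa by simp
  qed
  show "finite (?D f)"
  proof (cases "?D f = {}")
    case False
    then obtain a b where "(a, b) \<in> ?D f" by (metis (no_types, lifting) equals0I surj_pair)
    then have "?D f \<subseteq> {(a, b)}" using uniq by blast
    then show ?thesis by (rule finite_subset) simp
  qed (simp only: finite.emptyI)
qed

lemma convolution_add_left:
  assumes "f \<in> A" "f' \<in> A"
  shows "convolution G (f + f') g = convolution G f g + (convolution G f' g :: _ \<Rightarrow> 'k::field)"
proof
  fix \<gamma>
  define D where "D = {(a, b) \<in> composable G. gmult G a b = \<gamma> \<and> f a \<noteq> 0} \<union>
    {(a, b) \<in> composable G. gmult G a b = \<gamma> \<and> f' a \<noteq> 0}"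
  have D: "finite D" "D \<subseteq> {(a, b) \<in> composable G. gmult G a b = \<gamma>}"
    using finite_gmult_support[OF assms(1)] finite_gmult_support[OF assms(2)] by (auto simp: D_def)
  have "convolution G (f + f') g \<gamma> = (\<Sum>(a, b)\<in>D. (f + f') a * g b)"
    "convolution G f g \<gamma> = (\<Sum>(a, b)\<in>D. f a * g b)"
    "convolution G f' g \<gamma> = (\<Sum>(a, b)\<in>D. f' a * g b)"
    by (rule convolution_eq_sum[OF D]; auto simp: D_def)+
  then show "convolution G (f + f') g \<gamma> = (convolution G f g + convolution G f' g) \<gamma>"
    by (simp add: distrib_right sum.distrib case_prod_unfold)
qed

lemma convolution_scale_left:
  assumes "f \<in> A"
  shows "convolution G (\<lambda>x. c * f x) g = (\<lambda>x. c * convolution G f g x :: 'k::field)"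
proof
  fix \<gamma>
  define D where "D = {(a, b) \<in> composable G. gmult G a b = \<gamma> \<and> f a \<noteq> 0}"
  have D: "finite D" "D \<subseteq> {(a, b) \<in> composable G. gmult G a b = \<gamma>}"
    using finite_gmult_support[OF assms] by (auto simp: D_def)
  have "convolution G (\<lambda>x. c * f x) g \<gamma> = (\<Sum>(a, b)\<in>D. c * f a * g b)"
    by (rule convolution_eq_sum[OF D]) (auto simp: D_def)
  also have "\<dots> = c * (\<Sum>(a, b)\<in>D. f a * g b)"
    unfolding sum_distrib_left by (rule sum.cong[OF refl]) (simp only: case_prod_unfold mult.assoc)
  also have "(\<Sum>(a, b)\<in>D. f a * g b) = convolution G f g \<gamma>"
    by (rule convolution_eq_sum[OF D, symmetric]) (auto simp: D_def)
  finally show "convolution G (\<lambda>x. c * f x) g \<gamma> = c * convolution G f g \<gamma>" .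
qed

text \<open>The right factor is expanded first, with only generators on the left; linearity of
  convolution on the algebra then takes care of the left factor.\<close>

lemma convolution_closed:
  assumes "f \<in> A" "g \<in> A"
  shows "convolution G f g \<in> (A :: (_ \<Rightarrow> 'k::field) set)"
proof -
  have sub: "pointwise.subspace (A :: (_ \<Rightarrow> 'k) set)"
    unfolding steinberg_algebra_eq_span_ind by (rule pointwise.subspace_span)
  have ind: "convolution G (ind s) g \<in> A" if s: "s \<in> elts S" for s
  proof -
    obtain T and r :: "_ \<Rightarrow> 'k" where T: "finite T" "T \<subseteq> (ind ` elts S :: (_ \<Rightarrow> 'k) set)" "g = (\<Sum>a\<in>T. (\<lambda>x. r a * a x))"
      using assms(2) unfolding steinberg_algebra_eq_span_ind pointwise.span_explicit by blast
    have "convolution G (ind s) g = (\<Sum>a\<in>T. (\<lambda>x. r a * convolution G (ind s) a x))"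
      unfolding T(3) sum_fun_eq
      by (rule convolution_ind_linear_left[OF s, of r "\<lambda>a. a" T])
    moreover have "convolution G (ind s) a \<in> A" if a: "a \<in> T" for a
    proof -
      obtain t where "t \<in> elts S" "a = ind t" using a T(2) by blast
      then show ?thesis using s by (simp add: convolution_ind ind_in_algebra)
    qed
    ultimately show ?thesis
      by (auto intro!: pointwise.subspace_sum[OF sub] pointwise.subspace_scale[OF sub])
  qed
  have "f \<in> A \<and> convolution G f g \<in> A"
    using assms(1) unfolding steinberg_algebra_eq_span_ind
  proof (induction f rule: pointwise.span_induct)
    show "pointwise.subspace {f :: _ \<Rightarrow> 'k. f \<in> pointwise.span (ind ` elts S) \<and>
        convolution G f g \<in> pointwise.span (ind ` elts S)}"
      unfolding steinberg_algebra_eq_span_ind[symmetric]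
    proof (rule pointwise.subspaceI, unfold mem_Collect_eq)
      have "convolution G 0 g = (0 :: _ \<Rightarrow> 'k)"
        by (intro ext) (simp add: convolution_zero)
      then show "(0 :: _ \<Rightarrow> 'k) \<in> A \<and> convolution G 0 g \<in> A"
        using pointwise.subspace_0[OF sub] by simp
      fix f f' :: "_ \<Rightarrow> 'k"
      assume "f \<in> A \<and> convolution G f g \<in> A" "f' \<in> A \<and> convolution G f' g \<in> A"
      then show "f + f' \<in> A \<and> convolution G (f + f') g \<in> A"
        using pointwise.subspace_add[OF sub] by (simp add: convolution_add_left)
    next
      fix c :: 'k and f assume "f \<in> A \<and> convolution G f g \<in> A"
      then show "(\<lambda>x. c * f x) \<in> A \<and> convolution G (\<lambda>x. c * f x) g \<in> A"
        using pointwise.subspace_scale[OF sub] by (simp add: convolution_scale_left)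
    qed
  next
    show "f \<in> pointwise.span (ind ` elts S) \<and> convolution G f g \<in> pointwise.span (ind ` elts S)"
      if "f \<in> ind ` elts S" for f :: "_ \<Rightarrow> 'k"
      using that ind ind_in_algebra unfolding steinberg_algebra_eq_span_ind[symmetric] by auto
  qed
  then show ?thesis by blast
qed

text \<open>A product \<open>gmult G b c\<close> has the domain of \<open>c\<close>, and by
  invariance this lies in \<open>Y\<close> exactly if the domain of \<open>b\<close> does. A
  function vanishing over \<open>Y\<close> therefore kills every term, on whichever side it
  stands.\<close>

lemma two_sided_ideal_vanishing:
  assumes "\<And>a. a \<in> arrows G \<Longrightarrow> gdom G a \<in> Y \<longleftrightarrow> grng G a \<in> Y"
  shows "two_sided_ideal A (convolution G) {f \<in> A. \<forall>a\<in>arrows G. gdom G a \<in> Y \<longrightarrow> f a = (0 :: 'k::field)}"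
    (is "two_sided_ideal A _ ?I")
proof -
  have sub: "pointwise.subspace (A :: (_ \<Rightarrow> 'k) set)"
    unfolding steinberg_algebra_eq_span_ind by (rule pointwise.subspace_span)
  have "convolution G a f \<in> ?I \<and> convolution G f a \<in> ?I" if "a \<in> A" "f \<in> ?I" for a f :: "_ \<Rightarrow> 'k"
  proof -
    have zero: "f b = 0" if "b \<in> arrows G" "gdom G b \<in> Y" for b
      using \<open>f \<in> ?I\<close> that by blast
    have "convolution G a f \<gamma> = 0" if "gdom G \<gamma> \<in> Y" for \<gamma>
      by (rule convolution_zero) (use that zero gmult_arrow(2) in \<open>force simp: composable_iff\<close>)
    moreover have "convolution G f a \<gamma> = 0" if "gdom G \<gamma> \<in> Y" for \<gamma>
    proof (rule convolution_zero)
      fix b c assume bc: "(b, c) \<in> composable G" "gmult G b c = \<gamma>"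
      then have "gdom G c \<in> Y" using that gmult_arrow(2) by metis
      then have "gdom G b \<in> Y" using assms[of c] bc by (simp add: composable_iff)
      then show "f b * a c = 0" using zero bc by (simp add: composable_iff)
    qed
    ultimately show ?thesis using that convolution_closed by auto
  qed
  moreover have "(\<lambda>_. 0 :: 'k) \<in> A" using pointwise.subspace_0[OF sub] by (simp add: zero_fun_def)
  moreover have "(\<lambda>x. f x + g x) \<in> A" if "f \<in> A" "g \<in> A" for f g :: "_ \<Rightarrow> 'k"
    using pointwise.subspace_add[OF sub that] by (simp add: plus_fun_def)
  moreover have "(\<lambda>x. c * f x) \<in> A" if "f \<in> A" for f and c :: 'k
    using pointwise.subspace_scale[OF sub that] .
  ultimately show ?thesis unfolding two_sided_ideal_def by auto
qed

end

section \<open>The inverse semigroup of a self-similar action\<close>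

text \<open>The restriction \<open>r1 g x = g|\<^sub>x\<close> is asked to depend only on the orbit of \<open>x\<close>; this
  makes \<open>g \<mapsto> g|\<^sub>x\<close> a homomorphism. The element \<open>u g v\<^sup>*\<close> of the inverse semigroup is
  coded by the triple \<open>(u, g, v)\<close>, and the zero by \<open>None\<close>.\<close>

locale self_similar_action =
  fixes a1 :: "'g::ab_group_add \<Rightarrow> 'x \<Rightarrow> 'x" and r1 :: "'g \<Rightarrow> 'x \<Rightarrow> 'g"
    and code :: "('x list \<times> 'g \<times> 'x list) option \<Rightarrow> 's"
  assumes a1_add: "a1 (g + h) x = a1 g (a1 h x)" and a1_zero: "a1 0 x = x"
    and r1_add: "r1 (g + h) x = r1 g x + r1 h x" and r1_a1: "r1 g (a1 h x) = r1 g x"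
    and inj_code: "inj code"
begin

primrec act :: "'g \<Rightarrow> 'x list \<Rightarrow> 'x list" where
  "act g [] = []"
| "act g (x # w) = a1 g x # act (r1 g x) w"

primrec res :: "'g \<Rightarrow> 'x list \<Rightarrow> 'g" where
  "res g [] = g"
| "res g (x # w) = res (r1 g x) w"

lemma r1_zero [simp]: "r1 0 x = 0"
  using r1_add[of 0 0 x] by simp

lemma act_zero [simp]: "act 0 w = w"
  by (induction w) (simp_all add: a1_zero)

lemma res_zero [simp]: "res 0 w = 0"
  by (induction w) simp_all

lemma res_add: "res (g + h) w = res g w + res h w"
  by (induction w arbitrary: g h) (simp_all add: r1_add)

text \<open>The action law needs the restrictions of \<open>g\<close> at the letters of
  \<open>act h w\<close>; \<open>r1_a1\<close> replaces them by restrictions at the letters of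
  \<open>w\<close>.\<close>

lemma act_add: "act (g + h) w = act g (act h w)"
  by (induction w arbitrary: g h) (simp_all add: a1_add r1_add r1_a1)

lemma res_act [simp]: "res g (act h w) = res g w"
  by (induction w arbitrary: g h) (simp_all add: r1_a1)

lemma act_append: "act g (v @ w) = act g v @ act (res g v) w"
  by (induction v arbitrary: g) simp_all

lemma res_append: "res g (v @ w) = res (res g v) w"
  by (induction v arbitrary: g) simp_all

lemma length_act [simp]: "length (act g w) = length w"
  by (induction w arbitrary: g) simp_all

lemma act_inverse [simp]: "act (- g) (act g w) = w" "act g (act (- g) w) = w"
  by (simp_all flip: act_add)

lemma act_eq_iff [simp]: "act g v = act g w \<longleftrightarrow> v = w"
  by (metis act_inverse(1))

lemma res_uminus: "res (- g) w = - res g w"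
  using res_add[of g "- g" w] by (simp add: eq_neg_iff_add_eq_0 add.commute)

lemma prefix_act_iff: "prefix (act (- g) v) w \<longleftrightarrow> prefix v (act g w)"
proof
  assume "prefix (act (- g) v) w"
  then obtain z where "w = act (- g) v @ z" by (auto simp: prefix_def)
  then show "prefix v (act g w)" by (simp add: act_append)
next
  assume "prefix v (act g w)"
  then obtain z where "act g w = v @ z" by (auto simp: prefix_def)
  then have "w = act (- g) (v @ z)" by (metis act_inverse(1))
  then show "prefix (act (- g) v) w" by (simp add: act_append)
qed

text \<open>Reduction of \<open>u g v\<^sup>* u' g' v'\<^sup>*\<close>: prefixes cancel, and the
  remaining word \<open>w\<close> is moved past a group element, to the left of \<open>g\<close> or,
  as \<open>w\<^sup>*\<close>, to the right of \<open>g'\<close>, where it becomes the word that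
  \<open>g'\<close> carries to \<open>w\<close>.\<close>

fun mul :: "('x list \<times> 'g \<times> 'x list) option \<Rightarrow> ('x list \<times> 'g \<times> 'x list) option \<Rightarrow>
    ('x list \<times> 'g \<times> 'x list) option" where
  "mul (Some (u, g, v)) (Some (u', g', v')) =
     (if prefix v u' then let w = drop (length v) u' in Some (u @ act g w, res g w + g', v')
      else if prefix u' v then let w = drop (length u') v in Some (u, g + res g' w, v' @ act (- g') w)
      else None)"
| "mul _ _ = None"

text \<open>The faithful representation by partial injections of words times group elements
  reduces associativity to that of relational composition.\<close>

fun rep :: "('x list \<times> 'g \<times> 'x list) option \<Rightarrow> (('x list \<times> 'g) \<times> ('x list \<times> 'g)) set" where
  "rep None = {}"
| "rep (Some (u, g, v)) = {((v @ w, k), (u @ act g w, res g w + k)) | w k. True}"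

lemma rep_mul: "rep (mul s t) = rep t O rep s"
proof (cases "s = None \<or> t = None")
  case True
  then show ?thesis by (cases s; cases t) auto
next
  case False
  then obtain u g v u' g' v' where st: "s = Some (u, g, v)" "t = Some (u', g', v')"
    by (cases s; cases t) auto
  consider (1) "prefix v u'" | (2) "\<not> prefix v u'" "prefix u' v"
    | (3) "\<not> prefix v u'" "\<not> prefix u' v" by blast
  then show ?thesis
  proof cases
    case 1
    then obtain w where w: "u' = v @ w" by (auto simp: prefix_def)
    have "rep t O rep s = {((v' @ x, k), (u @ act g (w @ act g' x), res g (w @ act g' x) + (res g' x + k))) | x k. True}"
      unfolding st w by (auto simp: relcomp_unfold)
    then show ?thesis
      unfolding st w by (simp add: act_append res_append act_add res_add add.assoc)
  next
    case 2
    then obtain w where w: "v = u' @ w" by (auto simp: prefix_def)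
    \<comment> \<open>The input must begin with the preimage of \<open>w\<close> under
      \<open>g'\<close>, which is where \<open>act (- g') w\<close> in \<open>mul\<close> comes
      from.\<close>
    have x: "act g' x = w @ z \<longleftrightarrow> (\<exists>y. x = act (- g') w @ y \<and> z = act (res g' w) y)" for x z
    proof
      assume "act g' x = w @ z"
      then have "x = act (- g') (w @ z)" by (metis act_inverse(1))
      then show "\<exists>y. x = act (- g') w @ y \<and> z = act (res g' w) y"
        by (auto simp: act_append res_uminus)
    qed (auto simp: act_append)
    have "rep t O rep s = {((v' @ x, k), (u @ act g z, res g z + (res g' x + k))) | x z k. act g' x = w @ z}"
      unfolding st w by (auto simp: relcomp_unfold)
    also have "\<dots> = {((v' @ act (- g') w @ y, k),
        (u @ act g (act (res g' w) y), res g y + (res (res g' w) y + k))) | y k. True}"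
      unfolding x by (auto simp: res_append) 
    finally show ?thesis
      using 2 unfolding st w by (simp add: act_add res_add add.assoc)
  next
    case 3
    then have "v @ y \<noteq> u' @ x" for x y
      by (metis prefixI prefix_same_cases)
    then show ?thesis using 3 unfolding st by (auto simp: relcomp_unfold)
  qed
qed

text \<open>The triple is recovered from the relation: \<open>v\<close> is the least word in its
  domain with respect to prefixes, and the input \<open>(v, 0)\<close> is sent to
  \<open>(u, g)\<close>.\<close>

lemma inj_rep: "inj rep"
proof (rule injI)
  fix s t assume eq: "rep s = rep t"
  have mem: "((v, 0), (u, g)) \<in> rep (Some (u, g, v))" for u g v
    by (auto intro!: exI[of _ "[]"])
  show "s = t"
  proof (cases "s = None \<or> t = None")
    case True
    then show ?thesis using eq mem by (cases s; cases t) fastforce+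
  next
    case False
    then obtain u g v u' g' v' where st: "s = Some (u, g, v)" "t = Some (u', g', v')"
      by (cases s; cases t) auto
    have m: "((v, 0), (u, g)) \<in> rep t" "((v', 0), (u', g')) \<in> rep s"
      using mem eq st by metis+
    then have "prefix v' v" "prefix v v'" unfolding st by auto
    then have v: "v = v'" by (rule prefix_order.antisym[rotated])
    show ?thesis using m unfolding st v by auto
  qed
qed

fun mirror :: "('x list \<times> 'g \<times> 'x list) option \<Rightarrow> ('x list \<times> 'g \<times> 'x list) option" where
  "mirror None = None"
| "mirror (Some (u, g, v)) = Some (v, - g, u)"

lemma rep_mirror: "rep (mirror s) = (rep s)\<inverse>"
proof (cases s)
  case (Some p)
  obtain u g v where p: "p = (u, g, v)" by (cases p)
  have "((u @ w, k), (v @ act (- g) w, res (- g) w + k)) \<in> (rep s)\<inverse>" for w k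
    unfolding Some p by (auto intro!: exI[of _ "act (- g) w"] simp: res_uminus)
  moreover have "((u @ act g w, res g w + k), (v @ w, k)) \<in> rep (mirror s)" for w k
    unfolding Some p by (auto intro!: exI[of _ "act g w"] simp: res_uminus)
  ultimately show ?thesis unfolding Some p by auto
qed simp

lemma single_valued_rep: "((x, y) \<in> rep s) \<Longrightarrow> (x, z) \<in> rep s \<Longrightarrow> y = z"
  by (cases s rule: rep.cases) auto

lemma injective_rep: "((x, z) \<in> rep s) \<Longrightarrow> (y, z) \<in> rep s \<Longrightarrow> x = y"
  using single_valued_rep[of z x "mirror s" y] by (simp add: rep_mirror)

text \<open>The structure is transported along \<open>code\<close>, because the semigroup has to
  live on a prescribed type.\<close>

definition S :: "'s semigroup_zero" where
  "S = \<lparr>elts = range code, smult = \<lambda>a b. code (mul (inv code a) (inv code b)), szero = code None\<rparr>"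

abbreviation prod (infixl \<open>\<odot>\<close> 70) where "a \<odot> b \<equiv> smult S a b"

lemma elts_S: "elts S = range code"
  and code_mult [simp]: "code a \<odot> code b = code (mul a b)"
  and szero_S [simp]: "szero S = code None"
  using inj_code by (simp_all add: S_def)

lemma code_elts [simp]: "code a \<in> elts S"
  by (simp add: elts_S)

lemma code_eq [simp]: "code a = code b \<longleftrightarrow> a = b"
  using inj_code by (rule inj_eq)

lemma mul_assoc: "mul (mul a b) c = mul a (mul b c)"
  by (rule injD[OF inj_rep]) (simp add: rep_mul O_assoc)

lemma mul_mirror: "mul (mul s (mirror s)) s = s"
proof (rule injD[OF inj_rep])
  have "p \<in> rep s" if "p \<in> rep s O (rep s)\<inverse> O rep s" for p
    using that by (auto dest: injective_rep)
  moreover have "p \<in> rep s O (rep s)\<inverse> O rep s" if "p \<in> rep s" for p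
    using that by (cases p) blast
  ultimately show "rep (mul (mul s (mirror s)) s) = rep s"
    unfolding rep_mul rep_mirror by blast
qed

lemma mirror_mirror: "mirror (mirror s) = s"
  by (cases s rule: mirror.cases) simp_all

text \<open>Elements are partial injections, and a generalized inverse of a partial injection
  contains its converse. The roles of \<open>s\<close> and \<open>t\<close> are symmetric, so
  equality follows.\<close>

lemma mirror_unique:
  assumes "mul (mul s t) s = s" "mul (mul t s) t = t"
  shows "t = mirror s"
proof (rule injD[OF inj_rep])
  have *: "(rep s)\<inverse> \<subseteq> rep t" if "mul (mul s t) s = s" for s t
  proof clarify
    fix a b c d assume ab: "((a, b), (c, d)) \<in> rep s"
    then have "((a, b), (c, d)) \<in> rep s O (rep t O rep s)"
      using arg_cong[OF that, of rep] by (simp add: rep_mul)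
    then obtain y z where "((a, b), y) \<in> rep s" "(y, z) \<in> rep t" "(z, (c, d)) \<in> rep s" by blast
    then show "((c, d), (a, b)) \<in> rep t"
      using single_valued_rep[OF ab] injective_rep[OF ab] by metis
  qed
  show "rep t = rep (mirror s)"
    unfolding rep_mirror using *[OF assms(1)] *[OF assms(2)] by auto
qed

sublocale inverse_semigroup S
proof
  have "\<exists>!t. t \<in> elts S \<and> code s \<odot> t \<odot> code s = code s \<and> t \<odot> code s \<odot> t = t" for s
  proof (rule ex1I[of _ "code (mirror s)"])
    have "mul (mul (mirror s) s) (mirror s) = mirror s"
      using mul_mirror[of "mirror s"] unfolding mirror_mirror .
    then show "code (mirror s) \<in> elts S \<and> code s \<odot> code (mirror s) \<odot> code s = code s \<and>
        code (mirror s) \<odot> code s \<odot> code (mirror s) = code (mirror s)"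
      by (simp add: mul_mirror)
    fix t assume t: "t \<in> elts S \<and> code s \<odot> t \<odot> code s = code s \<and> t \<odot> code s \<odot> t = t"
    then obtain b where "t = code b" by (auto simp: elts_S)
    then show "t = code (mirror s)" using t mirror_unique[of s b] by simp
  qed
  then have "\<forall>s\<in>elts S. \<exists>!t. t \<in> elts S \<and> s \<odot> t \<odot> s = s \<and> t \<odot> s \<odot> t = t"
    unfolding elts_S by blast
  moreover have "mul None a = None" "mul a None = None" for a
    by (cases a; auto)+
  ultimately show "inverse_semigroup_zero S"
    unfolding inverse_semigroup_zero_def by (intro conjI) (auto simp: mul_assoc elts_S)
qed

lemma code_None_idem [simp]: "code None \<in> E"
  using zero_idem by simp

section \<open>Characters as finite and infinite words\<close>

definition tri where "tri u g v = code (Some (u, g, v))"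
abbreviation ew where "ew w \<equiv> tri w 0 w"

lemma tri_elts [simp]: "tri u g v \<in> elts S"
  by (simp add: tri_def)

lemma tri_eq [simp]: "tri u g v = tri u' g' v' \<longleftrightarrow> u = u' \<and> g = g' \<and> v = v'"
  by (simp add: tri_def)

lemma tri_nonzero [simp]: "tri u g v \<noteq> code None" "code None \<noteq> tri u g v"
  by (simp_all add: tri_def)

lemma elts_cases:
  assumes "s \<in> elts S"
  obtains "s = code None" | u g v where "s = tri u g v"
proof -
  obtain a where "s = code a" using assms by (auto simp: elts_S)
  then show ?thesis using that by (cases a) (auto simp: tri_def)
qed

lemma tri_mult_left: "tri u g v \<odot> tri (v @ w) h x = tri (u @ act g w) (res g w + h) x"
  by (simp add: tri_def)

lemma tri_mult_right: "tri u g (u' @ w) \<odot> tri u' h v' = tri u (g + res h w) (v' @ act (- h) w)"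
proof (cases "w = []")
  case False
  then have "\<not> prefix (u' @ w) u'" by (simp add: prefix_def)
  then show ?thesis by (simp add: tri_def)
qed (simp add: tri_def)

lemma tri_mult_zero:
  assumes "\<not> prefix v u'" "\<not> prefix u' v"
  shows "tri u g v \<odot> tri u' h v' = code None"
  using assms by (simp add: tri_def)

lemma tri_mult_same [simp]: "tri u g v \<odot> tri v h x = tri u (g + h) x"
  using tri_mult_left[of u g v "[]" h x] by simp

lemma star_tri [simp]: "star S (tri u g v) = tri v (- g) u"
  by (rule star_unique) simp_all

lemma ew_idem [simp]: "ew w \<in> E"
  by (rule idemsI) simp_all

lemma ew_mult: "prefix v w \<Longrightarrow> ew v \<odot> ew w = ew w"
  by (auto simp: prefix_def tri_mult_left)

lemma idems_cases:
  assumes "e \<in> E"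
  obtains "e = code None" | w where "e = ew w"
proof -
  consider "e = code None" | u g v where "e = tri u g v"
    using elts_cases[OF idems_elts[OF assms]] by metis
  then show ?thesis
  proof cases
    case (2 u g v)
    have "e = star S e \<odot> e" using assms by simp
    then have "e = ew v" using 2 by simp
    then show ?thesis by (rule that)
  qed (rule that)
qed

lemma character_code_None [simp]: "\<theta> \<in> characters S \<Longrightarrow> \<not> \<theta> (code None)"
  using character_zero[of \<theta>] by simp

lemma character_prefix:
  assumes "\<theta> \<in> characters S" "\<theta> (ew w)" "prefix v w"
  shows "\<theta> (ew v)"
  using assms character_mult[of \<theta> "ew v" "ew w"] by (simp add: ew_mult)

text \<open>Incomparable words have product zero. Together with closure under prefixes this makes a
  character a finite or infinite word.\<close>

lemma character_chain:
  assumes "\<theta> \<in> characters S" "\<theta> (ew w)" "\<theta> (ew v)"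
  shows "prefix v w \<or> prefix w v"
proof (rule ccontr)
  assume "\<not> (prefix v w \<or> prefix w v)"
  then have "ew v \<odot> ew w = code None" by (intro tri_mult_zero) auto
  then show False using assms character_mult[of \<theta> "ew v" "ew w"] by simp
qed

lemma character_word:
  assumes "\<theta> \<in> characters S" "e \<in> E" "\<theta> e"
  obtains w where "e = ew w"
  using assms(2)
proof (cases rule: idems_cases)
  case 1
  then show ?thesis using assms(1,3) by simp
qed (rule that)

lemma character_Nil [simp]: "\<theta> \<in> characters S \<Longrightarrow> \<theta> (ew [])"
  using character_nonzero[of \<theta>] character_word[of \<theta>] character_prefix[of \<theta> _ "[]"] by (metis Nil_prefix)

lemma character_eqI:
  assumes "\<theta> \<in> characters S" "\<theta>' \<in> characters S" "\<And>w. \<theta> (ew w) = \<theta>' (ew w)"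
  shows "\<theta> = \<theta>'"
proof (rule character_ext[OF assms(1,2)])
  fix e assume "e \<in> E"
  then show "\<theta> e = \<theta>' e" using assms by (cases rule: idems_cases) auto
qed

text \<open>Here \<open>Q\<close> is meant as the set of prefixes of a finite or infinite
  word.\<close>

definition word_character :: "('x list \<Rightarrow> bool) \<Rightarrow> 's \<Rightarrow> bool" where
  "word_character Q = restrict (\<lambda>e. \<exists>w. e = ew w \<and> Q w) E"

lemma word_character_ew [simp]: "word_character Q (ew w) = Q w"
  by (simp add: word_character_def)

lemma word_character_in:
  assumes "Q []" "\<And>v w. Q w \<Longrightarrow> prefix v w \<Longrightarrow> Q v" "\<And>v w. Q v \<Longrightarrow> Q w \<Longrightarrow> prefix v w \<or> prefix w v"
  shows "word_character Q \<in> characters S"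
proof -
  let ?\<theta> = "word_character Q"
  have zero: "\<not> ?\<theta> (code None)"
    by (simp add: word_character_def restrict_def)
  have "?\<theta> (e \<odot> f) \<longleftrightarrow> ?\<theta> e \<and> ?\<theta> f" if e: "e \<in> E" and f: "f \<in> E" for e f
  proof (cases "e = code None \<or> f = code None")
    case True
    then show ?thesis using zero mult_zero idems_elts[OF e] idems_elts[OF f] szero_S by metis
  next
    case False
    then obtain v w where vw: "e = ew v" "f = ew w" using idems_cases e f by metis
    consider "prefix v w" | "prefix w v" | "\<not> prefix v w" "\<not> prefix w v" by blast
    then show ?thesis
    proof cases
      case 1
      then show ?thesis using assms(2)[of w v] by (auto simp: vw ew_mult)
    next
      case 2
      then show ?thesis using assms(2)[of v w] idem_commute[OF e f] by (auto simp: vw ew_mult)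
    next
      case 3
      then show ?thesis using assms(3)[of v w] zero by (auto simp: vw tri_mult_zero)
    qed
  qed
  then show ?thesis
    unfolding characters_def using zero assms(1)
    by (auto simp: word_character_def intro: bexI[of _ "ew []"])
qed

abbreviation principal where "principal w \<equiv> word_character (\<lambda>v. prefix v w)"

lemma principal_character [simp]: "principal w \<in> characters S"
  by (rule word_character_in) (auto intro: prefix_order.trans, meson prefix_same_cases)

lemma dom_tri [simp]: "charD S (star S (tri u g v) \<odot> tri u g v) = charD S (ew v)"
  by simp

lemma dact_tri:
  assumes "\<theta> \<in> charD S (ew v)"
  shows "prefix x u \<Longrightarrow> dact S (tri u g v) \<theta> (ew x)"
    and "dact S (tri u g v) \<theta> (ew (u @ w)) \<longleftrightarrow> \<theta> (ew (v @ act (- g) w))"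
    and "\<not> prefix x u \<Longrightarrow> \<not> prefix u x \<Longrightarrow> \<not> dact S (tri u g v) \<theta> (ew x)"
proof -
  have \<theta>: "\<theta> \<in> characters S" "\<theta> (ew v)" using assms by (auto simp: charD_iff)
  have d: "dact S (tri u g v) \<theta> (ew x) = \<theta> (tri v (- g) u \<odot> (ew x \<odot> tri u g v))" for x
    by (subst dact_apply) simp_all
  show "dact S (tri u g v) \<theta> (ew x)" if "prefix x u"
    using that \<theta> unfolding d by (auto simp: prefix_def tri_mult_left)
  show "dact S (tri u g v) \<theta> (ew (u @ w)) \<longleftrightarrow> \<theta> (ew (v @ act (- g) w))"
    unfolding d by (simp add: tri_mult_right tri_mult_left res_uminus)
  show "\<not> dact S (tri u g v) \<theta> (ew x)" if "\<not> prefix x u" "\<not> prefix u x"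
    using that \<theta> mult_zero(2)[of "tri v (- g) u"] unfolding d by (simp add: tri_mult_zero)
qed

lemma dact_character_tri:
  "\<theta> \<in> charD S (ew v) \<Longrightarrow> dact S (tri u g v) \<theta> \<in> characters S"
  by (rule dact_character) simp_all

lemma dact_principal: "dact S (tri u g v) (principal (v @ w)) = principal (u @ act g w)"
proof (rule character_eqI)
  have d: "principal (v @ w) \<in> charD S (ew v)" by (simp add: charD_iff)
  then show "dact S (tri u g v) (principal (v @ w)) \<in> characters S" by (rule dact_character_tri)
  fix x
  consider "prefix x u" | y where "x = u @ y" | "\<not> prefix x u" "\<not> prefix u x"
    by (auto simp: prefix_def)
  then show "dact S (tri u g v) (principal (v @ w)) (ew x) = principal (u @ act g w) (ew x)"
  proof cases
    case 3
    then show ?thesis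
      using dact_tri(3)[OF d, of x u g] by (auto dest: prefix_same_cases[of x _ u])
  qed (use dact_tri(1,2)[OF d] in \<open>auto simp: prefix_act_iff\<close>)
qed simp

text \<open>The words ruled out by \<open>F\<close> are not prefixes of \<open>w\<close>, so a
  character through \<open>w @ [y]\<close> can meet one of them only if it begins with
  \<open>w @ [y]\<close>. This excludes finitely many letters \<open>y\<close>, and all other
  one-letter extensions of \<open>w\<close> stay in \<open>U\<close>.\<close>

lemma spectrum_word_basis:
  assumes U: "openin (spectrum S) U" and \<theta>: "\<theta> \<in> U" and v: "\<theta> (ew v)"
  obtains w Y where "prefix v w" "\<theta> (ew w)" "finite Y"
    "\<And>y. y \<notin> Y \<Longrightarrow> charD S (ew (w @ [y])) \<subseteq> U"
proof -
  obtain e F where eF: "e \<in> E" "finite F" "F \<subseteq> E" "\<theta> \<in> charDs e F"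
    "charDs e F \<subseteq> U"
    using spectrum_basis[OF U \<theta>] by metis
  have \<theta>c: "\<theta> \<in> characters S" "\<theta> e" using eF(4) by (auto simp: charD_iff)
  obtain w0 where w0: "e = ew w0" using character_word[OF \<theta>c(1) eF(1) \<theta>c(2)] .
  obtain w where w: "prefix v w" "prefix w0 w" "\<theta> (ew w)"
    using character_chain[OF \<theta>c(1), of v w0] v \<theta>c(2) unfolding w0 by blast
  \<comment> \<open>For words \<open>x\<close> not longer than \<open>w\<close> the indexed letter
    is arbitrary, which merely enlarges \<open>Y\<close>.\<close>
  define Y where "Y = (\<lambda>x. x ! length w) ` {x. ew x \<in> F}"
  have "finite {x. ew x \<in> F}"
    using finite_vimageI[OF eF(2), of ew] by (auto simp: inj_def vimage_def)
  then have "finite Y" by (simp add: Y_def)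
  moreover have "charD S (ew (w @ [y])) \<subseteq> U" if y: "y \<notin> Y" for y
  proof
    fix \<eta> assume \<eta>: "\<eta> \<in> charD S (ew (w @ [y]))"
    then have \<eta>c: "\<eta> \<in> characters S" "\<eta> (ew (w @ [y]))" by (auto simp: charD_iff)
    have "\<not> \<eta> f" if f: "f \<in> F" for f
    proof
      assume "\<eta> f"
      then obtain x where x: "f = ew x" using character_word \<eta>c(1) f eF(3) by blast
      have "\<not> \<theta> (ew x)" using eF(4) f x \<theta>c by (auto simp: charD_iff)
      then have "\<not> prefix x w" using character_prefix[OF \<theta>c(1) w(3)] by blast
      moreover have "prefix x (w @ [y]) \<or> prefix (w @ [y]) x"
        using character_chain[OF \<eta>c] \<open>\<eta> f\<close> x by blast
      ultimately have "prefix (w @ [y]) x" by auto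
      then have "x ! length w = y" by (auto simp: prefix_def nth_append)
      then show False using y f x unfolding Y_def by blast
    qed
    moreover have "\<eta> e"
      unfolding w0 by (rule character_prefix[OF \<eta>c]) (rule prefix_prefix[OF w(2)])
    ultimately show "\<eta> \<in> U" using eF(5) \<eta>c by (auto simp: charD_iff)
  qed
  ultimately show ?thesis using that w by blast
qed

text \<open>The germ of \<open>tri (w @ [z]) 0 []\<close> exists over every character and moves it
  into the cylinder of \<open>w @ [z]\<close>; since the alphabet is infinite, every nonempty open
  set contains such a cylinder.\<close>

theorem minimal:
  assumes "infinite (UNIV :: 'x set)"
  shows "minimal_groupoid G"
  unfolding minimal_groupoid_def
proof
  fix x assume "x \<in> units G"
  then obtain \<theta> where \<theta>: "\<theta> \<in> characters S" "x = unit \<theta>" unfolding units_eq by blast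
  have "y \<in> unit_space G closure_of orbit G x" if y: "y \<in> units G" for y
    unfolding in_closure_of topspace_unit_space
  proof (intro conjI y allI impI)
    fix T assume T: "y \<in> T \<and> openin (unit_space G) T"
    obtain \<phi> where \<phi>: "\<phi> \<in> characters S" "y = unit \<phi>" using y unfolding units_eq by blast
    have "openin (spectrum S) {\<phi> \<in> characters S. unit \<phi> \<in> T}"
      using homeomorphic_imp_continuous_map[OF homeomorphic_unit] T by (auto simp: continuous_map_def)
    then obtain w Y where w: "finite Y" "\<And>z. z \<notin> Y \<Longrightarrow> charD S (ew (w @ [z])) \<subseteq> {\<phi> \<in> characters S. unit \<phi> \<in> T}"
      using spectrum_word_basis[of _ \<phi> "[]"] \<phi> T by (metis (mono_tags, lifting) character_Nil mem_Collect_eq)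
    obtain z where z: "z \<notin> Y" using assms w(1) by (meson ex_new_if_finite)
    let ?s = "tri (w @ [z]) 0 []"
    have d: "\<theta> \<in> dom ?s" unfolding dom_tri using \<theta> by (simp add: charD_iff)
    then have "dact S ?s \<theta> \<in> charD S (ew (w @ [z]))"
      using dact_charD[of ?s \<theta>] by simp
    then have "unit (dact S ?s \<theta>) \<in> T" using w(2)[OF z] by blast
    moreover have "unit (dact S ?s \<theta>) \<in> orbit G x"
      unfolding orbit_def using d \<theta>(2) gdom_germ[of ?s \<theta>] grng_germ[of ?s \<theta>] germ_arrow[of ?s \<theta>]
      by (intro image_eqI[of _ _ "germ S ?s \<theta>"]) simp_all
    ultimately show "\<exists>y. y \<in> orbit G x \<and> y \<in> T" by blast
  qed
  then show "unit_space G closure_of orbit G x = units G"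
    using closure_of_subset_topspace[of "unit_space G"] topspace_unit_space by blast
qed

text \<open>Near an interior isotropy germ, \<open>u g v\<^sup>*\<close> fixes every finite word
  that continues some \<open>w = v @ w'\<close> by a letter outside a finite set. Comparing words
  splits this into \<open>u @ act g w' = w\<close> and triviality of \<open>res g w'\<close> on such
  continuations, and faithfulness yields \<open>res g w' = 0\<close>. So the element agrees with an
  idempotent at \<open>ew w\<close>.\<close>

theorem effective:
  assumes inf: "infinite (UNIV :: 'x set)"
    and faithful: "\<And>g Y. g \<noteq> 0 \<Longrightarrow> finite Y \<Longrightarrow> \<exists>y z. y \<notin> Y \<and> act g (y # z) \<noteq> y # z"
  shows "effective_groupoid G"
  unfolding effective_groupoid_def
proof
  let ?I = "{g \<in> arrows G. gdom G g = grng G g}"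
  show "units G \<subseteq> gtop G interior_of ?I"
    by (rule interior_of_maximal[OF _ openin_units]) (auto simp: units_eq)
  show "gtop G interior_of ?I \<subseteq> units G"
  proof
    fix a assume a: "a \<in> gtop G interior_of ?I"
    have I: "b \<in> ?I" if "b \<in> gtop G interior_of ?I" for b
      using subsetD[OF interior_of_subset that] .
    have "a \<in> arrows G" using I[OF a] by blast
    then obtain s \<theta> where s: "s \<in> elts S" "\<theta> \<in> dom s" "a = germ S s \<theta>" by (rule arrowE)
    have \<theta>: "\<theta> \<in> characters S" using s by simp
    obtain u g v where uv: "s = tri u g v"
      using s \<theta> by (cases s rule: elts_cases) (auto simp: charD_iff)
    define U where "U = {\<theta> \<in> dom s. germ S s \<theta> \<in> gtop G interior_of ?I}"
    have U: "openin (spectrum S) U" "\<theta> \<in> U"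
      unfolding U_def using s a by (simp_all add: openin_germ_preimage)
    have fixed: "dact S s \<eta> = \<eta>" if "\<eta> \<in> U" for \<eta>
    proof -
      have \<eta>: "\<eta> \<in> dom s" "germ S s \<eta> \<in> ?I" using that I unfolding U_def by blast+
      then have "unit \<eta> = unit (dact S s \<eta>)" using s(1) by simp
      then show ?thesis using \<eta>(1) s(1) dact_character[OF s(1) \<eta>(1)] by (metis dom_character unit_inject)
    qed
    have "\<theta> (ew v)" using s(2) unfolding uv dom_tri by (simp add: charD_iff)
    then obtain w Y where w: "prefix v w" "\<theta> (ew w)" "finite Y"
      "\<And>y. y \<notin> Y \<Longrightarrow> charD S (ew (w @ [y])) \<subseteq> U"
      using spectrum_word_basis[OF U] by metis
    obtain w' where w': "w = v @ w'" using w(1) by (auto simp: prefix_def)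
    have *: "u @ act g w' = v @ w' \<and> act (res g w') (y # z) = y # z" if "y \<notin> Y" for y z
    proof -
      have p: "principal (v @ (w' @ y # z)) \<in> U"
        using w(4)[OF that] by (auto simp: charD_iff w')
      have eq: "principal (u @ act g (w' @ y # z)) = principal (v @ w' @ y # z)"
        using fixed[OF p] unfolding uv dact_principal .
      have "prefix x (u @ act g (w' @ y # z)) \<longleftrightarrow> prefix x (v @ w' @ y # z)" for x
        using fun_cong[OF eq, of "ew x"] by simp
      then have "u @ act g (w' @ y # z) = v @ w' @ y # z"
        by (meson prefix_order.antisym prefix_order.refl)
      then have "(u @ act g w') @ act (res g w') (y # z) = (v @ w') @ (y # z)"
        by (simp add: act_append)
      then show ?thesis by (subst (asm) append_eq_append_conv) auto
    qed
    obtain y where "y \<notin> Y" using inf w(3) by (meson ex_new_if_finite)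
    then have 1: "u @ act g w' = w" using * w' by blast
    have 2: "res g w' = 0" using faithful[OF _ w(3)] * by blast
    have "s \<odot> ew w = ew w \<odot> ew w"
      using 1 2 by (simp add: uv w' tri_mult_left)
    then have "germ S s \<theta> = germ S (ew w) \<theta>"
      using s w(2) by (intro germ_eqI(2)[where e = "ew w"]) simp_all
    then have "a = unit \<theta>" using s(3) \<theta> w(2) unit_eq[of "ew w" \<theta>] by (simp add: charD_iff)
    then show "a \<in> units G" using \<theta> by (simp add: units_eq)
  qed
qed

end

section \<open>Products of cyclic groups\<close>

text \<open>The group \<open>\<Prod>\<^sub>n \<int>/n\<int>\<close>, with \<open>\<int>/0\<int> = \<int>\<close>; residues are
  represented by the results of \<open>mod\<close>.\<close>

typedef cyclic_product = "{f :: nat \<Rightarrow> int. \<forall>n. f n mod int n = f n}"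
  morphisms coord Abs_cyclic_product
  by (rule exI[of _ "\<lambda>_. 0"]) simp

definition of_coords :: "(nat \<Rightarrow> int) \<Rightarrow> cyclic_product" where
  "of_coords f = Abs_cyclic_product (\<lambda>n. f n mod int n)"

lemma coord_of_coords [simp]: "coord (of_coords f) n = f n mod int n"
  unfolding of_coords_def by (subst Abs_cyclic_product_inverse) auto

lemma coord_mod [simp]: "coord x n mod int n = coord x n"
  using coord[of x] by simp

lemma cyclic_product_eqI: "(\<And>n. coord x n = coord y n) \<Longrightarrow> x = y"
  using coord_inject[of x y] by (simp add: fun_eq_iff)

instantiation cyclic_product :: ab_group_add
begin

definition "0 = of_coords (\<lambda>_. 0)"
definition "x + y = of_coords (\<lambda>n. coord x n + coord y n)"
definition "- x = of_coords (\<lambda>n. - coord x n)"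
definition "x - y = of_coords (\<lambda>n. coord x n - coord y n)"

instance
  by standard (auto intro!: cyclic_product_eqI simp: zero_cyclic_product_def plus_cyclic_product_def
      uminus_cyclic_product_def minus_cyclic_product_def mod_simps algebra_simps)

end

lemma coord_zero [simp]: "coord 0 n = 0"
  and coord_add: "coord (x + y) n = (coord x n + coord y n) mod int n"
  by (simp_all add: zero_cyclic_product_def plus_cyclic_product_def)

lemma coord_range: "n > 0 \<Longrightarrow> coord x n \<in> {0..<int n}"
  using coord_mod[of x n] by (metis atLeastLessThan_iff of_nat_0_less_iff pos_mod_bound pos_mod_sign)

lemma uncountable_cyclic_product: "uncountable (UNIV :: cyclic_product set)"
proof
  assume c: "countable (UNIV :: cyclic_product set)"
  define g where "g = from_nat_into (UNIV :: cyclic_product set)"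
  have g: "range g = UNIV" unfolding g_def using c by (intro range_from_nat_into) auto
  \<comment> \<open>Cantor's diagonal. Entry \<open>m\<close> of the enumeration is contradicted at
    the modulus \<open>m + 2\<close>, which is large enough for \<open>0\<close> and
    \<open>1\<close> to be different residues.\<close>
  define x where "x = of_coords (\<lambda>n. if coord (g (n - 2)) n = 0 then 1 else 0)"
  obtain m where m: "x = g m" using g by (metis UNIV_I imageE)
  have "coord x (m + 2) = (if coord (g m) (m + 2) = 0 then 1 else 0)"
    by (simp add: x_def)
  then show False unfolding m by (simp split: if_splits)
qed

section \<open>Sums over parallel lines\<close>

text \<open>A linear form on the plane \<open>(\<int>/p)\<^sup>2\<close> for each direction; the directions
  \<open>0, \<dots>, p\<close> represent all lines through the origin.\<close>

definition line_form :: "nat \<Rightarrow> nat \<Rightarrow> int \<times> int \<Rightarrow> int" where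
  "line_form p j v = (if j = 0 then snd v else (fst v + int j * snd v) mod int p)"

text \<open>Two different points lie on exactly one line. If their second coordinates agree it is
  the one of direction \<open>0\<close>; otherwise the direction solves a linear congruence whose
  coefficient \<open>dy\<close> is invertible modulo \<open>p\<close>.\<close>

lemma card_lines_through:
  assumes p: "prime p" and v: "v \<in> {0..<int p} \<times> {0..<int p}" and a: "a \<in> {0..<int p} \<times> {0..<int p}"
  shows "card {j \<in> {0..p}. line_form p j v = line_form p j a} = (if v = a then p + 1 else 1)"
proof (cases "v = a")
  case False
  define dx dy where "dx = fst v - fst a" and "dy = snd v - snd a"
  have small: "d = 0" if "int p dvd d" "\<bar>d\<bar> < int p" for d :: int
    using that by (metis zdvd_not_zless abs_dvd_iff dvd_abs_iff zero_less_abs_iff)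
  have bnd: "\<bar>dx\<bar> < int p" "\<bar>dy\<bar> < int p"
    using v a unfolding dx_def dy_def by auto
  have eq_iff: "line_form p j v = line_form p j a \<longleftrightarrow> int p dvd dx + int j * dy" if "j \<noteq> 0" for j
    using that unfolding line_form_def dx_def dy_def
    by (simp add: mod_eq_dvd_iff algebra_simps)
  have "\<exists>!j. j \<in> {0..p} \<and> line_form p j v = line_form p j a"
  proof (cases "dy = 0")
    case True
    show ?thesis
    proof (rule ex1I[of _ 0])
      show "0 \<in> {0..p} \<and> line_form p 0 v = line_form p 0 a"
        using True by (simp add: line_form_def dy_def)
      fix j assume j: "j \<in> {0..p} \<and> line_form p j v = line_form p j a"
      show "j = 0"
      proof (rule ccontr)
        assume "j \<noteq> 0"
        then have "dx = 0" using j eq_iff[of j] True small bnd by simp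
        then show False using True False unfolding dx_def dy_def by (simp add: prod_eq_iff)
      qed
    qed
  next
    case dy: False
    then have "\<not> int p dvd dy" using small bnd by blast
    then have cop: "coprime dy (int p)"
      using p by (metis coprime_commute prime_imp_coprime prime_nat_int_transfer)
    obtain i where i: "[dy * i = - dx] (mod int p)"
      using cong_solve_coprime_int[OF cop] by (metis cong_scalar_right mult.assoc mult.commute mult_1)
    \<comment> \<open>The representative of \<open>i\<close> modulo \<open>p\<close> is taken in
      \<open>{1..p}\<close>, because the value \<open>0\<close> is reserved for the form
      \<open>snd\<close>.\<close>
    define j where "j = nat ((i - 1) mod int p) + 1"
    have p0: "int p > 0" using p prime_gt_0_nat by simp
    have "nat ((i - 1) mod int p) < p" using p0 by (simp add: nat_less_iff)
    then have j: "j \<in> {1..p}" unfolding j_def by simp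
    have "[int j = i] (mod int p)"
      unfolding j_def using p0 by (simp add: cong_def mod_simps)
    then have "[dx + int j * dy = dx + i * dy] (mod int p)"
      by (intro cong_add cong_mult cong_refl)
    also have "[dx + i * dy = dx + (- dx)] (mod int p)"
      using i by (intro cong_add cong_refl) (simp add: mult.commute)
    finally have "int p dvd dx + int j * dy" by (simp add: cong_0_iff)
    then have jl: "line_form p j v = line_form p j a" using eq_iff j by simp
    show ?thesis
    proof (rule ex1I[of _ j])
      show "j \<in> {0..p} \<and> line_form p j v = line_form p j a" using j jl by simp
      fix k assume k: "k \<in> {0..p} \<and> line_form p k v = line_form p k a"
      have "k \<noteq> 0"
      proof
        assume "k = 0"
        then show False using k dy by (simp add: line_form_def dy_def)
      qed
      then have "int p dvd (dx + int k * dy) - (dx + int j * dy)"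
        using k eq_iff \<open>int p dvd dx + int j * dy\<close> by (intro dvd_diff) auto
      then have "int p dvd (int k - int j) * dy" by (simp add: algebra_simps)
      then have "int p dvd int k - int j"
        using cop by (simp add: coprime_commute coprime_dvd_mult_left_iff)
      moreover have "\<bar>int k - int j\<bar> < int p" using k j \<open>k \<noteq> 0\<close> by auto
      ultimately show "k = j" using small by fastforce
    qed
  qed
  then obtain j where "{j \<in> {0..p}. line_form p j v = line_form p j a} = {j}" by blast
  then show ?thesis using False by simp
qed simp

text \<open>The lines through a point \<open>a\<close> cover \<open>a\<close> exactly \<open>p + 1\<close> times and every other
  point once, so the sum of \<open>f\<close> over all of them is \<open>p f(a)\<close> plus the total sum of \<open>f\<close>.\<close>

lemma line_sums_determine:
  fixes f :: "'d \<Rightarrow> 'k::field" and q :: "'d \<Rightarrow> int \<times> int"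
  assumes p: "prime p" "of_nat p \<noteq> (0 :: 'k)" and D: "finite D" "q ` D \<subseteq> {0..<int p} \<times> {0..<int p}"
    and zero: "\<And>j c. (\<Sum>h\<in>{h \<in> D. line_form p j (q h) = c}. f h) = 0"
  shows "(\<Sum>h\<in>{h \<in> D. q h = a}. f h) = 0"
proof (cases "a \<in> {0..<int p} \<times> {0..<int p}")
  case True
  have total: "(\<Sum>h\<in>D. f h) = 0"
  proof -
    have "(\<Sum>h\<in>D. f h) = (\<Sum>c\<in>(\<lambda>h. line_form p 0 (q h)) ` D. \<Sum>h\<in>{h \<in> D. line_form p 0 (q h) = c}. f h)"
      using D(1) by (rule sum.image_gen)
    then show ?thesis by (simp add: zero)
  qed
  have "0 = (\<Sum>j\<in>{0..p}. \<Sum>h\<in>{h \<in> D. line_form p j (q h) = line_form p j a}. f h)"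
    by (simp add: zero)
  also have "\<dots> = (\<Sum>j\<in>{0..p}. \<Sum>h\<in>D. if line_form p j (q h) = line_form p j a then f h else 0)"
    using D(1) by (simp add: sum.inter_filter)
  also have "\<dots> = (\<Sum>h\<in>D. \<Sum>j\<in>{0..p}. if line_form p j (q h) = line_form p j a then f h else 0)"
    by (rule sum.swap)
  also have "\<dots> = (\<Sum>h\<in>D. of_nat (card {j \<in> {0..p}. line_form p j (q h) = line_form p j a}) * f h)"
    by (simp flip: sum.inter_filter)
  also have "\<dots> = (\<Sum>h\<in>D. f h + (if q h = a then of_nat p * f h else 0))"
  proof (rule sum.cong[OF refl])
    fix h assume "h \<in> D"
    then have "q h \<in> {0..<int p} \<times> {0..<int p}" using D(2) by blast
    then show "of_nat (card {j \<in> {0..p}. line_form p j (q h) = line_form p j a}) * f h =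
        f h + (if q h = a then of_nat p * f h else 0)"
      using card_lines_through[OF p(1) _ True, of "q h"] by (simp add: algebra_simps)
  qed
  also have "\<dots> = of_nat p * (\<Sum>h\<in>{h \<in> D. q h = a}. f h)"
    using D(1) by (simp add: sum.distrib total sum_distrib_left flip: sum.inter_filter)
  finally show ?thesis using p(2) by simp
next
  case False
  then have "{h \<in> D. q h = a} = {}" using D(2) by blast
  then show ?thesis by (simp only: sum.empty)
qed

text \<open>The coordinates in \<open>F\<close> are treated one at a time: \<open>one\<close> trades
  the weaker information \<open>r i j (q i h)\<close>, for all \<open>j\<close>, for
  \<open>q i h\<close> itself. It is required for every finite \<open>D'\<close> because the
  conditions on the other coordinates cut down the index set.\<close>

lemma fibre_sums_determine:
  fixes f :: "'d \<Rightarrow> 'k::field" and q :: "'i \<Rightarrow> 'd \<Rightarrow> 'v" and r :: "'i \<Rightarrow> 'l \<Rightarrow> 'v \<Rightarrow> 'w"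
  assumes "finite F" "finite D"
    and one: "\<And>i D' a. i \<in> F \<Longrightarrow> finite D' \<Longrightarrow>
      (\<And>j c. (\<Sum>h\<in>{h \<in> D'. r i j (q i h) = c}. f h) = 0) \<Longrightarrow> (\<Sum>h\<in>{h \<in> D'. q i h = a}. f h) = 0"
    and zero: "\<And>l c. (\<Sum>h\<in>{h \<in> D. \<forall>i\<in>F. r i (l i) (q i h) = c i}. f h) = 0"
  shows "(\<Sum>h\<in>{h \<in> D. \<forall>i\<in>F. q i h = a i}. f h) = 0"
  using assms
proof (induction F arbitrary: D rule: finite_induct)
  case empty
  then show ?case by simp
next
  case (insert i F)
  have "(\<Sum>h\<in>{h \<in> {h \<in> D. q i h = a i}. \<forall>i\<in>F. r i (l i) (q i h) = c i}. f h) = 0" for l c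
  proof -
    let ?D = "{h \<in> D. \<forall>i\<in>F. r i (l i) (q i h) = c i}"
    have "(\<Sum>h\<in>{h \<in> ?D. r i j (q i h) = c'}. f h) = 0" for j c'
    proof -
      have "{h \<in> ?D. r i j (q i h) = c'} =
          {h \<in> D. \<forall>m\<in>insert i F. r m ((l(i := j)) m) (q m h) = (c(i := c')) m}"
        using insert.hyps(2) by auto
      then show ?thesis using insert.prems(3)[of "l(i := j)" "c(i := c')"] by simp
    qed
    then have "(\<Sum>h\<in>{h \<in> ?D. q i h = a i}. f h) = 0"
      using insert.prems(1) by (intro insert.prems(2)) auto
    moreover have "{h \<in> ?D. q i h = a i} = {h \<in> {h \<in> D. q i h = a i}. \<forall>i\<in>F. r i (l i) (q i h) = c i}"
      by blast
    ultimately show ?thesis by simp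
  qed
  then have "(\<Sum>h\<in>{h \<in> {h \<in> D. q i h = a i}. \<forall>i\<in>F. q i h = a i}. f h) = 0"
    using insert.prems(1,2) by (intro insert.IH) auto
  moreover have "{h \<in> {h \<in> D. q i h = a i}. \<forall>i\<in>F. q i h = a i} = {h \<in> D. \<forall>i\<in>insert i F. q i h = a i}"
    by blast
  ultimately show ?case by simp
qed

text \<open>A homomorphism that kills one line in each \<open>(\<int>/p)\<^sup>2\<close> with \<open>p \<in> P\<close> and nothing else.\<close>

definition psi :: "nat set \<Rightarrow> (nat \<Rightarrow> nat) \<Rightarrow> cyclic_product \<times> cyclic_product \<Rightarrow> cyclic_product \<times> cyclic_product" where
  "psi P l h = (of_coords (\<lambda>n. if n \<in> P then line_form n (l n) (coord (fst h) n, coord (snd h) n) else coord (fst h) n),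
     of_coords (\<lambda>n. if n \<in> P then 0 else coord (snd h) n))"

lemma line_form_mod: "line_form n j (coord x n, coord y n) mod int n = line_form n j (coord x n, coord y n)"
  by (simp add: line_form_def)

lemma line_form_add:
  "line_form n j ((x + x') mod int n, (y + y') mod int n) mod int n =
     (line_form n j (x, y) + line_form n j (x', y')) mod int n"
proof (cases "j = 0")
  case False
  have "((x + x') mod int n + int j * ((y + y') mod int n)) mod int n = (x + x' + int j * (y + y')) mod int n"
    by (intro mod_add_cong) (simp_all add: mod_mult_right_eq)
  also have "x + x' + int j * (y + y') = (x + int j * y) + (x' + int j * y')"
    by (simp add: algebra_simps)
  also have "\<dots> mod int n = ((x + int j * y) mod int n + (x' + int j * y') mod int n) mod int n"
    by (rule mod_add_eq[symmetric])
  finally show ?thesis using False by (simp add: line_form_def)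
qed (simp add: line_form_def)

lemma psi_add: "psi P l (h + h') = psi P l h + psi P l h'"
  unfolding psi_def
  by (auto intro!: cyclic_product_eqI simp: coord_add line_form_add mod_simps)

lemma psi_faithful:
  assumes "h \<noteq> 0"
  shows "\<exists>l. psi P l h \<noteq> 0"
proof -
  obtain n where n: "coord (fst h) n \<noteq> 0 \<or> coord (snd h) n \<noteq> 0"
    using assms by (metis coord_zero cyclic_product_eqI prod_eq_iff zero_prod_def fst_conv snd_conv)
  \<comment> \<open>Form \<open>0\<close> reads the second coordinate; if that vanishes, form
    \<open>1\<close> reads the first.\<close>
  define l :: "nat \<Rightarrow> nat" where "l = (\<lambda>_. if coord (snd h) n = 0 then 1 else 0)"
  have "coord (fst (psi P l h)) n \<noteq> 0 \<or> coord (snd (psi P l h)) n \<noteq> 0"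
    using n by (auto simp: psi_def line_form_def l_def)
  then show ?thesis by (metis coord_zero fst_zero snd_zero)
qed

text \<open>Finitely many moduli separate \<open>h0\<close> from the other elements of
  \<open>D\<close>. If all fibre sums vanished, the line argument at these moduli would make the sum
  over the elements agreeing with \<open>h0\<close> there vanish, but that sum is
  \<open>f h0\<close>.\<close>

lemma psi_fibre_sums_nonzero:
  fixes f :: "cyclic_product \<times> cyclic_product \<Rightarrow> 'k::field"
  assumes P: "\<And>p. p \<in> P \<Longrightarrow> prime p \<and> of_nat p \<noteq> (0 :: 'k)"
    and D: "finite D" "h0 \<in> D" "f h0 \<noteq> 0"
  shows "\<exists>l k. (\<Sum>h\<in>{h \<in> D. psi P l h = k}. f h) \<noteq> 0"
proof (rule ccontr)
  assume "\<not> ?thesis"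
  then have zero: "(\<Sum>h\<in>{h \<in> D. psi P l h = k}. f h) = 0" for l k by blast
  define q where "q = (\<lambda>n (h :: cyclic_product \<times> cyclic_product). (coord (fst h) n, coord (snd h) n))"
  \<comment> \<open>What \<open>psi P l\<close> retains of the two coordinates at the modulus
    \<open>n\<close>, for \<open>j = l n\<close>.\<close>
  define r where "r = (\<lambda>n j v. if n \<in> P then (line_form n j v, 0) else v)"
  have "\<exists>n. q n h \<noteq> q n h0" if "h \<noteq> h0" for h
    using that unfolding q_def by (metis cyclic_product_eqI prod.inject prod_eqI)
  then obtain N where N: "\<And>h. h \<noteq> h0 \<Longrightarrow> q (N h) h \<noteq> q (N h) h0" by metis
  have q_psi: "q n (psi P l h) = r n (l n) (q n h)" for n l h
    by (simp add: q_def r_def psi_def line_form_mod)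
  have "(\<Sum>h\<in>{h \<in> D. \<forall>n\<in>N ` D. q n h = q n h0}. f h) = 0"
  proof (rule fibre_sums_determine[where F = "N ` D" and D = D and r = r and q = q
        and a = "\<lambda>n. q n h0" and f = f])
    fix i D' a
    assume i: "finite D'" and z: "\<And>j c. (\<Sum>h\<in>{h \<in> D'. r i j (q i h) = c}. f h) = 0"
    show "(\<Sum>h\<in>{h \<in> D'. q i h = a}. f h) = 0"
    proof (cases "i \<in> P")
      case True
      have p: "prime i" "of_nat i \<noteq> (0::'k)" using P[OF True] by auto
      show ?thesis
      proof (rule line_sums_determine[OF p i])
        show "q i ` D' \<subseteq> {0..<int i} \<times> {0..<int i}"
          using coord_range[OF prime_gt_0_nat[OF p(1)]] by (auto simp: q_def)
        show "(\<Sum>h\<in>{h \<in> D'. line_form i j (q i h) = c}. f h) = 0" for j c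
          using z[of j "(c, 0)"] True by (simp add: r_def)
      qed
    next
      case False
      then show ?thesis using z[of _ a] by (simp add: r_def)
    qed
  next
    fix l c
    let ?D = "{h \<in> D. \<forall>n\<in>N ` D. r n (l n) (q n h) = c n}"
    have "(\<Sum>h\<in>?D. f h) = (\<Sum>k\<in>psi P l ` ?D. \<Sum>h\<in>{h \<in> ?D. psi P l h = k}. f h)"
      using D(1) by (intro sum.image_gen) simp
    also have "\<dots> = 0"
    proof (rule sum.neutral, rule ballI)
      \<comment> \<open>The conditions defining \<open>?D\<close> depend on \<open>psi P l h\<close>
        only, so a fibre in \<open>D\<close> that meets \<open>?D\<close> is contained in
        it.\<close>
      fix k assume "k \<in> psi P l ` ?D"
      then have "{h \<in> ?D. psi P l h = k} = {h \<in> D. psi P l h = k}"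
        by (auto simp flip: q_psi)
      then show "(\<Sum>h\<in>{h \<in> ?D. psi P l h = k}. f h) = 0" by (simp add: zero)
    qed
    finally show "(\<Sum>h\<in>?D. f h) = 0" .
  qed (use D in auto)
  moreover have "{h \<in> D. \<forall>n\<in>N ` D. q n h = q n h0} = {h0}"
    using N D(2) by auto
  ultimately show False using D(3) by simp
qed

text \<open>Parametrized by one of its coordinates, a line has \<open>p\<close> points; for a value
  \<open>c\<close> out of range the set is empty. Divisibility covers both cases.\<close>

lemma card_line:
  assumes "p > 0"
  shows "p dvd card {v \<in> {0..<int p} \<times> {0..<int p}. line_form p j v = c}"
proof (cases "c \<in> {0..<int p}")
  case True
  let ?g = "\<lambda>t. if j = 0 then (t, c) else ((c - int j * t) mod int p, t)"
  have "bij_betw ?g {0..<int p} {v \<in> {0..<int p} \<times> {0..<int p}. line_form p j v = c}"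
    unfolding bij_betw_def
  proof
    show "inj_on ?g {0..<int p}" by (auto simp: inj_on_def)
    show "?g ` {0..<int p} = {v \<in> {0..<int p} \<times> {0..<int p}. line_form p j v = c}" (is "?L = ?R")
    proof
      show "?L \<subseteq> ?R" using True assms by (auto simp: line_form_def mod_simps)
      show "?R \<subseteq> ?L"
      proof
        fix v assume v: "v \<in> ?R"
        show "v \<in> ?L"
        proof (cases "j = 0")
          case False
          then have "c = (fst v + int j * snd v) mod int p" using v by (auto simp: line_form_def)
          then have "(c - int j * snd v) mod int p = fst v" using v by (auto simp: mod_simps)
          then show ?thesis using v False by (auto intro!: image_eqI[of _ _ "snd v"])
        qed (use v in \<open>auto simp: line_form_def intro!: image_eqI[of _ _ "fst v"]\<close>)
      qed
    qed
  qed
  then show ?thesis using bij_betw_same_card by fastforce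
next
  case False
  then have "{v \<in> {0..<int p} \<times> {0..<int p}. line_form p j v = c} = {}"
    using assms by (auto simp: line_form_def)
  then show ?thesis by (simp only: card.empty dvd_0_right)
qed

text \<open>The witness is the copy of the plane at the modulus \<open>p\<close> inside the product.
  There \<open>psi P l\<close> reduces to a single linear form, so its fibres are empty or
  lines.\<close>

lemma psi_fibre_sums_zero:
  assumes p: "prime p" "p \<in> P" "of_nat p = (0 :: 'k::field)"
  shows "\<exists>D. finite D \<and> D \<noteq> {} \<and> (\<forall>l k. of_nat (card {h \<in> D. psi P l h = k}) = (0 :: 'k))"
proof -
  have p0: "p > 0" using p(1) prime_gt_0_nat by blast
  define pt where "pt x = of_coords (\<lambda>n. if n = p then x else 0)" for x
  have pt: "coord (pt x) n = (if n = p then x else 0)" if "x \<in> {0..<int p}" for x n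
    using that by (simp add: pt_def)
  define \<iota> where "\<iota> v = (pt (fst v), pt (snd v))" for v
  let ?V = "{0..<int p} \<times> {0..<int p}"
  have inj: "inj_on \<iota> ?V"
  proof (rule inj_onI)
    fix v w assume vw: "v \<in> ?V" "w \<in> ?V" "\<iota> v = \<iota> w"
    then have "coord (pt (fst v)) p = coord (pt (fst w)) p" "coord (pt (snd v)) p = coord (pt (snd w)) p"
      by (simp_all add: \<iota>_def)
    then show "v = w" using vw(1,2) by (auto simp: pt prod_eq_iff)
  qed
  have dvd_zero: "of_nat m = (0 :: 'k)" if "p dvd m" for m
    using that p(3) by (auto elim!: dvdE)
  have dvd: "p dvd card {h \<in> \<iota> ` ?V. psi P l h = k}" for l k
  proof -
    have psi: "psi P l (\<iota> v) = (pt (line_form p (l p) v), 0)" if v: "v \<in> ?V" for v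
    proof -
      have "line_form p (l p) v \<in> {0..<int p}" using v p0 by (auto simp: line_form_def)
      then show ?thesis
        unfolding psi_def \<iota>_def using v p(2)
        by (auto intro!: cyclic_product_eqI simp: pt mem_Times_iff line_form_def)
    qed
    show ?thesis
    proof (cases "\<exists>v\<in>?V. psi P l (\<iota> v) = k")
      case False
      then have "{h \<in> \<iota> ` ?V. psi P l h = k} = {}" by blast
      then show ?thesis by (simp only: card.empty dvd_0_right)
    next
      case True
      then obtain v0 where v0: "v0 \<in> ?V" "psi P l (\<iota> v0) = k" by blast
      have "psi P l (\<iota> v) = k \<longleftrightarrow> line_form p (l p) v = line_form p (l p) v0" if v: "v \<in> ?V" for v
      proof -
        have "line_form p (l p) v \<in> {0..<int p}" "line_form p (l p) v0 \<in> {0..<int p}"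
          using v v0 p0 by (auto simp: line_form_def)
        then have "pt (line_form p (l p) v) = pt (line_form p (l p) v0) \<longleftrightarrow>
            line_form p (l p) v = line_form p (l p) v0"
          using pt[of _ p] by metis
        then show ?thesis using psi[OF v] psi[OF v0(1)] v0(2) by simp
      qed
      then have "{h \<in> \<iota> ` ?V. psi P l h = k} = \<iota> ` {v \<in> ?V. line_form p (l p) v = line_form p (l p) v0}"
        by blast
      moreover have "card \<dots> = card {v \<in> ?V. line_form p (l p) v = line_form p (l p) v0}"
        by (intro card_image inj_on_subset[OF inj]) blast
      ultimately show ?thesis using card_line[OF p0] by simp
    qed
  qed
  have "of_nat (card {h \<in> \<iota> ` ?V. psi P l h = k}) = (0 :: 'k)" for l k
    by (rule dvd_zero[OF dvd])
  moreover have "\<iota> ` ?V \<noteq> {}" using p0 by simp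
  ultimately show ?thesis by (intro exI[of _ "\<iota> ` ?V"]) simp
qed

section \<open>Normal forms of algebra elements, identity and orbits\<close>

context inverse_semigroup
begin

lemma ind_zero: "ind \<zero> x = (0 :: 'k::field)"
proof -
  have "\<theta> \<notin> charD S \<zero>" for \<theta> using character_zero[of \<theta>] by (auto simp: charD_iff)
  then have "charD S \<zero> = {}" by blast
  then show ?thesis by (simp add: ind_def germ_basic_def)
qed

text \<open>Zero coefficients and the zero element are removed, so that every term left over really
  contributes a triple with nonzero coefficient.\<close>

lemma steinberg_algebraE:
  assumes "f \<in> (A :: (_ \<Rightarrow> 'k::field) set)"
  obtains T c where "finite T" "T \<subseteq> elts S - {\<zero>}" "\<And>r. r \<in> T \<Longrightarrow> c r \<noteq> 0"
    "f = (\<lambda>x. \<Sum>r\<in>T. c r * ind r x)"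
proof -
  obtain t and d :: "_ \<Rightarrow> 'k" where t: "finite t" "t \<subseteq> (ind ` elts S :: (_ \<Rightarrow> 'k) set)"
    "f = (\<Sum>a\<in>t. (\<lambda>x. d a * a x))"
    using assms unfolding steinberg_algebra_eq_span_ind pointwise.span_explicit by blast
  obtain U where U: "U \<subseteq> elts S" "inj_on (ind :: _ \<Rightarrow> _ \<Rightarrow> 'k) U" "t = ind ` U"
    using t(2) unfolding subset_image_inj by blast
  have fin: "finite U" using t(1) U(2,3) finite_image_iff by blast
  define T where "T = {r \<in> U. r \<noteq> \<zero> \<and> d (ind r) \<noteq> 0}"
  have "f = (\<lambda>x. \<Sum>r\<in>U. d (ind r) * ind r x)"
    unfolding t(3) sum_fun_eq U(3) using U(2) by (simp add: sum.reindex)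
  also have "\<dots> = (\<lambda>x. \<Sum>r\<in>T. d (ind r) * ind r x)"
    unfolding T_def using fin by (intro ext sum.mono_neutral_right) (auto simp: ind_zero)
  finally show ?thesis
    using fin U(1) by (intro that[of T "\<lambda>r. d (ind r)"]) (auto simp: T_def)
qed

lemma steinberg_algebra_sum:
  assumes "T \<subseteq> elts S"
  shows "(\<lambda>x. \<Sum>r\<in>T. c r * ind r x :: 'k::field) \<in> A"
proof -
  have "(\<Sum>r\<in>T. (\<lambda>x. c r * ind r x)) \<in> pointwise.span (ind ` elts S :: (_ \<Rightarrow> 'k) set)"
    using assms by (intro pointwise.span_sum pointwise.span_scale[OF pointwise.span_base]) auto
  then show ?thesis by (simp add: steinberg_algebra_eq_span_ind sum_fun_eq)
qed

text \<open>Since \<open>e\<close> is a right identity, every character has the value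
  \<open>True\<close> at \<open>e\<close>, and the formula for a generator on the right returns
  \<open>f\<close> unchanged.\<close>

lemma convolution_ind_identity:
  assumes one: "e \<in> E" "\<And>s. s \<in> elts S \<Longrightarrow> s \<cdot> e = s" and f: "f \<in> A"
  shows "convolution G f (ind e) = (f :: _ \<Rightarrow> 'k::field)"
proof
  fix \<gamma>
  show "convolution G f (ind e) \<gamma> = f \<gamma>"
  proof (cases "\<gamma> \<in> arrows G")
    case True
    then obtain t \<theta> where t: "t \<in> elts S" "\<theta> \<in> dom t" "\<gamma> = germ S t \<theta>" by (rule arrowE)
    obtain e' where e': "e' \<in> E" "\<theta> e'" using character_nonzero[of \<theta>] t(2) by auto
    then have "\<theta> e" using one character_mult[of \<theta> e' e] t(2) by simp
    then have "\<theta> \<in> charD S e" using t(2) by (auto simp: charD_iff)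
    then show ?thesis
      using one t convolution_ind_right[of e t \<theta> f] dact_idem[of e \<theta>] by simp
  next
    case False
    obtain T c where "T \<subseteq> elts S - {\<zero>}" "f = (\<lambda>x. \<Sum>r\<in>T. c r * ind r x)"
      using f by (elim steinberg_algebraE)
    then have "f \<gamma> = 0" using False by (auto intro!: sum.neutral simp: ind_off dest: subsetD)
    then show ?thesis using False by (simp add: convolution_off)
  qed
qed

lemma orbit_unit:
  assumes "\<theta> \<in> characters S"
  shows "orbit G (unit \<theta>) = {unit (dact S s \<theta>) | s. s \<in> elts S \<and> \<theta> \<in> dom s}"
proof (intro set_eqI iffI)
  fix x assume "x \<in> orbit G (unit \<theta>)"
  then obtain a where a: "a \<in> arrows G" "gdom G a = unit \<theta>" "x = grng G a"
    unfolding orbit_def by blast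
  obtain s \<phi> where s: "s \<in> elts S" "\<phi> \<in> dom s" "a = germ S s \<phi>" using a(1) by (rule arrowE)
  then have "\<phi> = \<theta>" using a(2) assms by (simp add: unit_inject)
  then show "x \<in> {unit (dact S s \<theta>) | s. s \<in> elts S \<and> \<theta> \<in> dom s}" using s a(3) by auto
next
  fix x assume "x \<in> {unit (dact S s \<theta>) | s. s \<in> elts S \<and> \<theta> \<in> dom s}"
  then obtain s where "s \<in> elts S" "\<theta> \<in> dom s" "x = unit (dact S s \<theta>)" by blast
  then show "x \<in> orbit G (unit \<theta>)"
    unfolding orbit_def by (intro image_eqI[of _ _ "germ S s \<theta>"]) simp_all
qed

lemma orbit_invariant:
  assumes "a \<in> arrows G"
  shows "gdom G a \<in> orbit G x \<longleftrightarrow> grng G a \<in> orbit G x"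
proof
  assume "gdom G a \<in> orbit G x"
  then obtain b where b: "b \<in> arrows G" "gdom G b = x" "gdom G a = grng G b" unfolding orbit_def by blast
  then have "(a, b) \<in> composable G" using assms by (simp add: composable_iff)
  from gmult_arrow[OF this] show "grng G a \<in> orbit G x"
    using b unfolding orbit_def by (intro image_eqI[of _ _ "gmult G a b"]) auto
next
  assume "grng G a \<in> orbit G x"
  then obtain b where b: "b \<in> arrows G" "gdom G b = x" "grng G a = grng G b" unfolding orbit_def by blast
  have i: "ginv G a \<in> arrows G" "gdom G (ginv G a) = grng G a" "grng G (ginv G a) = gdom G a"
    using is_ginverse_ginv[OF assms] by (auto simp: is_ginverse_def)
  then have "(ginv G a, b) \<in> composable G" using b by (simp add: composable_iff)
  from gmult_arrow[OF this] show "gdom G a \<in> orbit G x"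
    using b i unfolding orbit_def by (intro image_eqI[of _ _ "gmult G (ginv G a) b"]) auto
qed

end

section \<open>Isotropy germs and the orbit of the empty word\<close>

context self_similar_action
begin

lemma germ_in_isotropy:
  assumes \<theta>: "\<theta> \<in> characters S" and g: "\<And>w. \<theta> (ew w) \<Longrightarrow> act g w = w"
  shows "germ S (tri [] g []) \<theta> \<in> isotropy G (unit \<theta>)"
proof -
  have d: "\<theta> \<in> charD S (ew [])" using \<theta> by (simp add: charD_iff)
  have "\<theta> (ew (act (- g) w)) \<longleftrightarrow> \<theta> (ew w)" for w
    using g[of w] g[of "act (- g) w"] by (metis act_inverse)
  then have "dact S (tri [] g []) \<theta> = \<theta>"
    using dact_tri(2)[OF d, of "[]" g] \<theta> dact_character_tri[OF d] by (intro character_eqI) auto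
  then show ?thesis
    unfolding isotropy_def using d gdom_germ[of "tri [] g []" \<theta>] grng_germ[of "tri [] g []" \<theta>]
      germ_arrow[of "tri [] g []" \<theta>] by simp
qed

text \<open>Used for elements that restrict to themselves along every word: these have pairwise
  different germs over every character.\<close>

lemma germ_tri_eqD:
  assumes "\<theta> \<in> characters S" "germ S (tri [] g []) \<theta> = germ S (tri [] h []) \<theta>"
  shows "\<exists>w. \<theta> (ew w) \<and> res g w = res h w"
proof -
  have d: "\<theta> \<in> charD S (ew [])" using assms by (simp add: charD_iff)
  obtain e where e: "e \<in> E" "\<theta> e" "tri [] g [] \<odot> e = tri [] h [] \<odot> e"
    using assms d germ_eq_iff[of "tri [] g []" \<theta> "tri [] h []" \<theta>] by auto
  obtain w where w: "e = ew w" using character_word[OF assms(1) e(1,2)] .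
  have "res g w = res h w"
    using e(3) tri_mult_left[of "[]" _ "[]" w 0 w] by (simp add: w)
  then show ?thesis using e w by blast
qed

lemma countable_character_words:
  assumes "\<theta> \<in> characters S"
  shows "countable {w. \<theta> (ew w)}"
proof (rule countableI[where f = length], rule inj_onI)
  fix v w assume "v \<in> {w. \<theta> (ew w)}" "w \<in> {w. \<theta> (ew w)}" "length v = length w"
  then show "v = w"
    using character_chain[OF assms, of v w] by (auto simp: prefix_def)
qed

lemma principal_Nil_unique:
  assumes "\<theta> \<in> characters S" "\<And>x. \<not> \<theta> (ew [x])"
  shows "\<theta> = principal []"
proof (rule character_eqI[OF assms(1)])
  fix w
  show "\<theta> (ew w) = principal [] (ew w)"
    using assms character_prefix[OF assms(1), of w "[hd w]"]
    by (cases w) (auto simp: prefix_def)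
qed (rule principal_character)

text \<open>The orbit of the empty word consists of finite words, so an infinite constant word lies
  outside. This is what makes the ideal of functions supported over that orbit proper.\<close>

lemma orbit_principal_Nil_proper: "\<exists>\<theta>\<in>characters S. unit \<theta> \<notin> orbit G (unit (principal []))"
proof -
  define y :: 'x where "y = undefined"
  define Q where "Q w \<longleftrightarrow> set w \<subseteq> {y}" for w
  have rep: "w = replicate (length w) y" if "Q w" for w
    by (rule replicate_length_same[symmetric]) (use that in \<open>auto simp: Q_def\<close>)
  have chain: "prefix v w \<or> prefix w v" if "Q v" "Q w" for v w
  proof -
    have "prefix (replicate m y) (replicate n y)" if "m \<le> n" for m n
      using that by (auto simp: prefix_def le_iff_add replicate_add)
    then show ?thesis
      using rep[OF that(1)] rep[OF that(2)] nat_le_linear[of "length v" "length w"] by metis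
  qed
  let ?\<theta> = "word_character Q"
  have \<theta>: "?\<theta> \<in> characters S"
  proof (rule word_character_in)
    show "Q []" by (simp add: Q_def)
    show "Q v" if "Q w" "prefix v w" for v w using that by (auto simp: Q_def prefix_def)
  qed (rule chain)
  moreover have "unit ?\<theta> \<notin> orbit G (unit (principal []))"
  proof
    assume "unit ?\<theta> \<in> orbit G (unit (principal []))"
    then obtain s where s: "s \<in> elts S" "principal [] \<in> dom s" "unit ?\<theta> = unit (dact S s (principal []))"
      unfolding orbit_unit[OF principal_character] by blast
    then have eq: "?\<theta> = dact S s (principal [])"
      using \<theta> dact_character by (simp add: unit_inject)
    obtain u g v where uv: "s = tri u g v"
      using s(1,2) by (cases s rule: elts_cases) (auto simp: charD_iff)
    have "v = []" using s(2) unfolding uv dom_tri by (simp add: charD_iff)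
    then have "?\<theta> = principal u"
      using eq dact_principal[of u g "[]" "[]"] unfolding uv by simp
    from fun_cong[OF this, of "ew (replicate (Suc (length u)) y)"]
    have "prefix (replicate (Suc (length u)) y) u" by (auto simp: Q_def)
    then show False using prefix_length_le by fastforce
  qed
  ultimately show ?thesis by blast
qed

end

section \<open>The action\<close>

text \<open>A letter \<open>(l, i, c)\<close> tests whether the coordinate \<open>i\<close> of a group element vanishes, and
  restriction to it moves \<open>h\<close> through \<open>\<psi> l\<close> into that coordinate, where it can be tested
  later.\<close>

abbreviation (input) "lookup \<equiv> Poly_Mapping.lookup"
abbreviation (input) "single \<equiv> Poly_Mapping.single"
abbreviation (input) "keys \<equiv> Poly_Mapping.keys"

definition letter_act ::
    "'h \<times> ('i \<Rightarrow>\<^sub>0 'c::ab_group_add) \<Rightarrow> 'l \<times> 'i \<times> 'c \<Rightarrow> 'l \<times> 'i \<times> 'c" where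
  "letter_act g x = (case x of (l, i, c) \<Rightarrow> (l, i, c + lookup (snd g) i))"

definition letter_res ::
    "('l \<Rightarrow> 'h \<Rightarrow> 'c) \<Rightarrow> 'h::zero \<times> ('i \<Rightarrow>\<^sub>0 'c::ab_group_add) \<Rightarrow> 'l \<times> 'i \<times> 'c \<Rightarrow> 'h \<times> ('i \<Rightarrow>\<^sub>0 'c)" where
  "letter_res \<psi> g x = (case x of (l, i, c) \<Rightarrow> (0, snd g + single i (\<psi> l (fst g))))"

text \<open>\<open>'h\<close> is the group \<open>H\<close>, \<open>'i\<close> the index set and
  \<open>'i \<Rightarrow>\<^sub>0 'c\<close> the group \<open>B\<close>; the label \<open>l\<close>
  of a letter selects the homomorphism, and thereby the lines to be killed.\<close>

locale line_killing_action =
  fixes \<psi> :: "'l \<Rightarrow> 'h::ab_group_add \<Rightarrow> 'c::ab_group_add"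
    and code :: "(('l \<times> 'i \<times> 'c) list \<times> ('h \<times> ('i \<Rightarrow>\<^sub>0 'c)) \<times> ('l \<times> 'i \<times> 'c) list) option \<Rightarrow> 's"
  assumes psi_add: "\<psi> l (h + h') = \<psi> l h + \<psi> l h'"
    and psi_faithful: "h \<noteq> 0 \<Longrightarrow> \<exists>l. \<psi> l h \<noteq> 0"
    and code_inj: "inj code"
    and uncountable_index: "uncountable (UNIV :: 'i set)"
    and uncountable_value: "uncountable (UNIV :: 'c set)"

sublocale line_killing_action \<subseteq> self_similar_action letter_act "letter_res \<psi>" code
  by unfold_locales
    (auto simp: letter_act_def letter_res_def psi_add single_add lookup_add code_inj add.assoc
      split: prod.splits intro: add.commute)

context line_killing_action
begin

lemma psi_zero [simp]: "\<psi> l 0 = 0"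
  using psi_add[of l 0 0] by simp

lemma letter_act_simp [simp]: "letter_act (h, b) (l, i, c) = (l, i, c + lookup b i)"
  by (simp add: letter_act_def)

lemma letter_res_simp [simp]: "letter_res \<psi> (h, b) (l, i, c) = (0, b + single i (\<psi> l h))"
  by (simp add: letter_res_def)

lemma res_snd [simp]: "res (0, b) w = (0, b)"
  by (induction w) (auto split: prod.splits)

text \<open>An element of \<open>B\<close> restricts to itself, so each letter of the word tests the
  original \<open>b\<close>.\<close>

lemma act_snd_fixed_iff:
  "act (0, b) w = w \<longleftrightarrow> (\<forall>x\<in>set w. lookup b (fst (snd x)) = 0)"
proof (induction w)
  case (Cons x w)
  then show ?case by (cases x) auto
qed simp

lemma infinite_letters: "infinite (UNIV :: ('l \<times> 'i \<times> 'c) set)"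
proof
  assume "finite (UNIV :: ('l \<times> 'i \<times> 'c) set)"
  then have "finite ((\<lambda>x :: 'l \<times> 'i \<times> 'c. snd (snd x)) ` UNIV)" by (rule finite_imageI)
  moreover have "(\<lambda>x :: 'l \<times> 'i \<times> 'c. snd (snd x)) ` UNIV = UNIV"
    by (auto simp: image_iff)
  ultimately show False using uncountable_value countable_finite by metis
qed

text \<open>The component \<open>c\<close> of a letter is free, so a letter with prescribed
  \<open>l\<close> and \<open>i\<close> can be found outside \<open>Y\<close>. If \<open>b\<close>
  is nonzero, such a letter is moved; if \<open>b = 0\<close>, it sends the \<open>H\<close>-part
  into coordinate \<open>i\<close> through \<open>\<psi> l\<close>, and a second letter detects it
  there.\<close>

lemma faithful:
  assumes "g \<noteq> 0" "finite Y"
  shows "\<exists>y z. y \<notin> Y \<and> act g (y # z) \<noteq> y # z"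
proof -
  obtain h b where g: "g = (h, b)" by (cases g)
  have fresh: "\<exists>c. (l, i, c) \<notin> Y" for l i
  proof (rule ccontr)
    assume "\<nexists>c. (l, i, c) \<notin> Y"
    then have "UNIV \<subseteq> (\<lambda>x. snd (snd x)) ` Y" by force
    then have "finite (UNIV :: 'c set)" using assms(2) finite_surj by blast
    then show False using uncountable_value countable_finite by blast
  qed
  show ?thesis
  proof (cases "b = 0")
    case False
    then obtain i where i: "lookup b i \<noteq> 0" by (metis lookup_zero poly_mapping_eqI)
    obtain c where "(undefined, i, c) \<notin> Y" using fresh by blast
    then show ?thesis using i g by (intro exI[of _ "(undefined, i, c)"]) auto
  next
    case True
    then obtain l where l: "\<psi> l h \<noteq> 0" using assms(1) psi_faithful[of h] g by (auto simp: zero_prod_def)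
    obtain c where "(l, undefined, c) \<notin> Y" using fresh by blast
    then show ?thesis using l g True
      by (intro exI[of _ "(l, undefined, c)"] exI[of _ "[(l, undefined, 0)]"]) auto
  qed
qed

text \<open>A character involves only countably many letters, so some coordinate \<open>i\<close> is not
  tested by it and yields an uncountable subgroup of its isotropy group.\<close>

theorem uncountable_isotropy:
  assumes "x \<in> units G"
  shows "uncountable (isotropy G x)"
proof -
  obtain \<theta> where \<theta>: "\<theta> \<in> characters S" "x = unit \<theta>" using assms unfolding units_eq by blast
  have "countable (\<Union>w\<in>{w. \<theta> (ew w)}. (\<lambda>x. fst (snd x)) ` set w)"
    by (intro countable_UN countable_image countable_character_words[OF \<theta>(1)] countable_finite finite_set)
  then have "(\<Union>w\<in>{w. \<theta> (ew w)}. (\<lambda>x. fst (snd x)) ` set w) \<noteq> UNIV"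
    using uncountable_index by metis
  then obtain i where i: "i \<notin> (\<Union>w\<in>{w. \<theta> (ew w)}. (\<lambda>x. fst (snd x)) ` set w)"
    by blast
  define f where "f c = germ S (tri [] (0, single i c) []) \<theta>" for c
  have "f c \<in> isotropy G x" for c
    unfolding f_def \<theta>(2) using i
    by (intro germ_in_isotropy[OF \<theta>(1)]) (auto simp: act_snd_fixed_iff lookup_single when_def)
  then have "range f \<subseteq> isotropy G x" by blast
  moreover have "inj f"
  proof (rule injI)
    fix c c' assume "f c = f c'"
    then have "single i c = single i c'"
      using germ_tri_eqD[OF \<theta>(1), of "(0, single i c)" "(0, single i c')"]
      unfolding f_def by auto
    then show "c = c'" by (metis lookup_single_eq)
  qed
  then have "uncountable (range f)"
    using uncountable_value countable_image_inj_on by blast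
  ultimately show ?thesis using countable_subset by blast
qed

lemma not_topologically_principal: "\<not> topologically_principal G"
proof -
  have "isotropy G x \<noteq> {x}" if "x \<in> units G" for x
    using uncountable_isotropy[OF that] by (metis countable_finite finite.emptyI finite.insertI)
  then have "{x \<in> units G. isotropy G x = {x}} = {}" by blast
  moreover have "units G \<noteq> {}" unfolding units_eq using principal_character by blast
  ultimately show ?thesis unfolding topologically_principal_def by (simp only: closure_of_empty)
qed

section \<open>Simplicity\<close>

lemma tri_mult_identity:
  assumes "s \<in> elts S"
  shows "s \<cdot>\<^bsub>S\<^esub> ew [] = s"
  using assms
proof (cases rule: elts_cases)
  case 1
  then show ?thesis by (simp add: tri_def)
next
  case (2 u g v)
  then show ?thesis using tri_mult_right[of u g "[]" v 0 "[]"] by simp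
qed

text \<open>Compression by \<open>u\<^sub>0x\<close> and \<open>v\<^sub>0x\<close> for a fresh letter \<open>x\<close> fixed by all elements
  involved kills every term except those of the form \<open>u\<^sub>0gv\<^sub>0\<^sup>*\<close>.\<close>

lemma tri_compress:
  assumes len: "length v0 \<le> length v" "v = v0 \<Longrightarrow> length u0 \<le> length u"
    and fresh: "(l, i, 0) \<notin> set u" "(l, i, 0) \<notin> set v" "lookup b i = 0"
  shows "tri [] 0 (u0 @ [(l, i, 0)]) \<cdot>\<^bsub>S\<^esub> (tri u (h, b) v \<cdot>\<^bsub>S\<^esub> tri (v0 @ [(l, i, 0)]) 0 []) =
    (if u = u0 \<and> v = v0 then tri [] (0, b + single i (\<psi> l h)) [] else code None)"
proof -
  let ?x = "(l, i, 0)"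
  have np: "\<not> prefix (w0 @ [?x]) w" if "?x \<notin> set w" for w0 w
    using that by (auto simp: prefix_def)
  have pre: "prefix w (w0 @ [?x]) \<longleftrightarrow> w = w0" if "?x \<notin> set w" "length w0 \<le> length w" for w0 w
    using that by (auto simp: prefix_snoc) (auto simp: prefix_def)
  show ?thesis
  proof (cases "v = v0")
    case False
    then have "tri u (h, b) v \<cdot>\<^bsub>S\<^esub> tri (v0 @ [?x]) 0 [] = code None"
      using pre[of v v0] np[of v v0] fresh len by (intro tri_mult_zero) auto
    then show ?thesis using False mult_zero(2)[of "tri [] 0 (u0 @ [?x])"] by simp
  next
    case v: True
    have 1: "tri u (h, b) v \<cdot>\<^bsub>S\<^esub> tri (v0 @ [?x]) 0 [] =
        tri (u @ [?x]) (0, b + single i (\<psi> l h)) []"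
      unfolding v tri_mult_left using fresh(3) by simp
    show ?thesis
    proof (cases "u = u0")
      case True
      then show ?thesis unfolding 1 using v by simp
    next
      case False
      have "\<not> prefix (u0 @ [?x]) (u @ [?x])" "\<not> prefix (u @ [?x]) (u0 @ [?x])"
        using False np[of u u0] fresh len(2)[OF v] by (auto simp: prefix_snoc dest: prefix_length_le)
      then show ?thesis unfolding 1 using False by (simp add: tri_mult_zero)
    qed
  qed
qed

text \<open>Different words of equal length are incomparable, so compression by \<open>w\<close>
  gives zero unless \<open>act (0, b) w = w\<close>; since elements of \<open>B\<close> restrict to
  themselves, a surviving element is unchanged.\<close>

lemma tri_test:
  "tri [] 0 w \<cdot>\<^bsub>S\<^esub> (tri [] (0, b) [] \<cdot>\<^bsub>S\<^esub> tri w 0 []) =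
    (if \<forall>x\<in>set w. lookup b (fst (snd x)) = 0 then tri [] (0, b) [] else code None)"
proof -
  have 1: "tri [] (0, b) [] \<cdot>\<^bsub>S\<^esub> tri w 0 [] = tri (act (0, b) w) (0, b) []"
    using tri_mult_left[of "[]" "(0, b)" "[]" w 0 "[]"] by (simp add: zero_prod_def)
  show ?thesis
  proof (cases "act (0, b) w = w")
    case True
    have "tri [] 0 w \<cdot>\<^bsub>S\<^esub> tri (act (0, b) w) (0, b) [] = tri [] (0, b) []"
      unfolding True by simp
    then show ?thesis unfolding 1 using iffD1[OF act_snd_fixed_iff True] by simp
  next
    case False
    have "\<not> prefix v v'" if "length v = length v'" "v \<noteq> v'" for v v' :: "('l \<times> 'i \<times> 'c) list"
      using that by (auto simp: prefix_def)
    from this[of w "act (0, b) w"] this[of "act (0, b) w" w] False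
    have "\<not> prefix w (act (0, b) w)" "\<not> prefix (act (0, b) w) w" by simp_all
    then show ?thesis using False unfolding 1 by (simp add: tri_mult_zero act_snd_fixed_iff)
  qed
qed

text \<open>Compression on both sides acts as a sieve on the terms of \<open>f\<close>:
  \<open>?s0\<close> and \<open>?t0\<close> keep a single pair of outer words, the factor with
  \<open>- (0, b1)\<close> shifts the selected group element to \<open>0\<close>, and the test word
  \<open>W\<close> removes all others. What remains is one fibre sum times the function of
  \<open>ew []\<close>, and the hypothesis provides \<open>l\<close> and \<open>k\<close> for which
  the sum is nonzero.\<close>

lemma identity_in_ideal:
  fixes I :: "(('s \<times> ('s \<Rightarrow> bool)) set \<Rightarrow> 'k::field) set"
  assumes fibre: "\<And>(f :: 'h \<Rightarrow> 'k) D h0. finite D \<Longrightarrow> h0 \<in> D \<Longrightarrow> f h0 \<noteq> 0 \<Longrightarrow>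
      \<exists>l k. (\<Sum>h\<in>{h \<in> D. \<psi> l h = k}. f h) \<noteq> 0"
    and I: "two_sided_ideal A (convolution G) I" and f: "f \<in> I" "f \<noteq> (\<lambda>_. 0)"
  shows "ind (ew []) \<in> I"
proof -
  have "f \<in> A" using I f(1) by (auto simp: two_sided_ideal_def)
  then obtain T c where T: "finite T" "T \<subseteq> elts S - {code None}" "\<And>r. r \<in> T \<Longrightarrow> c r \<noteq> 0"
    "f = (\<lambda>x. \<Sum>r\<in>T. c r * ind r x)"
    by (rule steinberg_algebraE[unfolded szero_S]) (rule that)
  have tri: "\<exists>u g v. r = tri u g v" if "r \<in> T" for r
  proof -
    have "r \<in> elts S" "r \<noteq> code None" using that T(2) by auto
    then show ?thesis by (cases rule: elts_cases) auto
  qed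
  have "T \<noteq> {}" using f(2) T(4) by auto
  then have "\<exists>v u g. tri u g v \<in> T" using tri by blast
  \<comment> \<open>Minimal length, first of the right and then of the left word, is needed because
    a shorter prefix of \<open>v0\<close> or \<open>u0\<close> would not be removed by the
    compression.\<close>
  then obtain v0 where v0: "\<exists>u g. tri u g v0 \<in> T" "\<And>u g v. tri u g v \<in> T \<Longrightarrow> length v0 \<le> length v"
    using ex_has_least_nat[of "\<lambda>v. \<exists>u g. tri u g v \<in> T" _ length] by metis
  then obtain u0 where u0: "\<exists>g. tri u0 g v0 \<in> T" "\<And>u g. tri u g v0 \<in> T \<Longrightarrow> length u0 \<le> length u"
    using ex_has_least_nat[of "\<lambda>u. \<exists>g. tri u g v0 \<in> T" _ length] by metis
  obtain h0 b0 where h0: "tri u0 (h0, b0) v0 \<in> T" using u0(1) by auto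
  define Q where "Q = {(u, g, v). tri u g v \<in> T}"
  have Q: "finite Q"
    using finite_vimageI[OF T(1), of "\<lambda>(u, g, v). tri u g v"]
    by (auto simp: Q_def vimage_def inj_on_def case_prod_unfold)
  define J where "J = (\<Union>(u, g, v)\<in>Q. (\<lambda>x. fst (snd x)) ` set u \<union> (\<lambda>x. fst (snd x)) ` set v \<union> keys (snd g))"
  have "finite J" unfolding J_def using Q by auto
  \<comment> \<open>An index occurring nowhere in the terms of \<open>f\<close>: letters at
    \<open>i\<close> are fixed by all their group elements, and coordinate \<open>i\<close> is free
    to record \<open>\<psi> l h\<close>.\<close>
  then obtain i where i: "i \<notin> J"
    using uncountable_index countable_finite by (metis UNIV_eq_I)
  have fresh: "(l, i, 0) \<notin> set u \<and> (l, i, 0) \<notin> set v \<and> lookup b i = 0"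
    if "tri u (h, b) v \<in> T" for u h b v l
  proof -
    have "(u, (h, b), v) \<in> Q" using that by (simp add: Q_def)
    then have "i \<notin> (\<lambda>x. fst (snd x)) ` set u" "i \<notin> (\<lambda>x. fst (snd x)) ` set v" "i \<notin> keys b"
      using i unfolding J_def by fastforce+
    then show ?thesis
      using imageI[of "(l, i, 0)" "set u" "\<lambda>x. fst (snd x)"]
        imageI[of "(l, i, 0)" "set v" "\<lambda>x. fst (snd x)"] by (auto simp: in_keys_iff)
  qed
  define D where "D = {h. tri u0 (h, b0) v0 \<in> T}"
  have D: "finite D"
    using finite_vimageI[OF T(1), of "\<lambda>h. tri u0 (h, b0) v0"] by (auto simp: D_def vimage_def inj_on_def)
  obtain l k where lk: "(\<Sum>h\<in>{h \<in> D. \<psi> l h = k}. c (tri u0 (h, b0) v0)) \<noteq> 0"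
    using fibre[OF D, of h0 "\<lambda>h. c (tri u0 (h, b0) v0)"] h0 T(3) by (auto simp: D_def)
  define C where "C = (\<Sum>h\<in>{h \<in> D. \<psi> l h = k}. c (tri u0 (h, b0) v0))"
  define b1 where "b1 = b0 + single i k"
  \<comment> \<open>All nonzero differences to the selected element \<open>b1\<close>;
    \<open>W\<close> will contain a letter testing each of them at a coordinate where it does not
    vanish.\<close>
  define B where "B = (\<lambda>(u, g, v). snd g + single i (\<psi> l (fst g)) - b1) ` Q - {0}"
  have "finite B" using Q by (simp add: B_def)
  then obtain bs where bs: "set bs = B" using finite_list by blast
  obtain j :: "('i \<Rightarrow>\<^sub>0 'c) \<Rightarrow> 'i" where j: "\<And>b. b \<noteq> 0 \<Longrightarrow> lookup b (j b) \<noteq> 0"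
    using poly_mapping_eqI lookup_zero by metis
  define W :: "('l \<times> 'i \<times> 'c) list" where "W = map (\<lambda>b. (l, j b, 0)) bs"
  let ?s0 = "tri [] 0 (u0 @ [(l, i, 0)])" and ?t0 = "tri (v0 @ [(l, i, 0)]) 0 []"
  define s where "s = tri [] 0 W \<cdot>\<^bsub>S\<^esub> (tri [] (- (0, b1)) [] \<cdot>\<^bsub>S\<^esub> ?s0)"
  define t where "t = ?t0 \<cdot>\<^bsub>S\<^esub> tri W 0 []"
  have st: "s \<in> elts S" "t \<in> elts S" by (simp_all add: s_def t_def)
  define R where "R = (\<lambda>h. tri u0 (h, b0) v0) ` {h \<in> D. \<psi> l h = k}"
  have R: "R \<subseteq> T" by (auto simp: R_def D_def)
  have srt: "s \<cdot>\<^bsub>S\<^esub> (r \<cdot>\<^bsub>S\<^esub> t) = (if r \<in> R then ew [] else code None)" if r: "r \<in> T" for r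
  proof -
    obtain u g v where "r = tri u g v" using tri[OF r] by blast
    then obtain h b where uv: "r = tri u (h, b) v" by (cases g) auto
    note fr = fresh[OF r[unfolded uv]]
    let ?b = "b + single i (\<psi> l h)"
    have "s \<cdot>\<^bsub>S\<^esub> (r \<cdot>\<^bsub>S\<^esub> t) = tri [] 0 W \<cdot>\<^bsub>S\<^esub> (tri [] (- (0, b1)) [] \<cdot>\<^bsub>S\<^esub>
        ((?s0 \<cdot>\<^bsub>S\<^esub> (r \<cdot>\<^bsub>S\<^esub> ?t0)) \<cdot>\<^bsub>S\<^esub> tri W 0 []))"
      unfolding s_def t_def uv by (simp del: tri_mult_same)
    also have "?s0 \<cdot>\<^bsub>S\<^esub> (r \<cdot>\<^bsub>S\<^esub> ?t0) = (if u = u0 \<and> v = v0 then tri [] (0, ?b) [] else code None)"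
      unfolding uv using fr r uv v0(2) u0(2) by (intro tri_compress) auto
    finally have eq: "s \<cdot>\<^bsub>S\<^esub> (r \<cdot>\<^bsub>S\<^esub> t) = tri [] 0 W \<cdot>\<^bsub>S\<^esub> (tri [] (- (0, b1)) [] \<cdot>\<^bsub>S\<^esub>
        ((if u = u0 \<and> v = v0 then tri [] (0, ?b) [] else code None) \<cdot>\<^bsub>S\<^esub> tri W 0 []))" .
    show ?thesis
    proof (cases "u = u0 \<and> v = v0")
      case False
      then have "r \<notin> R" unfolding uv R_def by auto
      then show ?thesis unfolding eq if_not_P[OF False] using mult_zero by simp
    next
      case True
      have "tri [] (- (0, b1)) [] \<cdot>\<^bsub>S\<^esub> (tri [] (0, ?b) [] \<cdot>\<^bsub>S\<^esub> tri W 0 []) =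
          tri [] (0, ?b - b1) [] \<cdot>\<^bsub>S\<^esub> tri W 0 []"
        using mult_assoc[of "tri [] (- (0, b1)) []" "tri [] (0, ?b) []" "tri W 0 []", symmetric]
        by (simp add: algebra_simps)
      then have "s \<cdot>\<^bsub>S\<^esub> (r \<cdot>\<^bsub>S\<^esub> t) =
          (if \<forall>x\<in>set W. lookup (?b - b1) (fst (snd x)) = 0 then tri [] (0, ?b - b1) [] else code None)"
        unfolding eq using True tri_test[of W "?b - b1"] by simp
      moreover have "(\<forall>x\<in>set W. lookup (?b - b1) (fst (snd x)) = 0) \<longleftrightarrow> ?b = b1"
      proof
        assume *: "\<forall>x\<in>set W. lookup (?b - b1) (fst (snd x)) = 0"
        show "?b = b1"
        proof (rule ccontr)
          assume "?b \<noteq> b1"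
          then have "?b - b1 \<in> B"
            using r unfolding B_def Q_def uv by (auto intro!: image_eqI[of _ _ "(u, (h, b), v)"])
          then have "(l, j (?b - b1), 0) \<in> set W" unfolding W_def using bs by simp
          then show False using * j[of "?b - b1"] \<open>?b \<noteq> b1\<close> by auto
        qed
      qed simp
      \<comment> \<open>Neither \<open>b\<close> nor \<open>b0\<close> has a component at
        \<open>i\<close>, so \<open>?b\<close> determines both \<open>b\<close> and
        \<open>\<psi> l h\<close>.\<close>
      moreover have "?b = b1 \<longleftrightarrow> b = b0 \<and> \<psi> l h = k"
      proof
        assume eq: "?b = b1"
        have "lookup ?b i = \<psi> l h" "lookup b1 i = k"
          using fr fresh[OF h0] by (simp_all add: lookup_add b1_def)
        then have "\<psi> l h = k" using eq by simp
        then show "b = b0 \<and> \<psi> l h = k" using eq by (simp add: b1_def)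
      qed (simp add: b1_def)
      moreover have "r \<in> R \<longleftrightarrow> b = b0 \<and> \<psi> l h = k"
        using True r unfolding uv R_def D_def by auto
      ultimately show ?thesis by (auto simp: zero_prod_def)
    qed
  qed
  have "convolution G (ind s) (convolution G f (ind t)) = (\<lambda>x. \<Sum>r\<in>T. c r * ind (s \<cdot>\<^bsub>S\<^esub> (r \<cdot>\<^bsub>S\<^esub> t)) x)"
    unfolding T(4) using st T(2) by (intro convolution_ind_sum) auto
  also have "\<dots> = (\<lambda>x. \<Sum>r\<in>T. if r \<in> R then c r * ind (ew []) x else 0)"
    using srt by (intro ext sum.cong) (auto simp: ind_zero[unfolded szero_S])
  also have "\<dots> = (\<lambda>x. \<Sum>r\<in>R. c r * ind (ew []) x)"
    using R T(1) by (simp add: sum.If_cases Int_absorb1)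
  also have "\<dots> = (\<lambda>x. C * ind (ew []) x)"
    unfolding R_def C_def by (subst sum.reindex) (auto simp: inj_on_def sum_distrib_right)
  finally have eq: "convolution G (ind s) (convolution G f (ind t)) = (\<lambda>x. C * ind (ew []) x)" .
  have mult: "convolution G a g \<in> I \<and> convolution G g a \<in> I" if "a \<in> A" "g \<in> I" for a g
    using I that unfolding two_sided_ideal_def by blast
  have "(\<lambda>x. C * ind (ew []) x) \<in> I"
    unfolding eq[symmetric] by (simp add: mult f(1) ind_in_algebra st)
  have scale: "(\<lambda>x. d * g x) \<in> I" if "g \<in> I" for d g
    using I that unfolding two_sided_ideal_def by blast
  have "(\<lambda>x. 1 / C * (C * ind (ew []) x)) \<in> I"
    by (rule scale) fact
  then show ?thesis using lk by (simp add: C_def mult.assoc[symmetric])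
qed

lemma ind_identity_nonzero:
  assumes "\<theta> \<in> characters S"
  shows "ind (ew []) (unit \<theta>) = 1"
  using assms unit_eq[of "ew []" \<theta>] ind_germ_self[of \<theta> "ew []"] by (simp add: charD_iff)

theorem simple_if_fibre_sums_nonzero:
  assumes "\<And>(f :: 'h \<Rightarrow> 'k::field) D h0. finite D \<Longrightarrow> h0 \<in> D \<Longrightarrow> f h0 \<noteq> 0 \<Longrightarrow>
      \<exists>l k. (\<Sum>h\<in>{h \<in> D. \<psi> l h = k}. f h) \<noteq> 0"
  shows "simple_algebra (A :: (_ \<Rightarrow> 'k) set) (convolution G)"
  unfolding simple_algebra_def
proof (intro conjI allI impI)
  have "(ind (ew []) :: _ \<Rightarrow> 'k) \<noteq> (\<lambda>_. 0)"
    using ind_identity_nonzero[OF principal_character] by (metis zero_neq_one)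
  then show "(A :: (_ \<Rightarrow> 'k) set) \<noteq> {\<lambda>_. 0}" using ind_in_algebra[of "ew []"] by auto
  fix I :: "(_ \<Rightarrow> 'k) set" assume I: "two_sided_ideal A (convolution G) I"
  show "I = {\<lambda>_. 0} \<or> I = A"
  proof (cases "I = {\<lambda>_. 0}")
    case False
    then obtain f where f: "f \<in> I" "f \<noteq> (\<lambda>_. 0)" using I unfolding two_sided_ideal_def by blast
    have one: "ind (ew []) \<in> I"
    proof (rule identity_in_ideal)
      show "\<exists>l k. (\<Sum>h\<in>{h \<in> D. \<psi> l h = k}. f h) \<noteq> 0" if "finite D" "h0 \<in> D" "f h0 \<noteq> 0"
        for f :: "'h \<Rightarrow> 'k" and D h0
        using assms that .
    qed (rule I f)+
    have "a \<in> I" if "a \<in> A" for a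
    proof -
      have "convolution G a (ind (ew [])) \<in> I" using I one that unfolding two_sided_ideal_def by blast
      moreover have "convolution G a (ind (ew [])) = a"
        by (rule convolution_ind_identity[OF ew_idem tri_mult_identity that])
      ultimately show ?thesis by simp
    qed
    then show ?thesis using I unfolding two_sided_ideal_def by blast
  qed simp
qed

text \<open>The functions vanishing outside the orbit of the character \<open>principal []\<close> form an ideal. It
  contains \<open>\<Sum>\<^sub>h [h]\<close>, because off that character germs only depend on \<open>\<psi> l h\<close> for some
  \<open>l\<close>.\<close>

theorem not_simple_if_fibres_vanish:
  assumes D: "finite D" "D \<noteq> {}" and fibre: "\<And>l k. of_nat (card {h \<in> D. \<psi> l h = k}) = (0 :: 'k::field)"
  shows "\<not> simple_algebra (A :: (_ \<Rightarrow> 'k) set) (convolution G)"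
proof
  assume simple: "simple_algebra (A :: (_ \<Rightarrow> 'k) set) (convolution G)"
  let ?O = "orbit G (unit (principal []))"
  define I :: "(_ \<Rightarrow> 'k) set" where "I = {f \<in> A. \<forall>a\<in>arrows G. gdom G a \<in> - ?O \<longrightarrow> f a = 0}"
  have ideal: "two_sided_ideal A (convolution G) I"
    unfolding I_def by (rule two_sided_ideal_vanishing) (simp add: orbit_invariant)
  define \<tau> where "\<tau> h = tri [] (h, 0) []" for h
  have inj: "inj \<tau>" by (auto simp: \<tau>_def inj_def)
  define f :: "_ \<Rightarrow> 'k" where "f = (\<lambda>x. \<Sum>r\<in>\<tau> ` D. 1 * ind r x)"
  have f: "f x = (\<Sum>h\<in>D. ind (\<tau> h) x)" for x
    unfolding f_def using inj by (simp add: sum.reindex inj_on_subset[OF inj])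
  have fA: "f \<in> A" unfolding f_def by (rule steinberg_algebra_sum) (auto simp: \<tau>_def)
  have f_germ: "f (germ S t \<theta>) = (\<Sum>h\<in>D. of_bool (\<exists>e\<in>E. \<theta> e \<and> \<tau> h \<cdot>\<^bsub>S\<^esub> e = t \<cdot>\<^bsub>S\<^esub> e))"
    if "t \<in> elts S" "\<theta> \<in> dom t" for t \<theta>
    using that by (simp add: f ind_germ \<tau>_def)
  have "f a = 0" if a: "a \<in> arrows G" "gdom G a \<notin> ?O" for a
  proof -
    obtain t \<theta> where t: "t \<in> elts S" "\<theta> \<in> dom t" "a = germ S t \<theta>" using a(1) by (rule arrowE)
    have \<theta>: "\<theta> \<in> characters S" using t(2) by simp
    have "\<theta> \<noteq> principal []"
    proof
      assume "\<theta> = principal []"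
      moreover have "gdom G (unit \<theta>) \<in> orbit G (unit \<theta>)"
        using \<theta> unfolding orbit_def by (intro image_eqI[of _ _ "unit \<theta>"]) auto
      ultimately show False using a(2) t \<theta> by simp
    qed
    \<comment> \<open>A character other than the empty word passes through a letter, and
      \<open>\<psi> l\<close>, for its label \<open>l\<close>, is all that germs at this character
      retain of \<open>h\<close>.\<close>
    then obtain l i d where x: "\<theta> (ew [(l, i, d)])"
      using principal_Nil_unique[OF \<theta>] by (metis prod_cases3)
    let ?x = "[(l, i, d)]"
    define Q where "Q h \<longleftrightarrow> (\<exists>e\<in>E. \<theta> e \<and> \<tau> h \<cdot>\<^bsub>S\<^esub> e = t \<cdot>\<^bsub>S\<^esub> e)" for h
    have Q: "Q h'" if h: "Q h" "\<psi> l h = \<psi> l h'" for h h'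
    proof -
      obtain e where e: "e \<in> E" "\<theta> e" "\<tau> h \<cdot>\<^bsub>S\<^esub> e = t \<cdot>\<^bsub>S\<^esub> e" using h(1) unfolding Q_def by blast
      have "\<tau> h \<cdot>\<^bsub>S\<^esub> ew ?x = \<tau> h' \<cdot>\<^bsub>S\<^esub> ew ?x"
        using h(2) tri_mult_left[of "[]" _ "[]" ?x 0 ?x] by (simp add: \<tau>_def)
      then have "\<tau> h' \<cdot>\<^bsub>S\<^esub> (ew ?x \<cdot>\<^bsub>S\<^esub> e) = \<tau> h \<cdot>\<^bsub>S\<^esub> (ew ?x \<cdot>\<^bsub>S\<^esub> e)"
        using mult_assoc[of "\<tau> h'" "ew ?x" e] mult_assoc[of "\<tau> h" "ew ?x" e] e(1) by (simp add: \<tau>_def)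
      also have "\<dots> = \<tau> h \<cdot>\<^bsub>S\<^esub> e \<cdot>\<^bsub>S\<^esub> ew ?x"
        unfolding idem_commute[OF ew_idem e(1)] using e(1) by (simp add: \<tau>_def)
      also have "\<dots> = t \<cdot>\<^bsub>S\<^esub> (ew ?x \<cdot>\<^bsub>S\<^esub> e)"
        unfolding e(3) idem_commute[OF ew_idem e(1)] using e(1) t(1) by simp
      finally show ?thesis
        unfolding Q_def using x e \<theta> by (intro bexI[of _ "ew ?x \<cdot>\<^bsub>S\<^esub> e"]) (auto simp: character_mult idem_prod_idem)
    qed
    have "f a = (\<Sum>h\<in>D. of_bool (Q h))" using f_germ t by (simp add: Q_def)
    also have "\<dots> = (\<Sum>k\<in>\<psi> l ` D. \<Sum>h\<in>{h \<in> D. \<psi> l h = k}. of_bool (Q h))"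
      using D(1) by (rule sum.image_gen)
    also have "\<dots> = 0"
    proof (rule sum.neutral, rule ballI)
      fix k assume "k \<in> \<psi> l ` D"
      then obtain h0 where h0: "\<psi> l h0 = k" by blast
      have "(\<Sum>h\<in>{h \<in> D. \<psi> l h = k}. of_bool (Q h)) = (\<Sum>h\<in>{h \<in> D. \<psi> l h = k}. (of_bool (Q h0) :: 'k))"
      proof (rule sum.cong[OF refl])
        fix h assume "h \<in> {h \<in> D. \<psi> l h = k}"
        then have "Q h = Q h0" using Q[of h h0] Q[of h0 h] h0 by auto
        then show "of_bool (Q h) = (of_bool (Q h0) :: 'k)" by simp
      qed
      also have "\<dots> = 0" using fibre by (simp add: sum_constant)
      finally show "(\<Sum>h\<in>{h \<in> D. \<psi> l h = k}. of_bool (Q h)) = (0 :: 'k)" .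
    qed
    finally show ?thesis .
  qed
  then have "f \<in> I" using fA by (simp add: I_def)
  moreover have "f \<noteq> (\<lambda>_. 0)"
  proof -
    obtain h0 where h0: "h0 \<in> D" using D(2) by blast
    let ?\<theta> = "principal []"
    have dom: "?\<theta> \<in> dom (\<tau> h0)"
      unfolding \<tau>_def dom_tri charD_iff by (intro conjI principal_character) simp
    \<comment> \<open>At the empty word only \<open>ew []\<close> has the value \<open>True\<close>,
      so germs of different elements stay different.\<close>
    have key: "(\<exists>e\<in>E. ?\<theta> e \<and> \<tau> h \<cdot>\<^bsub>S\<^esub> e = \<tau> h0 \<cdot>\<^bsub>S\<^esub> e) \<longleftrightarrow> h = h0" for h
    proof
      assume "\<exists>e\<in>E. ?\<theta> e \<and> \<tau> h \<cdot>\<^bsub>S\<^esub> e = \<tau> h0 \<cdot>\<^bsub>S\<^esub> e"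
      then obtain e where e: "e \<in> E" "?\<theta> e" "\<tau> h \<cdot>\<^bsub>S\<^esub> e = \<tau> h0 \<cdot>\<^bsub>S\<^esub> e" by blast
      obtain w where w: "e = ew w" using character_word[OF principal_character e(1,2)] .
      then have "w = []" using e(2) by simp
      then show "h = h0" using e(3) by (simp add: w \<tau>_def)
    qed (auto intro!: bexI[of _ "ew []"])
    have "f (germ S (\<tau> h0) ?\<theta>) = (\<Sum>h\<in>D. of_bool (h = h0))"
      using f_germ[OF _ dom] unfolding key by (simp add: \<tau>_def)
    also have "\<dots> = 1" using D(1) h0 by (simp add: of_bool_def)
    finally show ?thesis by (metis zero_neq_one)
  qed
  \<comment> \<open>If the ideal were everything it would contain \<open>ind (ew [])\<close>, which
    is \<open>1\<close> at the units outside the orbit.\<close>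
  ultimately have "I = A" using simple ideal unfolding simple_algebra_def by blast
  then have "ind (ew []) \<in> I" using ind_in_algebra[of "ew []"] by simp
  moreover obtain \<theta> where \<theta>: "\<theta> \<in> characters S" "unit \<theta> \<notin> ?O" using orbit_principal_Nil_proper by blast
  ultimately have "ind (ew []) (unit \<theta>) = (0 :: 'k)"
    unfolding I_def using unit_arrow[OF \<theta>(1)] by auto
  then show False by (simp add: ind_identity_nonzero[OF \<theta>(1)])
qed

end

section \<open>Coding into sequences\<close>

lemma inj_fun_codeI:
  fixes f :: "'a \<Rightarrow> nat \<Rightarrow> nat"
  assumes "\<And>x y. (\<And>n. f x n = f y n) \<Longrightarrow> x = y"
  shows "inj f"
  by (rule injI, rule assms) (simp add: fun_eq_iff)

text \<open>Two sequences of naturals are merged entry by entry with a pairing function; lists and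
  options are coded entrywise in the same manner.\<close>

lemma code_prod:
  assumes "\<exists>f :: 'a \<Rightarrow> nat \<Rightarrow> nat. inj f" "\<exists>g :: 'b \<Rightarrow> nat \<Rightarrow> nat. inj g"
  shows "\<exists>f :: 'a \<times> 'b \<Rightarrow> nat \<Rightarrow> nat. inj f"
proof -
  obtain f :: "'a \<Rightarrow> nat \<Rightarrow> nat" and g :: "'b \<Rightarrow> nat \<Rightarrow> nat" where fg: "inj f" "inj g"
    using assms by blast
  have "inj (\<lambda>p n. prod_encode (f (fst p) n, g (snd p) n))"
  proof (rule inj_fun_codeI)
    fix x y :: "'a \<times> 'b"
    assume "prod_encode (f (fst x) n, g (snd x) n) = prod_encode (f (fst y) n, g (snd y) n)" for n
    then have "f (fst x) = f (fst y)" "g (snd x) = g (snd y)" by (simp_all add: fun_eq_iff)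
    then show "x = y" using fg by (auto simp: inj_eq prod_eq_iff)
  qed
  then show ?thesis by blast
qed

text \<open>The list decoded from any single entry already has the length of \<open>xs\<close>, so
  the elements can be compared position by position.\<close>

lemma code_list:
  assumes "\<exists>f :: 'a \<Rightarrow> nat \<Rightarrow> nat. inj f"
  shows "\<exists>f :: 'a list \<Rightarrow> nat \<Rightarrow> nat. inj f"
proof -
  obtain f :: "'a \<Rightarrow> nat \<Rightarrow> nat" where f: "inj f" using assms by blast
  have "inj (\<lambda>xs n. list_encode (map (\<lambda>x. f x n) xs))"
  proof (rule inj_fun_codeI)
    fix xs ys :: "'a list"
    assume *: "list_encode (map (\<lambda>x. f x n) xs) = list_encode (map (\<lambda>x. f x n) ys)" for n
    have eq: "map (\<lambda>x. f x n) xs = map (\<lambda>x. f x n) ys" for n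
      using *[of n] by (simp add: list_encode_eq)
    then have len: "length xs = length ys" using map_eq_imp_length_eq by blast
    show "xs = ys"
    proof (rule nth_equalityI[OF len])
      fix i assume i: "i < length xs"
      have "f (xs ! i) n = f (ys ! i) n" for n
        using arg_cong[OF eq, of "\<lambda>l. l ! i" n] i len by simp
      then show "xs ! i = ys ! i" by (intro injD[OF f] ext)
    qed
  qed
  then show ?thesis by blast
qed

lemma code_option:
  assumes "\<exists>f :: 'a \<Rightarrow> nat \<Rightarrow> nat. inj f"
  shows "\<exists>f :: 'a option \<Rightarrow> nat \<Rightarrow> nat. inj f"
proof -
  obtain f :: "'a \<Rightarrow> nat \<Rightarrow> nat" where f: "inj f" using assms by blast
  have "inj (\<lambda>x n. case x of None \<Rightarrow> 0 | Some a \<Rightarrow> Suc (f a n))"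
  proof (rule inj_fun_codeI)
    fix x y :: "'a option"
    assume "(case x of None \<Rightarrow> 0 | Some a \<Rightarrow> Suc (f a n)) = (case y of None \<Rightarrow> 0 | Some a \<Rightarrow> Suc (f a n))" for n
    then show "x = y"
      by (cases x; cases y) (auto intro!: injD[OF f] ext)
  qed
  then show ?thesis by blast
qed

text \<open>A finitely supported function is determined by its finite graph, which is listed in an
  arbitrary order.\<close>

lemma code_poly_mapping:
  assumes "\<exists>f :: 'a \<Rightarrow> nat \<Rightarrow> nat. inj f" "\<exists>g :: 'b::zero \<Rightarrow> nat \<Rightarrow> nat. inj g"
  shows "\<exists>f :: ('a \<Rightarrow>\<^sub>0 'b) \<Rightarrow> nat \<Rightarrow> nat. inj f"
proof -
  obtain f :: "('a \<times> 'b) list \<Rightarrow> nat \<Rightarrow> nat" where f: "inj f"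
    using code_list[OF code_prod[OF assms]] by blast
  define graph where "graph m = (\<lambda>a. (a, lookup m a)) ` keys m" for m :: "'a \<Rightarrow>\<^sub>0 'b"
  define l where "l m = (SOME xs. set xs = graph m)" for m
  have l: "set (l m) = graph m" for m
    unfolding l_def by (rule someI_ex) (simp add: graph_def finite_list)
  have "inj l"
  proof (rule injI)
    fix m m' assume "l m = l m'"
    then have eq: "graph m = graph m'" using l by metis
    have lookup: "lookup m a = b \<longleftrightarrow> (a, b) \<in> graph m" if "b \<noteq> 0" for m a b
      using that by (auto simp: graph_def in_keys_iff)
    show "m = m'"
    proof (rule poly_mapping_eqI)
      show "lookup m a = lookup m' a" for a
        using lookup[of _ m a] lookup[of _ m' a] eq by metis
    qed
  qed
  then have "inj (f \<circ> l)" using f by (intro inj_compose)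
  then show ?thesis by blast
qed

lemma code_cyclic_product: "\<exists>f :: cyclic_product \<Rightarrow> nat \<Rightarrow> nat. inj f"
proof -
  have "inj (\<lambda>x n. to_nat (coord x n))"
    by (rule inj_fun_codeI) (auto intro: cyclic_product_eqI)
  then show ?thesis by blast
qed

lemma uncountable_sequences: "uncountable (UNIV :: (nat \<Rightarrow> nat) set)"
proof
  assume "countable (UNIV :: (nat \<Rightarrow> nat) set)"
  obtain f :: "cyclic_product \<Rightarrow> nat \<Rightarrow> nat" where "inj f" using code_cyclic_product by blast
  moreover have "countable (range f)" using countable_subset[OF subset_UNIV \<open>countable UNIV\<close>] .
  ultimately show False using uncountable_cyclic_product countable_image_inj_on by blast
qed

theorem theorem6p14:
  fixes P :: "nat set"
  assumes "infinite P" and "\<forall>p\<in>P. prime p"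
  shows "\<exists>G :: ((nat \<Rightarrow> nat) \<times> ((nat \<Rightarrow> nat) \<Rightarrow> bool)) set top_groupoid.
    ample_groupoid G \<and> minimal_groupoid G \<and> effective_groupoid G \<and>
    (simple_algebra (steinberg_algebra G :: (_ \<Rightarrow> 'k::field) set) (convolution G)
       \<longleftrightarrow> CHAR('k) \<notin> P) \<and>
    (\<forall>x\<in>units G. uncountable (isotropy G x)) \<and>
    \<not> topologically_principal G \<and>
    (\<exists>S :: (nat \<Rightarrow> nat) semigroup_zero. inverse_semigroup_zero S \<and> G = universal_groupoid S)"
proof -
  have seq: "\<exists>f :: (nat \<Rightarrow> nat) \<Rightarrow> nat \<Rightarrow> nat. inj f" by (rule exI[of _ id]) simp
  note codes = seq code_cyclic_product code_prod code_list code_option code_poly_mapping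
  have "\<exists>f :: (((nat \<Rightarrow> nat) \<times> (nat \<Rightarrow> nat) \<times> cyclic_product \<times> cyclic_product) list \<times>
      ((cyclic_product \<times> cyclic_product) \<times> ((nat \<Rightarrow> nat) \<Rightarrow>\<^sub>0 cyclic_product \<times> cyclic_product)) \<times>
      ((nat \<Rightarrow> nat) \<times> (nat \<Rightarrow> nat) \<times> cyclic_product \<times> cyclic_product) list) option \<Rightarrow> nat \<Rightarrow> nat. inj f"
    by (intro codes)
  then obtain code :: "(((nat \<Rightarrow> nat) \<times> (nat \<Rightarrow> nat) \<times> cyclic_product \<times> cyclic_product) list \<times>
      ((cyclic_product \<times> cyclic_product) \<times> ((nat \<Rightarrow> nat) \<Rightarrow>\<^sub>0 cyclic_product \<times> cyclic_product)) \<times>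
      ((nat \<Rightarrow> nat) \<times> (nat \<Rightarrow> nat) \<times> cyclic_product \<times> cyclic_product) list) option \<Rightarrow> nat \<Rightarrow> nat"
    where code: "inj code" by blast
  have "uncountable (range (\<lambda>x :: cyclic_product. (x, x)))"
    using uncountable_cyclic_product countable_image_inj_on[of "\<lambda>x :: cyclic_product. (x, x)" UNIV]
    by (auto simp: inj_def)
  then have "uncountable (UNIV :: (cyclic_product \<times> cyclic_product) set)"
    using countable_subset[OF subset_UNIV] by blast
  \<comment> \<open>A label is a family of directions, one for each modulus; the indices are
    sequences of naturals, and the coordinates of \<open>B\<close> take values in \<open>H\<close>
    itself.\<close>
  then interpret line_killing_action "psi P" code
    using psi_add psi_faithful code uncountable_sequences by unfold_locales
  have "simple_algebra (A :: (_ \<Rightarrow> 'k) set) (convolution G)" if char: "CHAR('k) \<notin> P"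
  proof (rule simple_if_fibre_sums_nonzero)
    fix f :: "cyclic_product \<times> cyclic_product \<Rightarrow> 'k" and D h0
    assume "finite D" "h0 \<in> D" "f h0 \<noteq> 0"
    moreover have "prime p \<and> of_nat p \<noteq> (0 :: 'k)" if p: "p \<in> P" for p
    proof -
      have "prime p" using assms(2) p by blast
      moreover have "of_nat p \<noteq> (0 :: 'k)"
      proof
        assume "of_nat p = (0 :: 'k)"
        then have "CHAR('k) dvd p" by (simp add: of_nat_eq_0_iff_char_dvd)
        then have "CHAR('k) = p" using \<open>prime p\<close> CHAR_not_1' by (metis One_nat_def prime_nat_iff)
        then show False using char p by simp
      qed
      ultimately show ?thesis by blast
    qed
    ultimately show "\<exists>l k. (\<Sum>h\<in>{h \<in> D. psi P l h = k}. f h) \<noteq> 0"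
      by (intro psi_fibre_sums_nonzero)
  qed
  moreover have "\<not> simple_algebra (A :: (_ \<Rightarrow> 'k) set) (convolution G)" if char: "CHAR('k) \<in> P"
  proof -
    obtain D where "finite D" "D \<noteq> {}" "\<And>l k. of_nat (card {h \<in> D. psi P l h = k}) = (0 :: 'k)"
      using psi_fibre_sums_zero[of "CHAR('k)" P, where 'k = 'k] assms(2) char of_nat_CHAR by blast
    then show ?thesis by (rule not_simple_if_fibres_vanish)
  qed
  ultimately have "simple_algebra (A :: (_ \<Rightarrow> 'k) set) (convolution G) \<longleftrightarrow> CHAR('k) \<notin> P" by blast
  moreover have "minimal_groupoid G" by (rule minimal[OF infinite_letters])
  moreover have "effective_groupoid G" by (rule effective[OF infinite_letters faithful])
  ultimately show ?thesis
    using ample_universal_groupoid uncountable_isotropy not_topologically_principal inverse_semigroup_zero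
    by (intro exI[of _ G]) blast
qed

end
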